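(* For all integers $k\geq 2$ and $r\geq 3$ there exists $n_1=n_1(k,r)$ such that for all $n\geq n_1$ one has $\phi(n,F_{k,r})=\mathrm{ex}(n,F_{k,r})$. Moreover, for all $n\ge n_1$, the only graphs $G$ on $n$ vertices with $\phi(G,F_{k,r})=\mathrm{ex}(n,F_{k,r})$ are the extremal graphs for $F_{k,r}$ on $n$ vertices.
   Context: All graphs are finite and simple, and $e(G)$ denotes the number of edges of $G$. For $k\geq 2$ and $r\geq 3$, the $(k,r)$-fan $F_{k,r}$ is the graph on $(r-1)k+1$ vertices consisting of $k$ copies of the complete graph $K_r$ which intersect in exactly one common vertex (any two of these copies share that vertex and nothing else). For a fixed graph $H$, $\mathrm{ex}(n,H)$ is the maximum number of edges of a graph on $n$ vertices that does not contain $H$ as a (not necessarily induced) subgraph; an extremal graph for $H$ on $n$ vertices is a graph with $n$ vertices and $\mathrm{ex}(n,H)$ edges that does not contain $H$ as a subgraph. An $H$-decomposition of a graph $G$ is a partition of $E(G)$ such that every part is either a single edge or forms a graph isomorphic to $H$. $\phi(G,H)$ is the smallest number of parts in an $H$-decomposition of $G$, and $\phi(n,H)=\max\{\phi(G,H): G \text{ is a graph on } n \text{ vertices}\}$. *)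

theory Defs
  imports "HOL-Library.Disjoint_Sets" "HOL-Library.Ramsey"
begin

type_synonym 'a graph = "'a set \<times> 'a set set"

abbreviation verts :: "'a graph \<Rightarrow> 'a set" where
  "verts G \<equiv> fst G"

abbreviation edges :: "'a graph \<Rightarrow> 'a set set" where
  "edges G \<equiv> snd G"

definition simple_graph :: "'a graph \<Rightarrow> bool" where
  "simple_graph G \<longleftrightarrow> finite (verts G) \<and> edges G \<subseteq> nsets (verts G) 2"

definition subgraph :: "'a graph \<Rightarrow> 'a graph \<Rightarrow> bool" where
  "subgraph G' G \<longleftrightarrow> simple_graph G' \<and> simple_graph G \<and>
     verts G' \<subseteq> verts G \<and> edges G' \<subseteq> edges G"

definition graph_iso :: "'a graph \<Rightarrow> 'b graph \<Rightarrow> bool" where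
  "graph_iso G H \<longleftrightarrow>
     (\<exists>f. bij_betw f (verts G) (verts H) \<and> edges H = (\<lambda>e. f ` e) ` edges G)"

definition contains_graph :: "'a graph \<Rightarrow> 'b graph \<Rightarrow> bool" where
  "contains_graph G H \<longleftrightarrow> (\<exists>G'. subgraph G' G \<and> graph_iso G' H)"

text \<open>Vertices are natural numbers, but the vertex set is an arbitrary \<open>n\<close>-set, so every finite
  simple graph on \<open>n\<close> vertices occurs here up to isomorphism.\<close>

definition graphs_on :: "nat \<Rightarrow> nat graph set" where
  "graphs_on n = {G. simple_graph G \<and> card (verts G) = n}"

definition complete_graph :: "'a set \<Rightarrow> 'a graph" where
  "complete_graph W = (W, nsets W 2)"

text \<open>\<open>None\<close> is the common vertex; \<open>Some (i, j)\<close> is the \<open>j\<close>-th of the \<open>r - 1\<close> remaining vertices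
  of the \<open>i\<close>-th copy of the complete graph on \<open>r\<close> vertices.\<close>

definition fan_copy :: "nat \<Rightarrow> nat \<Rightarrow> (nat \<times> nat) option graph" where
  "fan_copy r i = complete_graph (insert None (Some ` ({i} \<times> {..<r - 1})))"

definition fan :: "nat \<Rightarrow> nat \<Rightarrow> (nat \<times> nat) option graph" where
  "fan k r = (\<Union>i<k. verts (fan_copy r i), \<Union>i<k. edges (fan_copy r i))"

definition ex_num :: "nat \<Rightarrow> 'b graph \<Rightarrow> nat" where
  "ex_num n H = Max {card (edges G) | G. G \<in> graphs_on n \<and> \<not> contains_graph G H}"

definition extremal_graph :: "nat \<Rightarrow> 'b graph \<Rightarrow> nat graph \<Rightarrow> bool" where
  "extremal_graph n H G \<longleftrightarrow>
     G \<in> graphs_on n \<and> card (edges G) = ex_num n H \<and> \<not> contains_graph G H"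

text \<open>A set \<open>p\<close> of edges forms the graph \<open>(\<Union>p, p)\<close>, whose vertices are the endpoints of those edges.
  Hence this is only meant for graphs \<open>H\<close> without isolated vertices, such as fans.\<close>

definition decomposition :: "'a graph \<Rightarrow> 'b graph \<Rightarrow> 'a set set set \<Rightarrow> bool" where
  "decomposition G H P \<longleftrightarrow> partition_on (edges G) P \<and>
     (\<forall>p\<in>P. card p = 1 \<or> graph_iso (\<Union>p, p) H)"

definition phi_graph :: "'a graph \<Rightarrow> 'b graph \<Rightarrow> nat" where
  "phi_graph G H = (LEAST m. \<exists>P. decomposition G H P \<and> card P = m)"

definition phi_num :: "nat \<Rightarrow> 'b graph \<Rightarrow> nat" where
  "phi_num n H = Max {phi_graph G H | G. G \<in> graphs_on n}"

lemma simple_graph_fan: "simple_graph (fan k r)"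
  unfolding simple_graph_def fan_def fan_copy_def complete_graph_def
  by (force simp: nsets_def)

lemma card_verts_fan_copy:
  assumes "r > 0"
  shows "card (verts (fan_copy r i)) = r"
  using assms by (simp add: fan_copy_def complete_graph_def card_insert_if card_image)

lemma fan_copy_Int:
  assumes "i \<noteq> j"
  shows "verts (fan_copy r i) \<inter> verts (fan_copy r j) = {None}"
  using assms by (auto simp: fan_copy_def complete_graph_def)

lemma card_verts_fan:
  assumes "k > 0"
  shows "card (verts (fan k r)) = (r - 1) * k + 1"
proof -
  have "verts (fan k r) = insert None (Some ` ({..<k} \<times> {..<r - 1}))"
    using assms by (auto simp: fan_def fan_copy_def complete_graph_def)
  then show ?thesis
    by (simp add: card_insert_if card_image card_cartesian_product mult.commute)
qed

lemma card_edges_le: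
  assumes "G \<in> graphs_on n"
  shows "finite (edges G)" "card (edges G) \<le> n choose 2"
proof -
  have G: "finite (verts G)" "edges G \<subseteq> nsets (verts G) 2" "card (verts G) = n"
    using assms by (auto simp: graphs_on_def simple_graph_def)
  have fin: "finite (nsets (verts G) 2)"
    using G(1) by (rule finite_imp_finite_nsets)
  show "finite (edges G)"
    using finite_subset[OF G(2) fin] .
  show "card (edges G) \<le> n choose 2"
    using card_mono[OF fin G(2)] G by simp
qed

lemma decomposition_singletons:
  "decomposition G H ((\<lambda>e. {e}) ` edges G)"
  by (auto simp: decomposition_def partition_on_def disjoint_def)

lemma phi_graph_attained:
  "\<exists>P. decomposition G H P \<and> card P = phi_graph G H"
  unfolding phi_graph_def by (rule LeastI_ex) (use decomposition_singletons in blast)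

lemma phi_graph_le_edges: "phi_graph G H \<le> card (edges G)"
proof -
  have "card ((\<lambda>e. {e}) ` edges G) = card (edges G)"
    by (rule card_image) (simp add: inj_on_def)
  then show ?thesis
    unfolding phi_graph_def using decomposition_singletons by (metis (mono_tags, lifting) Least_le)
qed

lemma empty_graph_on: "({..<n}, {}) \<in> graphs_on n"
  by (simp add: graphs_on_def simple_graph_def)

lemma phi_num_set:
  "finite {phi_graph G H | G. G \<in> graphs_on n}" "{phi_graph G H | G. G \<in> graphs_on n} \<noteq> {}"
proof -
  have "phi_graph G H \<le> n choose 2" if "G \<in> graphs_on n" for G
    using phi_graph_le_edges card_edges_le(2)[OF that] by (rule order_trans)
  then have "{phi_graph G H | G. G \<in> graphs_on n} \<subseteq> {..n choose 2}"
    by blast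
  then show "finite {phi_graph G H | G. G \<in> graphs_on n}"
    using finite_subset by blast
  show "{phi_graph G H | G. G \<in> graphs_on n} \<noteq> {}"
    using empty_graph_on by blast
qed

lemma ex_num_set:
  assumes "edges H \<noteq> {}"
  shows "finite {card (edges G) | G. G \<in> graphs_on n \<and> \<not> contains_graph G H}"
    "{card (edges G) | G. G \<in> graphs_on n \<and> \<not> contains_graph G H} \<noteq> {}"
proof -
  have "{card (edges G) | G. G \<in> graphs_on n \<and> \<not> contains_graph G H} \<subseteq> {..n choose 2}"
    using card_edges_le(2) by auto
  then show "finite {card (edges G) | G. G \<in> graphs_on n \<and> \<not> contains_graph G H}"
    using finite_subset by blast
  have "\<not> contains_graph ({..<n}, {}) H"
    using assms by (auto simp: contains_graph_def subgraph_def graph_iso_def)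
  then show "{card (edges G) | G. G \<in> graphs_on n \<and> \<not> contains_graph G H} \<noteq> {}"
    using empty_graph_on by blast
qed

lemma Union_edges_fan:
  assumes "r \<ge> 2"
  shows "\<Union> (edges (fan k r)) = verts (fan k r)"
proof
  show "\<Union> (edges (fan k r)) \<subseteq> verts (fan k r)"
    by (auto simp: fan_def fan_copy_def complete_graph_def nsets_def)
  show "verts (fan k r) \<subseteq> \<Union> (edges (fan k r))"
  proof
    fix v assume "v \<in> verts (fan k r)"
    then obtain i where i: "i < k" "v \<in> verts (fan_copy r i)"
      by (auto simp: fan_def)
    have "\<not> verts (fan_copy r i) \<subseteq> {v}"
      using card_mono[of "{v}" "verts (fan_copy r i)"] card_verts_fan_copy[of r i] assms by auto
    then obtain w where "w \<in> verts (fan_copy r i)" "w \<noteq> v"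
      by blast
    then have "{v, w} \<in> edges (fan_copy r i)"
      using i by (auto simp: fan_copy_def complete_graph_def nsets_def)
    then show "v \<in> \<Union> (edges (fan k r))"
      using i(1) unfolding fan_def snd_conv by blast
  qed
qed

end

theory Submission
  imports Complex_Main Defs
begin

text \<open>Put \<open>p = r - 1\<close>, let \<open>T n\<close> be the number of edges of the \<open>p\<close>-partite Turan graph and \<open>phi E\<close> the
  decomposition number of the edge set \<open>E\<close>. No regularity lemma is needed. Deleting vertices of
  minimum degree together with fans centred at them (Bollobas' induction) bounds
  \<open>card E + L * phi E\<close> for a constant \<open>L\<close>, so \<open>phi E \<ge> T n\<close> forces \<open>card E \<le> T n + O(n)\<close>. Hence
  packing fans greedily leaves a fan-free graph with at least \<open>T n - O(n)\<close> edges. Deleting linearly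
  many further edges makes it \<open>K_r\<close>-free, and Fueredi's stability theorem gives a \<open>p\<close>-colouring of the
  vertices with \<open>O(n)\<close> edges inside the classes and \<open>O(n)\<close> missing edges between them.

  A vertex with linearly many neighbours in every class, or of degree well below that of the Turan
  graph, can be deleted at a linear gain. Otherwise a recolouring makes all inner and missing degrees
  small, and greedily packed fans show that \<open>phi E\<close> exceeds \<open>T n\<close> by at most a constant. It follows
  that for large \<open>n\<close> the condition \<open>phi E \<ge> T n\<close> leaves only a bounded number of inner and of missing
  edges, all inside a bounded vertex set \<open>S\<close>.

  Any fan can then be moved so that it has a vertex outside \<open>S\<close>, hence at least two edges not inside
  \<open>S\<close>. Packing such fans saves more parts than the number of edges inside \<open>S\<close> they use up, and deleting
  only the latter already makes the graph fan-free. So \<open>phi E\<close> is smaller than the number of edges of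
  some fan-free graph; the exact value of the extremal number is never used.\<close>

section \<open>Fans and decompositions\<close>

text \<open>Every deletion rests on one piece of arithmetic. A fan centred at the deleted vertex
  turns \<open>k * p\<close> incident edges into a single part, so each of its \<open>k\<close>
  cliques of size \<open>p\<close> saves \<open>(k * p - 1) / k\<close>, which is at least 3/2
  because \<open>k\<close> and \<open>p\<close> are at least 2. A minimum degree that exceeds the
  Turan degree by \<open>t\<close> yields \<open>t\<close> such cliques: the surplus of
  \<open>t\<close> edges is repaid with half of it to spare. The spare half pays for the edges
  inside the cliques, which vanish with the fans; hence \<open>card E\<close> can be carried along
  in the same induction, although it has no bound of this kind on its own. The number
  \<open>T n\<close> cannot be the final yardstick. For any \<open>p\<close>-colouring a fan
  contains at least \<open>k\<close> inner edges, one in each clique, so a single inner edge added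
  to the Turan graph creates no fan. Even an error of \<open>O(1)\<close> would be too coarse, which
  is why the last comparison takes place inside the given graph.\<close>

lemma image_nsets:
  assumes "inj_on f W"
  shows "(`) f ` nsets W n = nsets (f ` W) n"
  using bij_betw_nsets[of f W "f ` W" n] assms
  by (simp add: bij_betw_def inj_on_imp_bij_betw)

lemma Union_nsets_2:
  assumes "card W \<ge> 2"
  shows "\<Union> (nsets W 2) = W"
proof
  show "\<Union> (nsets W 2) \<subseteq> W" by (auto simp: nsets_def)
  show "W \<subseteq> \<Union> (nsets W 2)"
  proof
    fix v assume v: "v \<in> W"
    have "\<not> W \<subseteq> {v}"
      using card_mono[of "{v}" W] assms by auto
    then obtain w where "w \<in> W" "w \<noteq> v" by blast
    with v have "{v, w} \<in> nsets W 2" by auto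
    then show "v \<in> \<Union> (nsets W 2)" by blast
  qed
qed

text \<open>A fan is handled as a set of edges of the host graph, given by its centre and its copies
  of \<open>K_r\<close> without the centre. With the centre left out, the condition that the copies
  meet only there becomes disjointness. The number of petals is a parameter because a multiple of
  \<open>k\<close> petals at one centre is split into fans later.\<close>

definition petals :: "nat \<Rightarrow> nat \<Rightarrow> 'a \<Rightarrow> 'a set set \<Rightarrow> bool" where
  "petals k p c Q \<longleftrightarrow> finite Q \<and> card Q = k \<and> disjoint Q \<and> (\<forall>q\<in>Q. finite q \<and> card q = p \<and> c \<notin> q)"

definition fan_edges :: "'a \<Rightarrow> 'a set set \<Rightarrow> 'a set set" where
  "fan_edges c Q = (\<Union>q\<in>Q. nsets (insert c q) 2)"

lemma edges_fan: "edges (fan k r) = (\<Union>i<k. nsets (insert None (Some ` ({i} \<times> {..<r - 1}))) 2)"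
  by (simp add: fan_def fan_copy_def complete_graph_def)

lemma verts_fan: "verts (fan k r) = (\<Union>i<k. insert None (Some ` ({i} \<times> {..<r - 1})))"
  by (simp add: fan_def fan_copy_def complete_graph_def)

lemma Union_fan_edges:
  assumes "petals k p c Q" "k \<ge> 1" "p \<ge> 1"
  shows "\<Union> (fan_edges c Q) = insert c (\<Union> Q)"
proof -
  have "\<Union> (nsets (insert c q) 2) = insert c q" if "q \<in> Q" for q
    using that assms by (intro Union_nsets_2) (auto simp: petals_def card_insert_if)
  then have "\<Union> (fan_edges c Q) = (\<Union>q\<in>Q. insert c q)"
    unfolding fan_edges_def by blast
  moreover have "Q \<noteq> {}" using assms by (auto simp: petals_def)
  ultimately show ?thesis by blast
qed

lemma card_fan_edges:
  assumes "petals k p c Q"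
  shows "card (fan_edges c Q) = k * (Suc p choose 2)"
proof -
  have "card (fan_edges c Q) = (\<Sum>q\<in>Q. card (nsets (insert c q) 2))"
    unfolding fan_edges_def
  proof (rule card_UN_disjoint)
    show "finite Q" using assms by (simp add: petals_def)
    show "\<forall>q\<in>Q. finite (nsets (insert c q) 2)"
      using assms by (auto simp: petals_def intro: finite_imp_finite_nsets)
    show "\<forall>q\<in>Q. \<forall>q'\<in>Q. q \<noteq> q' \<longrightarrow> nsets (insert c q) 2 \<inter> nsets (insert c q') 2 = {}"
    proof (intro ballI impI)
      fix q q' assume q: "q \<in> Q" "q' \<in> Q" "q \<noteq> q'"
      then have "q \<inter> q' = {}" using assms by (auto simp: petals_def disjoint_def)
      then show "nsets (insert c q) 2 \<inter> nsets (insert c q') 2 = {}"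
        by (auto simp: nsets_def card_2_iff)
    qed
  qed
  also have "\<dots> = (\<Sum>q\<in>Q. Suc p choose 2)"
    using assms by (intro sum.cong) (auto simp: petals_def card_insert_if)
  finally show ?thesis using assms by (simp add: petals_def)
qed

lemma finite_fan_edges: "petals k p c Q \<Longrightarrow> finite (fan_edges c Q)"
  by (auto simp: petals_def fan_edges_def intro: finite_imp_finite_nsets)

text \<open>An enumeration \<open>b\<close> of the petals and enumerations \<open>h q\<close> within
  them give the coordinates of the standard fan. Together with the converse
  \<open>iso_fan_edges\<close> this replaces graph isomorphism by \<open>is_fan\<close> in the
  combinatorial part.\<close>

lemma fan_edges_iso:
  assumes P: "petals k p c Q" and "k \<ge> 1" "p \<ge> 1"
  shows "graph_iso (\<Union> (fan_edges c Q), fan_edges c Q) (fan k (Suc p))"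
proof -
  have Q: "finite Q" "card Q = k" "disjoint Q" and
    q: "\<And>q. q \<in> Q \<Longrightarrow> finite q \<and> card q = p \<and> c \<notin> q"
    using P by (auto simp: petals_def)
  obtain b where b: "bij_betw b Q {..<k}"
    using ex_bij_betw_finite_nat[OF Q(1)] Q(2) by (auto simp: atLeast0LessThan)
  have "\<exists>h. bij_betw h q {..<p}" if "q \<in> Q" for q
    using ex_bij_betw_finite_nat[of q] q[OF that] by (auto simp: atLeast0LessThan)
  then obtain h where h: "\<And>q. q \<in> Q \<Longrightarrow> bij_betw (h q) q {..<p}" by metis
  define part where "part v = (THE q. q \<in> Q \<and> v \<in> q)" for v
  have part: "part v = q" if "q \<in> Q" "v \<in> q" for q v
    unfolding part_def using that Q(3) by (intro the_equality) (auto simp: disjoint_def)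
  define f where "f v = (if v = c then None else Some (b (part v), h (part v) v))" for v
  have fq: "f v = Some (b q, h q v)" if "q \<in> Q" "v \<in> q" for q v
    using that q[of q] part[of q v] by (auto simp: f_def)
  have im: "f ` insert c q = insert None (Some ` ({b q} \<times> {..<p}))" if "q \<in> Q" for q
  proof -
    have "f ` q = (\<lambda>v. Some (b q, h q v)) ` q" using fq that by (intro image_cong) auto
    also have "\<dots> = Some ` ({b q} \<times> h q ` q)" by auto
    also have "h q ` q = {..<p}" using h[OF that] by (simp add: bij_betw_def)
    finally have "f ` q = Some ` ({b q} \<times> {..<p})" .
    moreover have "f c = None" by (simp add: f_def)
    ultimately show ?thesis by simp
  qed
  have inj: "inj_on f (insert c (\<Union> Q))"
  proof (rule inj_onI)
    fix u v assume uv: "u \<in> insert c (\<Union> Q)" "v \<in> insert c (\<Union> Q)" "f u = f v"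
    show "u = v"
    proof (cases "u = c \<or> v = c")
      case True
      then show ?thesis using uv(3) by (auto simp: f_def split: if_splits)
    next
      case False
      then obtain q q' where qq: "q \<in> Q" "u \<in> q" "q' \<in> Q" "v \<in> q'" using uv by blast
      then have "b q = b q'" "h q u = h q' v" using uv(3) fq by auto
      then have "q = q'" using b qq by (auto simp: bij_betw_def dest: inj_onD)
      then show ?thesis using \<open>h q u = h q' v\<close> h[OF qq(1)] qq by (auto simp: bij_betw_def dest: inj_onD)
    qed
  qed
  have U: "\<Union> (fan_edges c Q) = insert c (\<Union> Q)" by (rule Union_fan_edges[OF assms])
  have Qne: "Q \<noteq> {}" using Q assms by auto
  have "f ` insert c (\<Union> Q) = (\<Union>q\<in>Q. f ` insert c q)" using Qne by blast
  also have "\<dots> = (\<Union>q\<in>Q. insert None (Some ` ({b q} \<times> {..<p})))" using im by simp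
  also have "\<dots> = (\<Union>i\<in>b ` Q. insert None (Some ` ({i} \<times> {..<p})))" by simp
  also have "b ` Q = {..<k}" using b by (simp add: bij_betw_def)
  finally have V: "f ` insert c (\<Union> Q) = verts (fan k (Suc p))" by (simp add: verts_fan)
  have "(`) f ` fan_edges c Q = (\<Union>q\<in>Q. (`) f ` nsets (insert c q) 2)"
    by (auto simp: fan_edges_def)
  also have "\<dots> = (\<Union>q\<in>Q. nsets (f ` insert c q) 2)"
  proof (rule SUP_cong)
    fix q assume "q \<in> Q"
    then have "inj_on f (insert c q)" by (intro inj_on_subset[OF inj]) auto
    then show "(`) f ` nsets (insert c q) 2 = nsets (f ` insert c q) 2" by (rule image_nsets)
  qed simp
  also have "\<dots> = (\<Union>q\<in>Q. nsets (insert None (Some ` ({b q} \<times> {..<p}))) 2)" using im by simp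
  also have "\<dots> = (\<Union>i\<in>b ` Q. nsets (insert None (Some ` ({i} \<times> {..<p}))) 2)" by simp
  also have "b ` Q = {..<k}" using b by (simp add: bij_betw_def)
  finally have E: "(`) f ` fan_edges c Q = edges (fan k (Suc p))" by (simp add: edges_fan)
  show ?thesis
    unfolding graph_iso_def using inj V E U by (intro exI[of _ f]) (simp add: bij_betw_def)
qed

lemma iso_fan_edges:
  assumes iso: "graph_iso G (fan k (Suc p))" and G: "edges G \<subseteq> nsets (verts G) 2"
    and k: "k \<ge> 1" and p: "p \<ge> 1"
  shows "\<exists>c Q. petals k p c Q \<and> edges G = fan_edges c Q"
proof -
  let ?F = "fan k (Suc p)"
  obtain f where f: "bij_betw f (verts G) (verts ?F)" and E: "edges ?F = (\<lambda>e. f ` e) ` edges G"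
    using iso by (auto simp: graph_iso_def)
  define g where "g = the_inv_into (verts G) f"
  have g: "bij_betw g (verts ?F) (verts G)"
    unfolding g_def by (rule bij_betw_the_inv_into[OF f])
  have gf: "g (f v) = v" if "v \<in> verts G" for v
    unfolding g_def using f that by (simp add: bij_betw_def the_inv_into_f_f)
  have "(`) g ` edges ?F = (\<lambda>e. g ` f ` e) ` edges G" by (simp add: E image_image)
  also have "\<dots> = (\<lambda>e. e) ` edges G"
  proof (rule image_cong)
    fix e assume "e \<in> edges G"
    then have "e \<subseteq> verts G" using G by (auto simp: nsets_def)
    then have "(\<lambda>x. g (f x)) ` e = (\<lambda>x. x) ` e"
      using gf by (intro image_cong) auto
    then show "g ` f ` e = e" by (simp add: image_image)
  qed simp
  finally have E': "edges G = (`) g ` edges ?F" by simp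
  define c where "c = g None"
  define q where "q i = g ` Some ` ({i} \<times> {..<p})" for i
  define Q where "Q = q ` {..<k}"
  have inj: "inj_on g (verts ?F)" using g by (simp add: bij_betw_def)
  have sub: "insert None (Some ` ({i} \<times> {..<p})) \<subseteq> verts ?F" if "i < k" for i
    using that by (auto simp: verts_fan)
  have N: "None \<in> verts ?F" using k unfolding verts_fan by (intro UN_I[of 0]) auto
  have S: "Some (i, j) \<in> verts ?F" if "i < k" "j < p" for i j using that by (auto simp: verts_fan)
  have disj: "q i \<inter> q j = {}" if "i < k" "j < k" "i \<noteq> j" for i j
    using that S inj by (auto simp: q_def dest!: inj_onD)
  have cq: "card (q i) = p" if "i < k" for i
  proof -
    have "card (q i) = card (Some ` ({i} \<times> {..<p}))"
      unfolding q_def using inj sub[OF that] by (intro card_image) (auto intro: inj_on_subset)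
    also have "\<dots> = card ({i} \<times> {..<p})" by (rule card_image) simp
    finally show ?thesis by (simp add: card_cartesian_product)
  qed
  have injq: "inj_on q {..<k}"
  proof (rule inj_onI)
    fix i j assume ij: "i \<in> {..<k}" "j \<in> {..<k}" "q i = q j"
    show "i = j"
    proof (rule ccontr)
      assume "i \<noteq> j"
      then have "q i = {}" using disj[of i j] ij by auto
      then show False using cq[of i] ij p by auto
    qed
  qed
  have "petals k p c Q"
    unfolding petals_def
  proof (intro conjI ballI)
    show "finite Q" "card Q = k" by (auto simp: Q_def card_image injq)
    show "disjoint Q" unfolding disjoint_def Q_def using disj by auto
    fix x assume "x \<in> Q"
    then obtain i where i: "i < k" "x = q i" by (auto simp: Q_def)
    show "finite x" using i by (auto simp: q_def)
    show "card x = p" using cq i by simp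
    show "c \<notin> x" using i S N inj by (auto simp: q_def c_def dest!: inj_onD)
  qed
  moreover have "edges G = fan_edges c Q"
  proof -
    have "edges G = (\<Union>i<k. (`) g ` nsets (insert None (Some ` ({i} \<times> {..<p}))) 2)"
      by (auto simp: E' edges_fan)
    also have "\<dots> = (\<Union>i<k. nsets (g ` insert None (Some ` ({i} \<times> {..<p}))) 2)"
    proof (rule SUP_cong)
      fix i assume "i \<in> {..<k}"
      then have "inj_on g (insert None (Some ` ({i} \<times> {..<p})))"
        by (intro inj_on_subset[OF inj sub]) simp
      then show "(`) g ` nsets (insert None (Some ` ({i} \<times> {..<p}))) 2
          = nsets (g ` insert None (Some ` ({i} \<times> {..<p}))) 2"
        by (rule image_nsets)
    qed simp
    also have "\<dots> = fan_edges c Q" by (simp add: fan_edges_def Q_def c_def q_def)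
    finally show ?thesis .
  qed
  ultimately show ?thesis by blast
qed

section \<open>Fans and the decomposition number of an edge set\<close>

locale fan_setting =
  fixes k p :: nat
  assumes k2: "k \<ge> 2" and p2: "p \<ge> 2"
begin

definition is_fan :: "nat set set \<Rightarrow> bool" where
  "is_fan A \<longleftrightarrow> (\<exists>c Q. petals k p c Q \<and> A = fan_edges c Q)"

definition fan_free :: "nat set set \<Rightarrow> bool" where
  "fan_free E \<longleftrightarrow> (\<forall>A\<subseteq>E. \<not> is_fan A)"

definition fan_size :: nat where
  "fan_size = k * (Suc p choose 2)"

text \<open>\<open>phi_graph\<close> reads only the edges of its graph; fixing the vertex set to
  \<open>{}\<close> makes the decomposition number a function of the edge set, on which the
  deletions act.\<close>

definition phi :: "nat set set \<Rightarrow> nat" where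
  "phi E = phi_graph ({}, E) (fan k (Suc p))"

lemma phi_graph_eq: "phi_graph G (fan k (Suc p)) = phi (edges G)"
  by (simp add: phi_def phi_graph_def decomposition_def)

lemma fan_size_ge: "fan_size \<ge> 3 * k" "fan_size \<ge> 6" "fan_size \<ge> 2 * k + 1"
proof -
  have "3 * 2 \<le> Suc p * p"
    using p2 by (intro mult_le_mono) auto
  then have "3 \<le> (Suc p choose 2)"
    unfolding choose_two by simp
  then show 1: "fan_size \<ge> 3 * k" by (simp add: fan_size_def)
  then show "fan_size \<ge> 6" "fan_size \<ge> 2 * k + 1" using k2 by auto
qed

lemma is_fanD:
  assumes "is_fan A"
  shows "finite A" "card A = fan_size" "A \<noteq> {}" "graph_iso (\<Union>A, A) (fan k (Suc p))"
proof -
  obtain c Q where Q: "petals k p c Q" "A = fan_edges c Q" using assms by (auto simp: is_fan_def)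
  show "finite A" and card: "card A = fan_size"
    using Q finite_fan_edges card_fan_edges by (auto simp: fan_size_def)
  show "A \<noteq> {}" using card fan_size_ge(2) by auto
  show "graph_iso (\<Union>A, A) (fan k (Suc p))" using fan_edges_iso[OF Q(1)] Q(2) k2 p2 by simp
qed

lemma phi_le_card: "phi E \<le> card E"
  using phi_graph_le_edges[of "({}, E)"] by (simp add: phi_def)

lemma phi_le_1:
  assumes "is_fan A"
  shows "phi A \<le> 1"
proof -
  have "decomposition ({}::nat set, A) (fan k (Suc p)) {A}"
    using is_fanD[OF assms] by (auto simp: decomposition_def partition_on_def)
  moreover have "card {A} = 1" by simp
  ultimately show ?thesis
    unfolding phi_def phi_graph_def by (metis (mono_tags, lifting) Least_le)
qed

lemma phi_Un:
  assumes "A \<inter> B = {}"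
  shows "phi (A \<union> B) \<le> phi A + phi B"
proof -
  let ?F = "fan k (Suc p)"
  obtain P1 where P1: "decomposition ({}::nat set, A) ?F P1" "card P1 = phi A"
    unfolding phi_def using phi_graph_attained by blast
  obtain P2 where P2: "decomposition ({}::nat set, B) ?F P2" "card P2 = phi B"
    unfolding phi_def using phi_graph_attained by blast
  have "\<Union>P1 = A" "\<Union>P2 = B" using P1 P2 by (auto simp: decomposition_def partition_on_def)
  then have "disjoint (P1 \<union> P2)"
    using P1 P2 assms by (intro disjoint_union) (auto simp: decomposition_def partition_on_def)
  then have "decomposition ({}::nat set, A \<union> B) ?F (P1 \<union> P2)"
    using P1 P2 by (auto simp: decomposition_def partition_on_def)
  then have "phi (A \<union> B) \<le> card (P1 \<union> P2)"
    unfolding phi_def phi_graph_def by (metis (mono_tags, lifting) Least_le)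
  also have "\<dots> \<le> phi A + phi B" using card_Un_le[of P1 P2] P1 P2 by simp
  finally show ?thesis .
qed

lemma contains_fanD:
  assumes "contains_graph (V, E) (fan k (Suc p))"
  shows "\<not> fan_free E"
proof -
  obtain G' where G': "subgraph G' (V, E)" "graph_iso G' (fan k (Suc p))"
    using assms by (auto simp: contains_graph_def)
  then have "edges G' \<subseteq> nsets (verts G') 2" by (simp add: subgraph_def simple_graph_def)
  then have "is_fan (edges G')"
    using iso_fan_edges[OF G'(2)] k2 p2 by (auto simp: is_fan_def)
  then show ?thesis using G'(1) by (auto simp: fan_free_def subgraph_def)
qed

text \<open>A part that is not a single edge would be a copy of the fan, so every part is a single
  edge.\<close>

lemma phi_eq_card:
  assumes "\<not> contains_graph (V, E) (fan k (Suc p))" "simple_graph (V, E)"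
  shows "phi E = card E"
proof -
  obtain P where P: "decomposition ({}::nat set, E) (fan k (Suc p)) P" "card P = phi E"
    unfolding phi_def using phi_graph_attained by blast
  have part: "partition_on E P" using P by (simp add: decomposition_def)
  have "card q = 1" if q: "q \<in> P" for q
  proof (rule ccontr)
    assume "card q \<noteq> 1"
    then have iso: "graph_iso (\<Union>q, q) (fan k (Suc p))" using P q by (auto simp: decomposition_def)
    have "q \<subseteq> E" using part q by (auto simp: partition_on_def)
    moreover have "E \<subseteq> nsets V 2" "finite V" using assms(2) by (auto simp: simple_graph_def)
    ultimately have "subgraph (\<Union>q, q) (V, E)"
      by (auto simp: subgraph_def simple_graph_def nsets_def dest: finite_subset intro: finite_subset[of _ V])
    then show False using assms(1) iso by (auto simp: contains_graph_def)
  qed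
  then have "card E = (\<Sum>q\<in>P. 1)"
    using part by (subst partition_onD1[OF part], subst card_Union_disjoint)
      (auto simp: partition_on_def pairwise_def disjoint_def disjnt_def card_eq_0_iff intro!: card_ge_0_finite)
  then show ?thesis using P(2) by simp
qed

end

section \<open>Degrees and greedy selection\<close>

definition deg :: "'a set set \<Rightarrow> 'a \<Rightarrow> nat" where
  "deg E v = card {e \<in> E. v \<in> e}"

definition nbh :: "'a set set \<Rightarrow> 'a \<Rightarrow> 'a set" where
  "nbh E v = {u. {u, v} \<in> E}"

lemma finite_edges: "finite V \<Longrightarrow> E \<subseteq> nsets V 2 \<Longrightarrow> finite E"
  using finite_subset finite_imp_finite_nsets by metis

lemma nbh_subset: "E \<subseteq> nsets V 2 \<Longrightarrow> nbh E v \<subseteq> V - {v}"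
  unfolding nbh_def
proof
  fix u assume "E \<subseteq> nsets V 2" "u \<in> {u. {u, v} \<in> E}"
  then have "{u, v} \<in> nsets V 2" by blast
  then show "u \<in> V - {v}" by simp
qed

lemma finite_nbh: "finite V \<Longrightarrow> E \<subseteq> nsets V 2 \<Longrightarrow> finite (nbh E v)"
  using nbh_subset finite_subset by (metis finite_Diff)

lemma incident_eq:
  assumes "E \<subseteq> nsets V 2"
  shows "{e \<in> E. v \<in> e} = (\<lambda>u. {u, v}) ` nbh E v"
proof -
  have "e \<in> (\<lambda>u. {u, v}) ` nbh E v" if "e \<in> E" "v \<in> e" for e
  proof -
    have "e \<in> nsets V 2" using that assms by auto
    then obtain a b where "e = {a, b}" "a \<noteq> b" by (auto simp: nsets_2_eq)
    then have "e = {a, v} \<or> e = {b, v}" using that by auto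
    then show ?thesis using that by (auto simp: nbh_def)
  qed
  then show ?thesis by (auto simp: nbh_def)
qed

lemma card_nbh:
  assumes "E \<subseteq> nsets V 2"
  shows "card (nbh E v) = deg E v"
proof -
  have "inj_on (\<lambda>u. {u, v}) (nbh E v)"
    by (auto simp: inj_on_def doubleton_eq_iff)
  then show ?thesis unfolding deg_def incident_eq[OF assms] by (simp add: card_image)
qed

lemma card_eq_without_vertex:
  assumes "finite E"
  shows "card E = card {e \<in> E. v \<notin> e} + deg E v"
proof -
  have "E = {e \<in> E. v \<notin> e} \<union> {e \<in> E. v \<in> e}" by auto
  then have "card E = card ({e \<in> E. v \<notin> e} \<union> {e \<in> E. v \<in> e})" by simp
  also have "\<dots> = card {e \<in> E. v \<notin> e} + deg E v"
    unfolding deg_def using assms by (intro card_Un_disjoint) auto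
  finally show ?thesis .
qed

lemma handshake:
  assumes V: "finite V" and E: "E \<subseteq> nsets V 2"
  shows "(\<Sum>v\<in>V. deg E v) = 2 * card E"
proof -
  have fE: "finite E" using finite_edges[OF assms] .
  have "(\<Sum>v\<in>V. deg E v) = (\<Sum>v\<in>V. \<Sum>e\<in>E. if v \<in> e then 1 else 0)"
    unfolding deg_def using fE by (intro sum.cong) (auto simp: sum.If_cases Int_def)
  also have "\<dots> = (\<Sum>e\<in>E. \<Sum>v\<in>V. if v \<in> e then 1 else 0)" by (rule sum.swap)
  also have "\<dots> = (\<Sum>e\<in>E. 2)"
  proof (rule sum.cong)
    fix e assume "e \<in> E"
    then have e: "e \<subseteq> V" "card e = 2" using E by (auto simp: nsets_def)
    then have "V \<inter> {v. v \<in> e} = e" by auto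
    then show "(\<Sum>v\<in>V. if v \<in> e then 1 else 0) = (2::nat)"
      using V e by (simp add: sum.If_cases)
  qed simp
  finally show ?thesis by simp
qed

lemma card_high_degree:
  fixes a :: real
  assumes V: "finite V" and E: "E \<subseteq> nsets V 2"
  shows "a * real (card {v \<in> V. a \<le> deg E v}) \<le> 2 * card E"
proof -
  have "a * real (card {v \<in> V. a \<le> deg E v}) = (\<Sum>v\<in>{v \<in> V. a \<le> deg E v}. a)" by simp
  also have "\<dots> \<le> (\<Sum>v\<in>{v \<in> V. a \<le> deg E v}. real (deg E v))"
    using sum_mono[of "{v \<in> V. a \<le> deg E v}" "\<lambda>_. a" "\<lambda>v. real (deg E v)"] by simp
  also have "\<dots> \<le> (\<Sum>v\<in>V. real (deg E v))" using V by (intro sum_mono2) auto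
  also have "\<dots> = 2 * card E" using handshake[OF assms] by (metis of_nat_sum of_nat_mult of_nat_numeral)
  finally show ?thesis .
qed

lemma fan_edges_subset:
  assumes "\<And>q. q \<in> Q \<Longrightarrow> q \<subseteq> nbh E x" "\<And>q. q \<in> Q \<Longrightarrow> nsets q 2 \<subseteq> E"
  shows "fan_edges x Q \<subseteq> E"
proof
  fix e assume "e \<in> fan_edges x Q"
  then obtain q where q: "q \<in> Q" "e \<in> nsets (insert x q) 2" by (auto simp: fan_edges_def)
  then obtain u v where uv: "e = {u, v}" "u \<noteq> v" "u \<in> insert x q" "v \<in> insert x q"
    by (auto simp: nsets_2_eq)
  have q': "q \<subseteq> nbh E x" "nsets q 2 \<subseteq> E" using assms q by auto
  consider "u = x" "v \<in> q" | "v = x" "u \<in> q" | "u \<in> q" "v \<in> q" using uv by auto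
  then show "e \<in> E"
  proof cases
    case 1
    then show ?thesis using q' uv by (auto simp: nbh_def insert_commute)
  next
    case 2
    then show ?thesis using q' uv by (auto simp: nbh_def)
  next
    case 3
    then have "e \<in> nsets q 2" using uv by auto
    then show ?thesis using q' by auto
  qed
qed

text \<open>One index is treated at a time: at most \<open>card I - 1\<close> earlier choices spoil
  at most \<open>h\<close> candidates each. The sets \<open>A i\<close> may coincide, as when a
  clique is chosen inside a single set.\<close>

lemma greedy_transversal:
  assumes "finite I" "\<And>i. i \<in> I \<Longrightarrow> finite (A i)"
    and sym: "\<And>u v. bad u v \<Longrightarrow> bad v u"
    and bad: "\<And>i i' v. i \<in> I \<Longrightarrow> i' \<in> I \<Longrightarrow> i \<noteq> i' \<Longrightarrow> v \<in> A i' \<Longrightarrow> card {u \<in> A i. bad u v} \<le> h"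
    and big: "\<And>i. i \<in> I \<Longrightarrow> (card I - 1) * h < card (A i)"
  shows "\<exists>g. (\<forall>i\<in>I. g i \<in> A i) \<and> (\<forall>i\<in>I. \<forall>i'\<in>I. i \<noteq> i' \<longrightarrow> \<not> bad (g i) (g i'))"
proof -
  have "\<exists>g. (\<forall>i\<in>J. g i \<in> A i) \<and> (\<forall>i\<in>J. \<forall>i'\<in>J. i \<noteq> i' \<longrightarrow> \<not> bad (g i) (g i'))" if "J \<subseteq> I" for J
    using finite_subset[OF that assms(1)] that
  proof (induction J rule: finite_induct)
    case empty
    then show ?case by auto
  next
    case (insert j J)
    then obtain g where g: "\<forall>i\<in>J. g i \<in> A i" "\<forall>i\<in>J. \<forall>i'\<in>J. i \<noteq> i' \<longrightarrow> \<not> bad (g i) (g i')"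
      by auto
    let ?X = "\<Union>i\<in>J. {u \<in> A j. bad u (g i)}"
    have "card ?X \<le> (\<Sum>i\<in>J. card {u \<in> A j. bad u (g i)})"
      by (rule card_UN_le) (use insert in auto)
    also have "\<dots> \<le> (\<Sum>i\<in>J. h)"
    proof (rule sum_mono)
      fix i assume "i \<in> J"
      then show "card {u \<in> A j. bad u (g i)} \<le> h"
        using insert g(1) by (intro bad[of j i]) auto
    qed
    also have "\<dots> = card J * h" by simp
    also have "\<dots> \<le> (card I - 1) * h"
    proof (rule mult_le_mono1)
      have "card (insert j J) \<le> card I" using insert assms(1) by (intro card_mono) auto
      then show "card J \<le> card I - 1" using insert by simp
    qed
    also have "\<dots> < card (A j)" using insert by (intro big) auto
    finally have "card ?X < card (A j)" .
    moreover have "finite ?X" using insert assms(2) by auto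
    ultimately have "\<not> A j \<subseteq> ?X" by (meson card_mono leD)
    then obtain u where u: "u \<in> A j" "u \<notin> ?X" by blast
    define g' where "g' = g(j := u)"
    have "\<forall>i\<in>insert j J. g' i \<in> A i" using g(1) u(1) by (auto simp: g'_def)
    moreover have "\<not> bad u (g i) \<and> \<not> bad (g i) u" if "i \<in> J" for i
      using u that sym by blast
    then have "\<forall>i\<in>insert j J. \<forall>i'\<in>insert j J. i \<noteq> i' \<longrightarrow> \<not> bad (g' i) (g' i')"
      using g(2) insert.hyps by (auto simp: g'_def)
    ultimately show ?case by blast
  qed
  then show ?thesis by blast
qed

text \<open>A new set is disjoint from the earlier ones and non-empty by \<open>ne\<close>, hence
  different from all of them; this makes the cardinality grow.\<close>

lemma greedy_disjoint_family:
  assumes step: "\<And>Q. finite Q \<Longrightarrow> card Q < s \<Longrightarrow> disjoint Q \<Longrightarrow> (\<forall>q\<in>Q. P q) \<Longrightarrow> \<exists>q. P q \<and> q \<inter> \<Union>Q = {}"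
    and ne: "\<And>q. P q \<Longrightarrow> q \<noteq> {}"
  shows "\<exists>Q. finite Q \<and> card Q = s \<and> disjoint Q \<and> (\<forall>q\<in>Q. P q)"
proof -
  have "\<exists>Q. finite Q \<and> card Q = j \<and> disjoint Q \<and> (\<forall>q\<in>Q. P q)" if "j \<le> s" for j
    using that
  proof (induction j)
    case 0
    then show ?case by (intro exI[of _ "{}"]) auto
  next
    case (Suc j)
    then obtain Q where Q: "finite Q" "card Q = j" "disjoint Q" "\<forall>q\<in>Q. P q" by auto
    then obtain q where q: "P q" "q \<inter> \<Union>Q = {}" using step[of Q] Suc by auto
    then have "q \<notin> Q" using ne by blast
    then show ?case
      using Q q by (intro exI[of _ "insert q Q"]) (auto simp: disjoint_def)
  qed
  then show ?thesis by blast
qed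

section \<open>Fans with a common centre\<close>

context fan_setting
begin

lemma phi_remove_fan:
  assumes "is_fan A" "A \<subseteq> E"
  shows "phi E \<le> phi (E - A) + 1"
proof -
  have "phi ((E - A) \<union> A) \<le> phi (E - A) + phi A" by (rule phi_Un) auto
  moreover have "(E - A) \<union> A = E" using assms by auto
  ultimately show ?thesis using phi_le_1[OF assms(1)] by simp
qed

text \<open>Distinct petals share only the centre, so their cliques are edge-disjoint and any
  grouping into \<open>f\<close> blocks of \<open>k\<close> petals gives \<open>f\<close>
  edge-disjoint fans.\<close>

lemma phi_fan_edges_le:
  assumes "petals (k * f) p x Q"
  shows "phi (fan_edges x Q) \<le> f"
  using assms
proof (induction f arbitrary: Q)
  case 0
  then have "Q = {}" by (auto simp: petals_def)
  then have "fan_edges x Q = {}" by (simp add: fan_edges_def)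
  then show ?case using phi_le_card[of "{}"] by simp
next
  case (Suc f)
  have "k \<le> card Q" using Suc.prems by (simp add: petals_def)
  then obtain Q1 where Q1: "Q1 \<subseteq> Q" "card Q1 = k" "finite Q1"
    by (rule obtain_subset_with_card_n)
  define Q2 where "Q2 = Q - Q1"
  have 1: "petals k p x Q1" and 2: "petals (k * f) p x Q2"
    using Suc.prems Q1 by (auto simp: petals_def Q2_def disjoint_def card_Diff_subset)
  have "fan_edges x Q1 \<inter> fan_edges x Q2 = {}"
  proof (rule ccontr)
    assume "fan_edges x Q1 \<inter> fan_edges x Q2 \<noteq> {}"
    then obtain e q q' where e: "e \<in> nsets (insert x q) 2" "e \<in> nsets (insert x q') 2" "q \<in> Q1" "q' \<in> Q2"
      by (auto simp: fan_edges_def)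
    then have "q \<in> Q" "q' \<in> Q" "q \<noteq> q'" using Q1 by (auto simp: Q2_def)
    then have "q \<inter> q' = {}" using Suc.prems unfolding petals_def disjoint_def by blast
    then show False using e by (auto simp: nsets_def card_2_iff)
  qed
  then have "phi (fan_edges x Q1 \<union> fan_edges x Q2) \<le> phi (fan_edges x Q1) + phi (fan_edges x Q2)"
    by (rule phi_Un)
  also have "\<dots> \<le> 1 + f"
    using 1 by (intro add_mono phi_le_1 Suc.IH 2) (auto simp: is_fan_def)
  also have "fan_edges x Q1 \<union> fan_edges x Q2 = fan_edges x Q"
    using Q1 by (auto simp: fan_edges_def Q2_def)
  finally show ?case by simp
qed

text \<open>The edges at \<open>x\<close> are covered by \<open>card Q div k\<close> fans and by
  single edges, and each fan saves \<open>k * p - 1\<close> parts. The fans also consume the edges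
  inside their cliques; these disappear together with \<open>x\<close>, which the last inequality
  accounts for. With \<open>Q = {}\<close> this is the plain deletion of \<open>x\<close>.\<close>

lemma star_removal:
  assumes V: "finite V" and E: "E \<subseteq> nsets V 2" and x: "x \<in> V"
    and Q: "finite Q" "disjoint Q"
    and q: "\<And>q. q \<in> Q \<Longrightarrow> card q = p \<and> q \<subseteq> nbh E x \<and> nsets q 2 \<subseteq> E"
  shows "\<exists>E'. E' \<subseteq> E \<and> E' \<subseteq> nsets (V - {x}) 2 \<and>
    phi E + (card Q div k) * (k * p - 1) \<le> phi E' + deg E x \<and>
    card E \<le> card E' + deg E x + card Q * (p choose 2)"
proof -
  let ?f = "card Q div k"
  have "k * ?f \<le> card Q" by simp
  then obtain Q' where Q': "Q' \<subseteq> Q" "card Q' = k * ?f" "finite Q'"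
    by (rule obtain_subset_with_card_n)
  have p0: "p > 0" using p2 by simp
  have P: "petals (k * ?f) p x Q'"
    unfolding petals_def
  proof (intro conjI ballI)
    show "disjoint Q'" using Q Q' by (auto simp: disjoint_def)
    fix a assume "a \<in> Q'"
    then have a: "card a = p" "a \<subseteq> nbh E x" using q Q' by auto
    then show "card a = p" "finite a" "x \<notin> a" using p0 nbh_subset[OF E, of x] by (auto intro: card_ge_0_finite)
  qed (use Q' in auto)
  define F where "F = fan_edges x Q'"
  have FE: "F \<subseteq> E"
    unfolding F_def using q Q' by (intro fan_edges_subset) auto
  have fE: "finite E" by (rule finite_edges[OF V E])
  have fF: "finite F" using finite_subset[OF FE fE] .
  have "nbh F x = \<Union>Q'"
  proof -
    have "{u, x} \<in> nsets (insert x a) 2 \<longleftrightarrow> u \<in> a" if "a \<in> Q'" for u a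
      using that P by (auto simp: petals_def)
    then show ?thesis by (auto simp: nbh_def F_def fan_edges_def)
  qed
  moreover have "card (\<Union>Q') = k * ?f * p"
    using P by (subst card_Union_disjoint) (auto simp: petals_def pairwise_def disjnt_def disjoint_def)
  ultimately have degF: "deg F x = k * ?f * p" using card_nbh[of F V x] FE E by simp
  have cF: "card F = k * ?f * (p choose 2) + k * ?f * p"
    unfolding F_def card_fan_edges[OF P] by (simp add: numeral_2_eq_2 algebra_simps)
  define E' where "E' = {e \<in> E - F. x \<notin> e}"
  define R where "R = {e \<in> E - F. x \<in> e}"
  have "deg E x = card (R \<union> {e \<in> F. x \<in> e})"
    unfolding deg_def R_def using FE by (intro arg_cong[of _ _ card]) auto
  also have "\<dots> = card R + deg F x"
    unfolding deg_def R_def using fE fF by (intro card_Un_disjoint) auto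
  finally have degE: "deg E x = card R + k * ?f * p" using degF by simp
  have EU: "E = E' \<union> (R \<union> F)" using FE by (auto simp: E'_def R_def)
  have d1: "E' \<inter> (R \<union> F) = {}" "R \<inter> F = {}" by (auto simp: E'_def R_def)
  have fin: "finite E'" "finite R" using fE by (auto simp: E'_def R_def)
  have "card E = card E' + (card R + card F)"
    by (subst EU) (use d1 fin fF in \<open>simp add: card_Un_disjoint\<close>)
  then have c: "card E = card E' + deg E x + k * ?f * (p choose 2)" using cF degE by simp
  have "k * ?f * (p choose 2) \<le> card Q * (p choose 2)" by (intro mult_le_mono1) simp
  then have c': "card E \<le> card E' + deg E x + card Q * (p choose 2)" using c by simp
  have "phi E \<le> phi E' + phi (R \<union> F)" using phi_Un[OF d1(1)] EU by simp
  also have "\<dots> \<le> phi E' + (phi R + phi F)" using phi_Un[OF d1(2)] by simp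
  also have "\<dots> \<le> phi E' + (card R + ?f)"
    using phi_le_card[of R] phi_fan_edges_le[OF P] by (simp add: F_def)
  finally have "phi E + ?f * (k * p - 1) \<le> phi E' + (card R + (?f * (k * p - 1) + ?f))" by simp
  also have "?f * (k * p - 1) + ?f = k * ?f * p"
  proof -
    have "k * p \<ge> 1" using k2 p2 by (simp add: Suc_le_eq)
    then have "?f * (k * p - 1) + ?f = ?f * (k * p - 1 + 1)" by (simp add: algebra_simps)
    also have "\<dots> = k * ?f * p" using \<open>k * p \<ge> 1\<close> by simp
    finally show ?thesis .
  qed
  finally have "phi E + ?f * (k * p - 1) \<le> phi E' + deg E x" using degE by simp
  moreover have "E' \<subseteq> nsets (V - {x}) 2"
    using E by (auto simp: E'_def nsets_def)
  moreover have "E' \<subseteq> E" by (auto simp: E'_def)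
  ultimately show ?thesis using c' by blast
qed

end

section \<open>Turan numbers and stability\<close>

text \<open>The edge count of the \<open>p\<close>-partite Turan graph, built vertex by vertex: with
  residues modulo \<open>p\<close> as classes, vertex \<open>i\<close> is joined to all earlier
  vertices except the \<open>i div p\<close> in its own class. This recursive form matches the
  deletion of one vertex.\<close>

definition turan :: "nat \<Rightarrow> nat \<Rightarrow> nat" where
  "turan p n = (\<Sum>i<n. i - i div p)"

lemma turan_0 [simp]: "turan p 0 = 0" and turan_Suc: "turan p (Suc n) = turan p n + (n - n div p)"
  by (simp_all add: turan_def)

definition mono_edge :: "('a \<Rightarrow> 'c) \<Rightarrow> 'a set \<Rightarrow> bool" where
  "mono_edge c e \<longleftrightarrow> (\<forall>u\<in>e. \<forall>v\<in>e. c u = c v)"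

definition cross_pairs :: "'a set \<Rightarrow> ('a \<Rightarrow> 'c) \<Rightarrow> 'a set set" where
  "cross_pairs V c = {e \<in> nsets V 2. \<not> mono_edge c e}"

definition color_class :: "'a set \<Rightarrow> ('a \<Rightarrow> 'c) \<Rightarrow> 'c \<Rightarrow> 'a set" where
  "color_class V c j = {v \<in> V. c v = j}"

lemma mono_edge_doubleton [simp]: "mono_edge c {u, v} \<longleftrightarrow> c u = c v"
  by (auto simp: mono_edge_def)

lemma cross_pairs_subset: "cross_pairs V c \<subseteq> nsets V 2"
  by (auto simp: cross_pairs_def)

lemma doubleton_in_cross_pairs [simp]: "{u, v} \<in> cross_pairs V c \<longleftrightarrow> u \<in> V \<and> v \<in> V \<and> c u \<noteq> c v"
  by (auto simp: cross_pairs_def)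

lemma color_class_subset: "color_class V c j \<subseteq> V"
  by (auto simp: color_class_def)

lemma deg_cross_pairs:
  assumes "finite V" "v \<in> V"
  shows "deg (cross_pairs V c) v + card (color_class V c (c v)) = card V"
proof -
  have "nbh (cross_pairs V c) v = V - color_class V c (c v)"
    using assms by (auto simp: nbh_def color_class_def)
  then have "deg (cross_pairs V c) v = card (V - color_class V c (c v))"
    using card_nbh[OF cross_pairs_subset, of V c v] by simp
  also have "\<dots> = card V - card (color_class V c (c v))"
    using assms color_class_subset[of V c] by (intro card_Diff_subset) (auto intro: finite_subset)
  finally show ?thesis
    using card_mono[OF assms(1) color_class_subset[of V c "c v"]] by simp
qed

lemma card_eq_sum_color_classes:
  fixes c :: "'a \<Rightarrow> nat"
  assumes "finite V" "c ` V \<subseteq> {..<p}"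
  shows "card V = (\<Sum>j<p. card (color_class V c j))"
proof -
  have "V = (\<Union>j<p. color_class V c j)" using assms by (auto simp: color_class_def)
  then have "card V = card (\<Union>j<p. color_class V c j)" by simp
  also have "\<dots> = (\<Sum>j<p. card (color_class V c j))"
    using assms(1) by (intro card_UN_disjoint) (auto simp: color_class_def)
  finally show ?thesis .
qed

text \<open>Among \<open>n + 1\<close> vertices some class has more than \<open>n div p\<close>
  members. A vertex of that class has degree at most \<open>n - n div p\<close>, the increment of
  \<open>turan\<close>, and is deleted.\<close>

lemma card_cross_pairs_le_turan:
  fixes c :: "'a \<Rightarrow> nat"
  assumes "finite V" "c ` V \<subseteq> {..<p}" "p \<ge> 1"
  shows "card (cross_pairs V c) \<le> turan p (card V)"
  using assms
proof (induction "card V" arbitrary: V)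
  case 0
  then show ?case by (simp add: cross_pairs_def nsets_empty_iff)
next
  case (Suc n)
  have "\<exists>j<p. n div p < card (color_class V c j)"
  proof (rule ccontr)
    assume "\<not> ?thesis"
    then have "card V \<le> (\<Sum>j<p. n div p)"
      unfolding card_eq_sum_color_classes[OF Suc.prems(1,2)] by (intro sum_mono) (meson lessThan_iff not_less)
    also have "\<dots> \<le> n" by simp
    finally show False using Suc.hyps(2) by simp
  qed
  then obtain j where j: "j < p" "n div p < card (color_class V c j)" by blast
  then have "color_class V c j \<noteq> {}" by auto
  then obtain v where v: "v \<in> V" "c v = j" by (auto simp: color_class_def)
  have "{e \<in> cross_pairs V c. v \<notin> e} = cross_pairs (V - {v}) c"
    by (auto simp: cross_pairs_def nsets_def)
  then have "card (cross_pairs V c) = card (cross_pairs (V - {v}) c) + deg (cross_pairs V c) v"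
    using card_eq_without_vertex[OF finite_edges[OF Suc.prems(1) cross_pairs_subset], of c v] by simp
  also have "card (cross_pairs (V - {v}) c) \<le> turan p n"
  proof -
    have "n = card (V - {v})" using Suc.hyps(2) Suc.prems(1) v by simp
    moreover have "c ` (V - {v}) \<subseteq> {..<p}" using Suc.prems(2) by auto
    ultimately show ?thesis using Suc.hyps(1)[of "V - {v}"] Suc.prems(1,3) by simp
  qed
  also have "deg (cross_pairs V c) v \<le> n - n div p"
    using deg_cross_pairs[OF Suc.prems(1) v(1), of c] j v(2) Suc.hyps(2) by simp
  finally show ?case using Suc.hyps(2)[symmetric] by (simp add: turan_Suc)
qed

lemma turan_lower:
  assumes "p \<ge> 1"
  shows "2 * real (turan p n) \<ge> (1 - 1 / p) * (real n ^ 2 - n)"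
proof (induction n)
  case 0
  then show ?case by simp
next
  case (Suc n)
  have "real (n div p) \<le> n / p" by (simp add: of_nat_div_le_of_nat)
  then have "real (n - n div p) \<ge> n - n / p" by (simp add: of_nat_diff)
  then have "2 * real (turan p (Suc n)) \<ge> (1 - 1 / p) * (real n ^ 2 - n) + 2 * (n - n / p)"
    using Suc by (simp add: turan_Suc)
  also have "(1 - 1 / p) * (real n ^ 2 - n) + 2 * (n - n / p) = (1 - 1 / p) * (real (Suc n) ^ 2 - real (Suc n))"
    by (simp add: power2_eq_square algebra_simps)
  finally show ?case .
qed

text \<open>By the degree sum, the squared class sizes add up to
  \<open>n^2 - 2 * card (cross_pairs V c)\<close>. Subtracting \<open>n^2 / p\<close> gives the sum
  of the squared deviations from \<open>n / p\<close>, which is small when the cross pairs nearly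
  reach the Turan number.\<close>

lemma color_class_deviation:
  fixes c :: "'a \<Rightarrow> nat" and D :: real
  assumes "finite V" "c ` V \<subseteq> {..<p}" "p \<ge> 1"
    and "real (turan p (card V)) \<le> card (cross_pairs V c) + D" and "j < p"
  shows "(real (card (color_class V c j)) - card V / p) ^ 2 \<le> card V + 2 * D"
proof -
  let ?n = "real (card V)" and ?a = "\<lambda>j. real (card (color_class V c j))"
  have S: "(\<Sum>j<p. ?a j) = ?n"
    using card_eq_sum_color_classes[OF assms(1,2)] by (simp flip: of_nat_sum)
  have "2 * real (card (cross_pairs V c)) = (\<Sum>v\<in>V. real (deg (cross_pairs V c) v))"
    using handshake[OF assms(1) cross_pairs_subset, of c] by (metis of_nat_sum of_nat_mult of_nat_numeral)
  also have "\<dots> = (\<Sum>v\<in>V. ?n - ?a (c v))"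
  proof (rule sum.cong)
    fix v assume "v \<in> V"
    then show "real (deg (cross_pairs V c) v) = ?n - ?a (c v)"
      using deg_cross_pairs[OF assms(1), of v c] by (simp flip: of_nat_add)
  qed simp
  also have "\<dots> = ?n ^ 2 - (\<Sum>v\<in>V. ?a (c v))" by (simp add: sum_subtractf power2_eq_square)
  also have "(\<Sum>v\<in>V. ?a (c v)) = (\<Sum>j<p. \<Sum>v\<in>{v \<in> V. c v = j}. ?a (c v))"
    using assms(1,2) by (intro sum.group[symmetric]) auto
  also have "\<dots> = (\<Sum>j<p. ?a j ^ 2)"
    by (intro sum.cong) (auto simp: color_class_def power2_eq_square)
  finally have 1: "(\<Sum>j<p. ?a j ^ 2) = ?n ^ 2 - 2 * real (card (cross_pairs V c))" by simp
  have "(?a j - ?n / p) ^ 2 \<le> (\<Sum>j<p. (?a j - ?n / p) ^ 2)"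
    using assms(5) by (intro member_le_sum) auto
  also have "\<dots> = (\<Sum>j<p. ?a j ^ 2 - 2 * (?n / p) * ?a j + (?n / p) ^ 2)"
    by (intro sum.cong) (auto simp: power2_eq_square algebra_simps)
  also have "\<dots> = (\<Sum>j<p. ?a j ^ 2) - 2 * (?n / p) * (\<Sum>j<p. ?a j) + p * (?n / p) ^ 2"
    by (simp add: sum.distrib sum_subtractf sum_distrib_left)
  also have "\<dots> = (\<Sum>j<p. ?a j ^ 2) - ?n ^ 2 / p"
    unfolding S using assms(3) by (simp add: power2_eq_square)
  also have "\<dots> = (1 - 1 / p) * (?n ^ 2 - ?n) + (1 - 1 / p) * ?n - 2 * real (card (cross_pairs V c))"
    unfolding 1 by (simp add: algebra_simps)
  also have "\<dots> \<le> 2 * real (turan p (card V)) + ?n - 2 * real (card (cross_pairs V c))"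
  proof -
    have "(1 - 1 / p) * ?n \<le> 1 * ?n" by (intro mult_right_mono) auto
    then show ?thesis using turan_lower[OF assms(3), of "card V"] by linarith
  qed
  also have "\<dots> \<le> card V + 2 * D" using assms(4) by linarith
  finally show ?thesis .
qed

section \<open>Clique-free graphs and colourings with few inner edges\<close>

definition clique_free :: "nat \<Rightarrow> 'a set \<Rightarrow> 'a set set \<Rightarrow> bool" where
  "clique_free q V E \<longleftrightarrow> (\<forall>K\<subseteq>V. card K = q \<longrightarrow> \<not> nsets K 2 \<subseteq> E)"

text \<open>Fueredi's stability theorem: the colour classes are the successive non-neighbourhoods of
  vertices of maximum degree.\<close>

lemma clique_free_coloring:
  assumes "finite V" "E \<subseteq> nsets V 2" "clique_free (Suc p) V E"
  shows "\<exists>c::'a \<Rightarrow> nat. c ` V \<subseteq> {..<p} \<and> card E + card {e \<in> E. mono_edge c e} \<le> card (cross_pairs V c)"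
  using assms
proof (induction p arbitrary: V E)
  case 0
  have "V = {}"
  proof (rule ccontr)
    assume "V \<noteq> {}"
    then obtain v where v: "v \<in> V" by blast
    have "nsets {v} 2 = {}" by (auto simp: nsets_singleton_iff)
    then show False using 0(3) v unfolding clique_free_def by (auto dest!: spec[of _ "{v}"])
  qed
  then show ?case using 0(2) by (auto simp: nsets_empty_iff)
next
  case (Suc p)
  show ?case
  proof (cases "V = {}")
    case True
    then show ?thesis using Suc.prems(2) by (auto simp: nsets_empty_iff)
  next
    case False
    define d where "d = Max (deg E ` V)"
    have "d \<in> deg E ` V" unfolding d_def using Suc.prems(1) False by (intro Max_in) auto
    then obtain x where x: "x \<in> V" "deg E x = d" by auto
    have dmax: "deg E v \<le> d" if "v \<in> V" for v
      unfolding d_def using that Suc.prems(1) by (intro Max_ge) auto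
    define W where "W = nbh E x"
    have W: "W \<subseteq> V - {x}" unfolding W_def by (rule nbh_subset[OF Suc.prems(2)])
    have fW: "finite W" using W Suc.prems(1) by (auto intro: finite_subset)
    have cW: "card W = d" using card_nbh[OF Suc.prems(2)] x W_def by simp
    define E' where "E' = E \<inter> nsets W 2"
    have "clique_free (Suc p) W E'"
      unfolding clique_free_def
    proof (intro allI impI notI)
      fix K assume K: "K \<subseteq> W" "card K = Suc p" "nsets K 2 \<subseteq> E'"
      have fK: "finite K" using K(1) fW by (rule finite_subset)
      have "x \<notin> K" using K W by auto
      then have "card (insert x K) = Suc (Suc p)" using K fK by simp
      moreover have "insert x K \<subseteq> V" using K W x by auto
      moreover have "nsets (insert x K) 2 \<subseteq> E"
      proof
        fix e assume "e \<in> nsets (insert x K) 2"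
        then obtain u v where uv: "e = {u, v}" "u \<noteq> v" "u \<in> insert x K" "v \<in> insert x K" by (auto simp: nsets_2_eq)
        consider "u = x" "v \<in> W" | "v = x" "u \<in> W" | "u \<in> K" "v \<in> K" using uv K by auto
        then show "e \<in> E"
        proof cases
          case 1 then show ?thesis using uv by (auto simp: W_def nbh_def insert_commute)
        next
          case 2 then show ?thesis using uv by (auto simp: W_def nbh_def)
        next
          case 3 then have "e \<in> nsets K 2" using uv by auto
          then show ?thesis using K by (auto simp: E'_def)
        qed
      qed
      ultimately show False using Suc.prems(3) unfolding clique_free_def by blast
    qed
    then obtain c :: "'a \<Rightarrow> nat" where c: "c ` W \<subseteq> {..<p}"
      "card E' + card {e \<in> E'. mono_edge c e} \<le> card (cross_pairs W c)"
      using Suc.IH[OF fW, of E'] by (auto simp: E'_def)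
    define c' where "c' v = (if v \<in> W then c v else p)" for v
    define U where "U = V - W"
    have fE: "finite E" by (rule finite_edges[OF Suc.prems(1,2)])
    have col: "c' ` V \<subseteq> {..<Suc p}" using c by (auto simp: c'_def less_Suc_eq)
    have c'W: "c' v < p" "c' v = c v" if "v \<in> W" for v using c that by (auto simp: c'_def)
    have c'U: "c' v = p" if "v \<in> U" for v using that by (auto simp: c'_def U_def)
    \<comment> \<open>\<open>T\<close> holds the edges meeting \<open>U\<close> and \<open>B\<close>
      those inside \<open>U\<close>. The degree sum over \<open>U\<close> counts the former once and
      the latter once more, and no degree exceeds \<open>d = card W\<close>. So
      \<open>card T + card B\<close> is at most the number of pairs between \<open>U\<close> and
      \<open>W\<close>, all of which are cross pairs of \<open>c'\<close>.\<close>
    define T where "T = {e \<in> E. \<not> e \<subseteq> W}"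
    define B where "B = {e \<in> E. e \<subseteq> U}"
    have m1: "card E = card E' + card T"
    proof -
      have "E = E' \<union> T" using Suc.prems(2) by (auto simp: E'_def T_def nsets_def)
      moreover have "E' \<inter> T = {}" by (auto simp: E'_def T_def nsets_def)
      ultimately show ?thesis using fE by (metis card_Un_disjoint finite_Un)
    qed
    have m2: "card {e \<in> E. mono_edge c' e} \<le> card {e \<in> E'. mono_edge c e} + card B"
    proof -
      have "{e \<in> E. mono_edge c' e} \<subseteq> {e \<in> E'. mono_edge c e} \<union> B"
      proof
        fix e assume "e \<in> {e \<in> E. mono_edge c' e}"
        then have e: "e \<in> E" "mono_edge c' e" by auto
        then have "e \<in> nsets V 2" using Suc.prems(2) by auto
        then obtain u v where uv: "e = {u, v}" "u \<noteq> v" "u \<in> V" "v \<in> V" by (auto simp: nsets_2_eq)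
        then have same: "c' u = c' v" using e by auto
        show "e \<in> {e \<in> E'. mono_edge c e} \<union> B"
        proof (cases "u \<in> W")
          case True
          then have "v \<in> W" using same c'W[of u] c'U[of v] uv by (cases "v \<in> W") (auto simp: U_def)
          then show ?thesis using True same c'W[of u] c'W[of v] uv e by (auto simp: E'_def)
        next
          case False
          then have "v \<notin> W" using same c'W[of v] c'U[of u] uv by (auto simp: U_def)
          then show ?thesis using False uv e by (auto simp: B_def U_def)
        qed
      qed
      then have "card {e \<in> E. mono_edge c' e} \<le> card ({e \<in> E'. mono_edge c e} \<union> B)"
        using fE by (intro card_mono) (auto simp: E'_def B_def)
      then show ?thesis using card_Un_le order_trans by blast
    qed
    have m3: "card T + card B \<le> card U * card W"
    proof -
      have TB: "(\<Sum>v\<in>U. deg E v) = card T + card B"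
      proof -
        have "(\<Sum>v\<in>U. deg E v) = (\<Sum>v\<in>U. \<Sum>e\<in>E. if v \<in> e then 1 else 0)"
          unfolding deg_def using fE by (intro sum.cong) (auto simp: sum.If_cases Int_def)
        also have "\<dots> = (\<Sum>e\<in>E. \<Sum>v\<in>U. if v \<in> e then 1 else 0)" by (rule sum.swap)
        also have "\<dots> = (\<Sum>e\<in>E. (if \<not> e \<subseteq> W then 1 else 0) + (if e \<subseteq> U then 1 else 0))"
        proof (rule sum.cong)
          fix e assume "e \<in> E"
          then have "e \<in> nsets V 2" using Suc.prems(2) by auto
          then obtain u v where uv: "e = {u, v}" "u \<noteq> v" "u \<in> V" "v \<in> V" by (auto simp: nsets_2_eq)
          have fU: "finite U" using Suc.prems(1) by (simp add: U_def)
          have "(\<Sum>v\<in>U. if v \<in> e then 1 else 0) = card (U \<inter> e)"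
            using fU by (simp add: sum.If_cases)
          also have "\<dots> = (if \<not> e \<subseteq> W then 1 else 0) + (if e \<subseteq> U then 1 else 0)"
          proof (cases "u \<in> U"; cases "v \<in> U")
            assume "u \<in> U" "v \<in> U"
            then have "U \<inter> e = {u, v}" "\<not> e \<subseteq> W" "e \<subseteq> U" using uv by (auto simp: U_def)
            then show ?thesis using uv by simp
          next
            assume "u \<in> U" "v \<notin> U"
            then have "U \<inter> e = {u}" "\<not> e \<subseteq> W" "\<not> e \<subseteq> U" using uv by (auto simp: U_def)
            then show ?thesis using uv by simp
          next
            assume "u \<notin> U" "v \<in> U"
            then have "U \<inter> e = {v}" "\<not> e \<subseteq> W" "\<not> e \<subseteq> U" using uv by (auto simp: U_def)
            then show ?thesis using uv by simp
          next
            assume "u \<notin> U" "v \<notin> U"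
            then have "U \<inter> e = {}" "e \<subseteq> W" "\<not> e \<subseteq> U" using uv by (auto simp: U_def)
            then show ?thesis using uv by simp
          qed
          finally show "(\<Sum>v\<in>U. if v \<in> e then 1 else 0) = (if \<not> e \<subseteq> W then 1 else 0) + (if e \<subseteq> U then 1 else 0::nat)" .
        qed simp
        also have "\<dots> = card T + card B"
          unfolding T_def B_def using fE by (simp add: sum.distrib sum.If_cases Int_def)
        finally show ?thesis .
      qed
      have "(\<Sum>v\<in>U. deg E v) \<le> (\<Sum>v\<in>U. d)" by (intro sum_mono dmax) (auto simp: U_def)
      then show ?thesis using TB cW by simp
    qed
    have m4: "card (cross_pairs W c) + card U * card W \<le> card (cross_pairs V c')"
    proof -
      let ?X = "(\<lambda>(u, w). {u, w}) ` (U \<times> W)"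
      have UW: "U \<inter> W = {}" by (auto simp: U_def)
      have "inj_on (\<lambda>(u, w). {u, w}) (U \<times> W)"
        using UW by (auto simp: inj_on_def doubleton_eq_iff)
      then have "card ?X = card U * card W" by (simp add: card_image card_cartesian_product)
      moreover have "cross_pairs W c \<inter> ?X = {}"
        using UW by (auto simp: cross_pairs_def nsets_def)
      moreover have fX: "finite ?X" "finite (cross_pairs W c)"
        using fW Suc.prems(1) finite_edges[OF fW cross_pairs_subset] by (auto simp: U_def)
      ultimately have "card (cross_pairs W c) + card U * card W = card (cross_pairs W c \<union> ?X)"
        by (simp add: card_Un_disjoint)
      also have "\<dots> \<le> card (cross_pairs V c')"
      proof (rule card_mono)
        show "finite (cross_pairs V c')" by (rule finite_edges[OF Suc.prems(1) cross_pairs_subset])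
        have "e \<in> cross_pairs V c'" if "e \<in> cross_pairs W c" for e
        proof -
          have "e \<in> nsets W 2" using that by (simp add: cross_pairs_def)
          then obtain u v where uv: "e = {u, v}" "u \<noteq> v" "u \<in> W" "v \<in> W" by (auto simp: nsets_2_eq)
          then show ?thesis using that W c'W by auto
        qed
        moreover have "{u, w} \<in> cross_pairs V c'" if "u \<in> U" "w \<in> W" for u w
          using that c'U[of u] c'W[of w] W by (auto simp: U_def)
        ultimately show "cross_pairs W c \<union> ?X \<subseteq> cross_pairs V c'" by auto
      qed
      finally show ?thesis .
    qed
    show ?thesis using col m1 m2 m3 m4 c(2) by (intro exI[of _ c']) auto
  qed
qed

section \<open>Vertex deletion\<close>

text \<open>A vertex of \<open>W\<close> has at most \<open>card V - d\<close> non-neighbours,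
  itself included, so \<open>p\<close> vertices can be chosen greedily; they are distinct because a
  one-element set is not an edge. In the application \<open>W\<close> is a neighbourhood without the
  vertices already used.\<close>

lemma exists_disjoint_clique:
  assumes V: "finite V" and E: "E \<subseteq> nsets V 2" and W: "W \<subseteq> V"
    and d: "\<And>v. v \<in> W \<Longrightarrow> d \<le> deg E v" and big: "(p - 1) * (card V - d) < card W"
  shows "\<exists>q\<subseteq>W. card q = p \<and> nsets q 2 \<subseteq> E"
proof -
  have fW: "finite W" using V W by (rule rev_finite_subset)
  have "\<exists>g. (\<forall>i\<in>{..<p}. g i \<in> W) \<and> (\<forall>i\<in>{..<p}. \<forall>i'\<in>{..<p}. i \<noteq> i' \<longrightarrow> \<not> {g i, g i'} \<notin> E)"
  proof (rule greedy_transversal)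
    fix v assume v: "v \<in> W"
    have "{u \<in> W. {u, v} \<notin> E} \<subseteq> V - nbh E v" using W by (auto simp: nbh_def)
    then have "card {u \<in> W. {u, v} \<notin> E} \<le> card (V - nbh E v)" using V by (intro card_mono) auto
    also have "\<dots> = card V - deg E v"
      using nbh_subset[OF E] card_nbh[OF E, of v] finite_nbh[OF V E, of v]
      by (subst card_Diff_subset) (auto simp: subset_Diff_insert)
    also have "\<dots> \<le> card V - d" using d[OF v] by simp
    finally show "card {u \<in> W. {u, v} \<notin> E} \<le> card V - d" .
  next
    show "(card {..<p} - 1) * (card V - d) < card W" using big by simp
  qed (use fW in \<open>auto simp: insert_commute\<close>)
  then obtain g where g: "\<And>i. i < p \<Longrightarrow> g i \<in> W" "\<And>i i'. i < p \<Longrightarrow> i' < p \<Longrightarrow> i \<noteq> i' \<Longrightarrow> {g i, g i'} \<in> E"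
    by auto
  have "inj_on g {..<p}"
  proof (rule inj_onI, rule ccontr)
    fix i i' assume i: "i \<in> {..<p}" "i' \<in> {..<p}" "g i = g i'" "i \<noteq> i'"
    then have "{g i, g i'} \<in> nsets V 2" using g(2)[of i i'] E by blast
    then show False using i(3) by (simp add: nsets_def)
  qed
  then have "card (g ` {..<p}) = p" by (simp add: card_image)
  moreover have "g ` {..<p} \<subseteq> W" using g by auto
  moreover have "nsets (g ` {..<p}) 2 \<subseteq> E"
    using g(2) by (auto simp: nsets_2_eq)
  ultimately show ?thesis by blast
qed

context fan_setting
begin

text \<open>A fan uses \<open>k\<close> cliques and saves \<open>k * p - 1\<close>, hence at least
  \<open>3 * k / 2\<close>, parts: 3/2 per clique. The summand \<open>3 * k\<close> covers the fewer
  than \<open>k\<close> cliques left over by the division.\<close>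

lemma fan_gain: "3 * t \<le> 2 * (t div k * (k * p - 1)) + 3 * k"
proof -
  have "t \<le> k * (t div k) + k"
    using k2 mod_less_divisor[of k t] mult_div_mod_eq[of k t] by linarith
  moreover have "2 * (k * p - 1) \<ge> 3 * k"
  proof -
    have "k * 2 \<le> k * p" using p2 by (intro mult_le_mono2)
    then show ?thesis using k2 by linarith
  qed
  then have "t div k * (2 * (k * p - 1)) \<ge> t div k * (3 * k)" by (rule mult_le_mono2)
  ultimately show ?thesis by (simp add: algebra_simps)
qed

text \<open>The edges lost per chosen clique: one from the surplus degree of the deleted vertex and
  \<open>p choose 2\<close> inside the clique. Doubled, it is the weight at which a saving of
  \<open>t / 2\<close> parts makes up for \<open>chain_const * t\<close> lost edges.\<close>

definition chain_const :: nat where "chain_const = 1 + (p choose 2)"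

text \<open>Bollobas' vertex deletion: if the minimum degree exceeds that of the Turan graph by \<open>t\<close>, the
  neighbourhood of a vertex of minimum degree contains \<open>t\<close> disjoint cliques of size \<open>p\<close>.\<close>

lemma card_phi_bound:
  assumes "finite V" "E \<subseteq> nsets V 2"
  shows "card E + 2 * chain_const * phi E \<le> (2 * chain_const + 1) * turan p (card V) + 3 * k * chain_const * card V"
  using assms
proof (induction "card V" arbitrary: V E)
  case 0
  then have "E = {}" by (auto simp: nsets_empty_iff)
  then show ?case using phi_le_card[of E] by simp
next
  case (Suc n)
  let ?L = chain_const
  have "V \<noteq> {}" using Suc.hyps(2) by auto
  define d where "d = Min (deg E ` V)"
  have "d \<in> deg E ` V" unfolding d_def using Suc.prems(1) \<open>V \<noteq> {}\<close> by (intro Min_in) auto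
  then obtain x where x: "x \<in> V" "deg E x = d" by auto
  have dmin: "d \<le> deg E v" if "v \<in> V" for v
    unfolding d_def using that Suc.prems(1) by (intro Min_le) auto
  define \<delta> where "\<delta> = n - n div p"
  \<comment> \<open>Truncated subtraction: for a degree of at most \<open>\<delta>\<close> the
    family below is empty and \<open>x\<close> is simply deleted.\<close>
  define t where "t = d - \<delta>"
  have "\<exists>Q. finite Q \<and> card Q = t \<and> disjoint Q \<and> (\<forall>q\<in>Q. card q = p \<and> q \<subseteq> nbh E x \<and> nsets q 2 \<subseteq> E)"
  proof (rule greedy_disjoint_family)
    fix Q assume Q: "finite Q" "card Q < t" "disjoint Q" "\<forall>q\<in>Q. card q = p \<and> q \<subseteq> nbh E x \<and> nsets q 2 \<subseteq> E"
    have "card (nbh E x - \<Union>Q) \<ge> d - p * card Q"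
    proof -
      have "card (\<Union>Q) \<le> (\<Sum>q\<in>Q. card q)" by (rule card_Union_le_sum_card)
      also have "\<dots> = p * card Q" using Q by simp
      finally have "card (\<Union>Q) \<le> p * card Q" .
      moreover have "card (nbh E x) - card (\<Union>Q) \<le> card (nbh E x - \<Union>Q)"
      proof (rule diff_card_le_card_Diff)
        have "\<Union>Q \<subseteq> nbh E x" using Q(4) by blast
        then show "finite (\<Union>Q)" using finite_nbh[OF Suc.prems] by (rule finite_subset)
      qed
      ultimately show ?thesis using card_nbh[OF Suc.prems(2), of x] x by linarith
    qed
    \<comment> \<open>With \<open>s = card Q\<close> this says
      \<open>(p - 1) * (n + 1) + p * s < p * d\<close> in the integers, which follows from
      \<open>d \<ge> \<delta> + s + 1\<close> and \<open>p * (n div p) \<le> n\<close>.\<close>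
    moreover have "(p - 1) * (card V - d) < d - p * card Q"
    proof -

      define s where "s = card Q"
      have dn: "d \<le> n"
        using card_mono[OF _ nbh_subset[OF Suc.prems(2), of x]] card_nbh[OF Suc.prems(2), of x] x Suc.prems(1) Suc.hyps(2) by simp
      have pn: "p * (n div p) \<le> n" by simp
      have nd: "n div p \<le> n" by simp
      have ds: "d \<ge> n - n div p + s + 1" using Q(2) nd unfolding t_def \<delta>_def s_def by linarith
      have "int d \<ge> int n - int (n div p) + int s + 1" using ds nd by linarith
      then have "int p * int d \<ge> int p * (int n - int (n div p) + int s + 1)"
        by (intro mult_left_mono) auto
      moreover have "int p * int (n div p) \<le> int n" using pn by (metis of_nat_le_iff of_nat_mult)
      ultimately have "(int p - 1) * (int n + 1 - int d) < int d - int p * int s"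
        by (simp add: algebra_simps)
      moreover have "int (p - 1) = int p - 1" "int (card V - d) = int n + 1 - int d"
        using p2 dn Suc.hyps(2) by auto
      ultimately have "int ((p - 1) * (card V - d)) < int d - int (p * s)"
        by (metis of_nat_mult)
      then show ?thesis unfolding s_def by linarith
    qed
    ultimately have "(p - 1) * (card V - d) < card (nbh E x - \<Union>Q)" by linarith
    moreover have "nbh E x - \<Union>Q \<subseteq> V" using nbh_subset[OF Suc.prems(2), of x] by auto
    ultimately obtain q where "q \<subseteq> nbh E x - \<Union>Q" "card q = p" "nsets q 2 \<subseteq> E"
      using exists_disjoint_clique[OF Suc.prems, of "nbh E x - \<Union>Q" d p] dmin by blast
    then show "\<exists>q. (card q = p \<and> q \<subseteq> nbh E x \<and> nsets q 2 \<subseteq> E) \<and> q \<inter> \<Union>Q = {}" by blast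
  next
    fix q assume "card q = p \<and> q \<subseteq> nbh E x \<and> nsets q 2 \<subseteq> E"
    then show "q \<noteq> {}" using p2 by auto
  qed
  then obtain Q where Q: "finite Q" "card Q = t" "disjoint Q"
    "\<And>q. q \<in> Q \<Longrightarrow> card q = p \<and> q \<subseteq> nbh E x \<and> nsets q 2 \<subseteq> E" by blast
  obtain E' where E': "E' \<subseteq> nsets (V - {x}) 2" "phi E + (t div k) * (k * p - 1) \<le> phi E' + d"
    "card E \<le> card E' + d + t * (p choose 2)"
    using star_removal[OF Suc.prems x(1) Q(1,3,4)] Q(2) x(2) by blast
  have IH: "card E' + 2 * ?L * phi E' \<le> (2 * ?L + 1) * turan p n + 3 * k * ?L * n"
  proof -
    have n: "n = card (V - {x})" using Suc.hyps(2) Suc.prems(1) x(1) by simp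
    show ?thesis using Suc.hyps(1)[OF n _ E'(1)] Suc.prems(1) n by simp
  qed
  define f where "f = t div k"
  have fk: "2 * (f * (k * p - 1)) + 3 * k \<ge> 3 * t" unfolding f_def by (rule fan_gain)
  have dt: "d \<le> \<delta> + t" by (simp add: t_def)
  have "phi E + f * (k * p - 1) \<le> phi E' + \<delta> + t" using E'(2) dt by (simp add: f_def)
  then have "2 * phi E + 3 * t \<le> 2 * phi E' + 2 * \<delta> + 2 * t + 3 * k" using fk by linarith
  then have "2 * phi E + t \<le> 2 * phi E' + 2 * \<delta> + 3 * k" by linarith
  \<comment> \<open>After this multiplication the term with \<open>t\<close> on the left cancels the
    \<open>?L * t\<close> edges lost in the next inequality.\<close>
  then have "?L * (2 * phi E + t) \<le> ?L * (2 * phi E' + 2 * \<delta> + 3 * k)" by (rule mult_le_mono2)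
  moreover have "card E \<le> card E' + \<delta> + ?L * t"
    using E'(3) dt by (simp add: chain_const_def algebra_simps)
  ultimately have "card E + 2 * ?L * phi E \<le> card E' + 2 * ?L * phi E' + (2 * ?L + 1) * \<delta> + 3 * k * ?L"
    by (simp add: algebra_simps)
  then have "card E + 2 * ?L * phi E \<le> (2 * ?L + 1) * (turan p n + \<delta>) + 3 * k * ?L * Suc n"
    using IH by (simp add: algebra_simps)
  then show ?case using Suc.hyps(2)[symmetric] by (simp add: turan_Suc \<delta>_def)
qed

text \<open>Removing \<open>m\<close> edge-disjoint fans until none is left gives
  \<open>phi E \<le> card R + m\<close> and \<open>card E = card R + m * fan_size\<close>; the
  inequality is the result of eliminating \<open>m\<close>.\<close>

lemma exists_fan_free_subset:
  assumes "finite E"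
  shows "\<exists>R\<subseteq>E. fan_free R \<and> fan_size * phi E \<le> (fan_size - 1) * card R + card E"
  using assms
proof (induction "card E" arbitrary: E rule: less_induct)
  case less
  show ?case
  proof (cases "fan_free E")
    case True
    have "fan_size * phi E \<le> fan_size * card E" using phi_le_card by simp
    also have "\<dots> = (fan_size - 1) * card E + card E"
      using fan_size_ge(2) by (cases fan_size) auto
    finally show ?thesis using True by auto
  next
    case False
    then obtain A where A: "A \<subseteq> E" "is_fan A" by (auto simp: fan_free_def)
    have fA: "finite A" "card A = fan_size" "A \<noteq> {}" using is_fanD[OF A(2)] by auto
    have cE: "card E = card (E - A) + fan_size"
      using A fA less.prems card_mono[OF less.prems A(1)] by (simp add: card_Diff_subset)
    then have "card (E - A) < card E" using fan_size_ge(2) by simp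
    then obtain R where R: "R \<subseteq> E - A" "fan_free R"
      "fan_size * phi (E - A) \<le> (fan_size - 1) * card R + card (E - A)"
      using less.hyps[of "E - A"] less.prems by auto
    have "fan_size * phi E \<le> fan_size * (phi (E - A) + 1)"
      using phi_remove_fan[OF A(2,1)] by (rule mult_le_mono2)
    also have "\<dots> \<le> (fan_size - 1) * card R + card E" using R(3) cE by simp
    finally show ?thesis using R by blast
  qed
qed

text \<open>In a fan-free graph a disjoint family of \<open>p\<close>-cliques in the neighbourhood
  of \<open>x\<close> has fewer than \<open>k\<close> members, so the at most \<open>k * p\<close>
  vertices of a maximal family meet every such clique. Deleting the edges from \<open>x\<close> to
  them destroys every copy of \<open>K_r\<close> through \<open>x\<close>.\<close>

lemma fan_free_clique_free:
  assumes V: "finite V" and R: "R \<subseteq> nsets V 2" and free: "fan_free R"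
  shows "\<exists>Q\<subseteq>R. clique_free (Suc p) V Q \<and> card R \<le> card Q + card V * (k * p)"
proof -
  have "\<exists>H\<subseteq>nbh R x. card H \<le> k * p \<and> (\<forall>q\<subseteq>nbh R x. card q = p \<and> nsets q 2 \<subseteq> R \<longrightarrow> q \<inter> H \<noteq> {})" for x
  proof -
    let ?P = "\<lambda>q. card q = p \<and> q \<subseteq> nbh R x \<and> nsets q 2 \<subseteq> R"
    have "\<exists>Q. finite Q \<and> card Q < k \<and> disjoint Q \<and> (\<forall>q\<in>Q. ?P q) \<and> \<not> (\<exists>q. ?P q \<and> q \<inter> \<Union>Q = {})"
    proof (rule ccontr)
      assume con: "\<not> ?thesis"
      have "\<exists>Q. finite Q \<and> card Q = k \<and> disjoint Q \<and> (\<forall>q\<in>Q. ?P q)"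
      proof (rule greedy_disjoint_family)
        fix q assume "?P q"
        then show "q \<noteq> {}" using p2 by auto
      qed (use con in blast)
      then obtain Q where Q: "finite Q" "card Q = k" "disjoint Q" "\<forall>q\<in>Q. ?P q" by blast
      have "petals k p x Q"
        unfolding petals_def
      proof (intro conjI ballI)
        fix q assume "q \<in> Q"
        then have q: "?P q" using Q by blast
        then show "card q = p" "finite q" "x \<notin> q"
          using p2 nbh_subset[OF R, of x] by (auto intro: card_ge_0_finite)
      qed (use Q in auto)
      moreover have "fan_edges x Q \<subseteq> R"
        using Q(4) by (intro fan_edges_subset) auto
      ultimately show False using free by (auto simp: fan_free_def is_fan_def)
    qed
    then obtain Q where Q: "finite Q" "card Q < k" "disjoint Q" "\<forall>q\<in>Q. ?P q" "\<not> (\<exists>q. ?P q \<and> q \<inter> \<Union>Q = {})" by blast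
    have "card (\<Union>Q) \<le> (\<Sum>q\<in>Q. card q)" by (rule card_Union_le_sum_card)
    also have "\<dots> = card Q * p" using Q by simp
    also have "\<dots> \<le> k * p" using Q by (intro mult_le_mono1) simp
    finally show ?thesis using Q by (intro exI[of _ "\<Union>Q"]) blast
  qed
  then obtain H where H: "\<And>x. H x \<subseteq> nbh R x" "\<And>x. card (H x) \<le> k * p"
    "\<And>x q. q \<subseteq> nbh R x \<Longrightarrow> card q = p \<Longrightarrow> nsets q 2 \<subseteq> R \<Longrightarrow> q \<inter> H x \<noteq> {}" by metis
  define D where "D = (\<Union>x\<in>V. (\<lambda>u. {u, x}) ` H x)"
  have fH: "finite (H x)" for x using H(1) finite_nbh[OF V R] finite_subset by blast
  have fR: "finite R" by (rule finite_edges[OF V R])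
  have "card D \<le> (\<Sum>x\<in>V. card ((\<lambda>u. {u, x}) ` H x))" unfolding D_def by (rule card_UN_le[OF V])
  also have "\<dots> \<le> (\<Sum>x\<in>V. k * p)"
    by (intro sum_mono) (use card_image_le[OF fH] H(2) order_trans in blast)
  finally have cD: "card D \<le> card V * (k * p)" by simp
  have "card R - card D \<le> card (R - D)"
    using fH V by (intro diff_card_le_card_Diff) (auto simp: D_def)
  then have c: "card R \<le> card (R - D) + card V * (k * p)" using cD by linarith
  have "clique_free (Suc p) V (R - D)"
    unfolding clique_free_def
  proof (intro allI impI notI)
    fix K assume K: "K \<subseteq> V" "card K = Suc p" "nsets K 2 \<subseteq> R - D"
    have "finite K" using K(1) V by (rule finite_subset)
    from K(2) obtain x where x: "x \<in> K" by (metis card_eq_0_iff ex_in_conv nat.simps(3))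
    let ?q = "K - {x}"
    have "{u, x} \<in> R" if "u \<in> ?q" for u
    proof -
      have "{u, x} \<in> nsets K 2" using that x by auto
      then show ?thesis using K(3) by blast
    qed
    then have "?q \<subseteq> nbh R x" by (auto simp: nbh_def)
    moreover have "nsets ?q 2 \<subseteq> R" using K(3) nsets_mono[of ?q K 2] by blast
    moreover have "card ?q = p" using x K \<open>finite K\<close> by simp
    ultimately obtain u where u: "u \<in> ?q" "u \<in> H x" using H(3)[of ?q x] by blast
    have "{u, x} \<in> nsets K 2" using u x by auto
    moreover have "{u, x} \<in> D" using u x K by (auto simp: D_def)
    ultimately show False using K(3) by blast
  qed
  then show ?thesis using c by blast
qed

lemma almost_partite:
  "\<exists>C. \<forall>V E. finite V \<and> E \<subseteq> nsets V 2 \<and> turan p (card V) \<le> phi E \<longrightarrow>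
     (\<exists>c. c ` V \<subseteq> {..<p} \<and> card {e \<in> E. mono_edge c e} \<le> C * card V \<and>
        card (cross_pairs V c - E) \<le> C * card V)"
proof -
  \<comment> \<open>\<open>C1\<close> is the linear error of \<open>card_phi_bound\<close>;
    \<open>C2\<close> adds the edges deleted to destroy the copies of \<open>K_r\<close>. The inner
    edges of \<open>E\<close> number at most \<open>C2 * n\<close> in the clique-free subgraph
    \<open>Q\<close> and \<open>(C1 + C2) * n\<close> outside it, whence the factor 3.\<close>
  define C1 where "C1 = 3 * k * chain_const"
  define C2 where "C2 = C1 + k * p"
  have "\<exists>c. c ` V \<subseteq> {..<p} \<and> card {e \<in> E. mono_edge c e} \<le> (3 * C2) * card V \<and>
        card (cross_pairs V c - E) \<le> (3 * C2) * card V"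
    if V: "finite V" and E: "E \<subseteq> nsets V 2" and T: "turan p (card V) \<le> phi E" for V E
  proof -
    let ?n = "card V" and ?T = "turan p (card V)"
    have fE: "finite E" by (rule finite_edges[OF V E])
    have "card E + 2 * chain_const * ?T \<le> card E + 2 * chain_const * phi E" using T by simp
    also have "\<dots> \<le> (2 * chain_const + 1) * ?T + C1 * ?n" using card_phi_bound[OF V E] by (simp add: C1_def)
    finally have e1: "card E \<le> ?T + C1 * ?n" by (simp add: algebra_simps)
    obtain R where R: "R \<subseteq> E" "fan_free R" "fan_size * phi E \<le> (fan_size - 1) * card R + card E"
      using exists_fan_free_subset[OF fE] by blast
    \<comment> \<open>With \<open>fan_size = m + 1\<close> the packing inequality bounds
      \<open>(m + 1) * ?T\<close> by \<open>m * card R + card E\<close>, and \<open>e1\<close>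
      removes one \<open>?T\<close>.\<close>
    have RT: "?T \<le> card R + C1 * ?n"
    proof -
      obtain m where m: "fan_size = Suc m" "m \<ge> 1" using fan_size_ge(2) by (cases fan_size) auto
      have "Suc m * ?T \<le> Suc m * phi E" using T by (rule mult_le_mono2)
      then have "m * ?T \<le> m * card R + C1 * ?n" using R(3) e1 m(1) by simp
      also have "\<dots> \<le> m * card R + m * (C1 * ?n)" using m(2) by simp
      also have "\<dots> = m * (card R + C1 * ?n)" by (simp add: algebra_simps)
      finally show ?thesis using m(2) by simp
    qed
    have RV: "R \<subseteq> nsets V 2" using R E by auto
    obtain Q where Q: "Q \<subseteq> R" "clique_free (Suc p) V Q" "card R \<le> card Q + ?n * (k * p)"
      using fan_free_clique_free[OF V RV R(2)] by blast
    have QT: "?T \<le> card Q + C2 * ?n" using RT Q(3) by (simp add: C2_def algebra_simps)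
    have QV: "Q \<subseteq> nsets V 2" using Q RV by auto
    have fQ: "finite Q" by (rule finite_edges[OF V QV])
    obtain c where c: "c ` V \<subseteq> {..<p}" "card Q + card {e \<in> Q. mono_edge c e} \<le> card (cross_pairs V c)"
      using clique_free_coloring[OF V QV Q(2)] by blast
    have cT: "card (cross_pairs V c) \<le> ?T" using p2 by (intro card_cross_pairs_le_turan[OF V c(1)]) auto
    have iQ: "card {e \<in> Q. mono_edge c e} \<le> C2 * ?n" using c(2) cT QT by linarith
    have "card {e \<in> E. mono_edge c e} \<le> card ({e \<in> Q. mono_edge c e} \<union> (E - Q))"
      using fE fQ by (intro card_mono) auto
    also have "\<dots> \<le> card {e \<in> Q. mono_edge c e} + card (E - Q)" by (rule card_Un_le)
    also have "card (E - Q) = card E - card Q" using Q R fQ by (intro card_Diff_subset) auto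
    also have "card E - card Q \<le> C1 * ?n + C2 * ?n" using e1 QT by linarith
    finally have "card {e \<in> E. mono_edge c e} \<le> C2 * ?n + (C1 * ?n + C2 * ?n)" using iQ by linarith
    moreover have "C1 * ?n \<le> C2 * ?n" by (simp add: C2_def)
    ultimately have b: "card {e \<in> E. mono_edge c e} \<le> (3 * C2) * ?n" by linarith
    have fX: "finite (cross_pairs V c)" by (rule finite_edges[OF V cross_pairs_subset])
    let ?Q' = "{e \<in> Q. \<not> mono_edge c e}"
    have "card (cross_pairs V c - E) \<le> card (cross_pairs V c - ?Q')"
      using fX Q R by (intro card_mono) auto
    also have "\<dots> = card (cross_pairs V c) - card ?Q'"
      using fQ QV by (intro card_Diff_subset) (auto simp: cross_pairs_def)
    also have "card Q = card ?Q' + card {e \<in> Q. mono_edge c e}"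
      using fQ by (subst card_Un_disjoint[symmetric]) (auto intro!: arg_cong[of _ _ card])
    then have "card (cross_pairs V c) - card ?Q' \<le> (3 * C2) * ?n"
      using cT QT iQ by (simp add: algebra_simps)
    finally show ?thesis using b c(1) by blast
  qed
  then show ?thesis by blast
qed

end

section \<open>Balanced colourings\<close>

abbreviation inner_edges :: "('a \<Rightarrow> 'c) \<Rightarrow> 'a set set \<Rightarrow> 'a set set" where
  "inner_edges c E \<equiv> {e \<in> E. mono_edge c e}"

abbreviation missing_edges :: "'a set \<Rightarrow> ('a \<Rightarrow> 'c) \<Rightarrow> 'a set set \<Rightarrow> 'a set set" where
  "missing_edges V c E \<equiv> cross_pairs V c - E"

lemma deg_Un_disjoint:
  assumes "finite A" "finite B" "A \<inter> B = {}"
  shows "deg (A \<union> B) v = deg A v + deg B v"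
proof -
  have "{e \<in> A \<union> B. v \<in> e} = {e \<in> A. v \<in> e} \<union> {e \<in> B. v \<in> e}" by auto
  then show ?thesis
    unfolding deg_def using assms by (simp add: card_Un_disjoint disjoint_iff)
qed

lemma partite_splits:
  assumes "E \<subseteq> nsets V 2"
  shows "E = inner_edges c E \<union> (E \<inter> cross_pairs V c)"
    "cross_pairs V c = missing_edges V c E \<union> (E \<inter> cross_pairs V c)"
    "inner_edges c E \<inter> (E \<inter> cross_pairs V c) = {}"
  using assms by (auto simp: cross_pairs_def)

text \<open>\<open>E\<close> and \<open>cross_pairs V c\<close> have the present cross pairs in
  common. The identity, written without subtraction, turns statements about \<open>card E\<close>
  into statements about inner minus missing edges.\<close>

lemma card_balance:
  assumes "finite V" "E \<subseteq> nsets V 2"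
  shows "card (missing_edges V c E) + card E = card (cross_pairs V c) + card (inner_edges c E)"
proof -
  have fin: "finite E" "finite (cross_pairs V c)"
    using finite_edges[OF assms] finite_edges[OF assms(1) cross_pairs_subset] by auto
  have "card E = card (inner_edges c E) + card (E \<inter> cross_pairs V c)"
    by (subst partite_splits(1)[OF assms(2), of c], rule card_Un_disjoint)
      (use fin partite_splits(3)[OF assms(2)] in auto)
  moreover have "card (cross_pairs V c) = card (missing_edges V c E) + card (E \<inter> cross_pairs V c)"
    by (subst (1) partite_splits(2)[OF assms(2), of c], rule card_Un_disjoint) (use fin in auto)
  ultimately show ?thesis by simp
qed

lemma deg_balance:
  assumes "finite V" "E \<subseteq> nsets V 2" "v \<in> V"
  shows "deg (missing_edges V c E) v + deg E v + card (color_class V c (c v))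
    = card V + deg (inner_edges c E) v"
proof -
  have fin: "finite E" "finite (cross_pairs V c)"
    using finite_edges[OF assms(1,2)] finite_edges[OF assms(1) cross_pairs_subset] by auto
  have "deg E v = deg (inner_edges c E) v + deg (E \<inter> cross_pairs V c) v"
    by (subst partite_splits(1)[OF assms(2), of c], rule deg_Un_disjoint)
      (use fin partite_splits(3)[OF assms(2)] in auto)
  moreover have "deg (cross_pairs V c) v = deg (missing_edges V c E) v + deg (E \<inter> cross_pairs V c) v"
    by (subst (1) partite_splits(2)[OF assms(2), of c], rule deg_Un_disjoint) (use fin in auto)
  ultimately show ?thesis using deg_cross_pairs[OF assms(1,3), of c] by simp
qed

lemma deg_inner_edges:
  assumes "E \<subseteq> nsets V 2"
  shows "deg (inner_edges c E) v = card (nbh E v \<inter> color_class V c (c v))"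
proof -
  have sub: "inner_edges c E \<subseteq> nsets V 2" using assms by auto
  have "nbh (inner_edges c E) v = nbh E v \<inter> color_class V c (c v)"
    using nbh_subset[OF assms, of v] by (auto simp: nbh_def color_class_def)
  then show ?thesis using card_nbh[OF sub, of v] by simp
qed

lemma card_edges_meeting:
  assumes "finite V" "X \<subseteq> V"
  shows "card {e \<in> nsets V 2. e \<inter> X \<noteq> {}} \<le> card X * card V"
proof -
  have fX: "finite X" using assms by (auto intro: finite_subset)
  have "{e \<in> nsets V 2. e \<inter> X \<noteq> {}} \<subseteq> (\<Union>x\<in>X. (\<lambda>u. {u, x}) ` V)"
    by (auto simp: nsets_2_eq)
  then have "card {e \<in> nsets V 2. e \<inter> X \<noteq> {}} \<le> card (\<Union>x\<in>X. (\<lambda>u. {u, x}) ` V)"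
    using assms fX by (intro card_mono) auto
  also have "\<dots> \<le> (\<Sum>x\<in>X. card ((\<lambda>u. {u, x}) ` V))" by (rule card_UN_le[OF fX])
  also have "\<dots> \<le> (\<Sum>x\<in>X. card V)" by (intro sum_mono card_image_le assms)
  finally show ?thesis by simp
qed

text \<open>For \<open>n \<ge> 1\<close>, the minimum degree of the \<open>p\<close>-partite Turan
  graph on \<open>n\<close> vertices: its largest class has \<open>(n - 1) div p + 1\<close>
  members.\<close>

definition turan_step :: "nat \<Rightarrow> nat \<Rightarrow> nat" where
  "turan_step p n = n - 1 - (n - 1) div p"

lemma turan_eq_step: "n \<ge> 1 \<Longrightarrow> turan p n = turan p (n - 1) + turan_step p n"
  by (cases n) (simp_all add: turan_Suc turan_step_def)

lemma turan_step_bounds: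
  assumes "n \<ge> 1" "p \<ge> 1"
  shows "real (turan_step p n) \<ge> n - n / p - 1"
proof -
  have "real ((n - 1) div p) \<le> real (n - 1) / p" by (simp add: of_nat_div_le_of_nat)
  also have "\<dots> \<le> n / p" using assms by (intro divide_right_mono) auto
  finally have "real ((n - 1) div p) \<le> n / p" .
  moreover have "real (turan_step p n) \<ge> real (n - 1) - real ((n - 1) div p)"
    unfolding turan_step_def by linarith
  ultimately show ?thesis using assms by simp
qed

context fan_setting
begin

text \<open>With \<open>a\<close> the smallest number of neighbours of \<open>x\<close> in a class, the degree of \<open>x\<close> exceeds the
  Turan degree by about \<open>a\<close>, while about \<open>a\<close> disjoint transversal cliques in the neighbourhood save
  at least \<open>3/2\<close> parts each.\<close>

lemma crossing_vertex_removal: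
  fixes C \<alpha> :: real
  assumes V: "finite V" and E: "E \<subseteq> nsets V 2" and c: "c ` V \<subseteq> {..<p}" and x: "x \<in> V"
    and M: "real (card (missing_edges V c E)) \<le> C * card V" and C: "C \<ge> 0"
    and \<alpha>: "\<alpha> > 0"
    and size: "\<And>j. j < p \<Longrightarrow> real (card (color_class V c j)) \<ge> card V / p - \<alpha> / 32 * card V"
    and large: "1 + 18 * p * C / \<alpha> + 3 / 2 * k \<le> \<alpha> / 32 * card V"
    and nb: "\<And>j. j < p \<Longrightarrow> real (card (nbh E x \<inter> color_class V c j)) \<ge> \<alpha> * card V"
  shows "\<exists>E'\<subseteq>nsets (V - {x}) 2. real (phi E) \<le> real (phi E') + turan_step p (card V) - \<alpha> / 8 * card V"
proof -
  let ?n = "card V" and ?M = "missing_edges V c E" and ?K = "color_class V c" and ?N = "nbh E x"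
  have n1: "?n \<ge> 1" using V x by (metis One_nat_def Suc_leI card_gt_0_iff empty_iff)
  have fM: "finite ?M" using finite_edges[OF V cross_pairs_subset] by auto
  have MV: "?M \<subseteq> nsets V 2" using cross_pairs_subset by blast
  \<comment> \<open>The denominator makes \<open>p * h\<close> at most
    \<open>\<alpha> / 6 * n\<close>, a sixth of the least possible value of \<open>a\<close>
    below.\<close>
  define \<eta> where "\<eta> = \<alpha> / (6 * p)"
  have \<eta>: "\<eta> > 0" using \<alpha> p2 by (simp add: \<eta>_def)
  define Z where "Z = {v \<in> V. \<eta> * ?n \<le> deg ?M v}"
  define h where "h = nat \<lfloor>\<eta> * ?n\<rfloor>"
  have h: "real h \<le> \<eta> * ?n" using \<eta> by (simp add: h_def)
  have dh: "deg ?M v \<le> h" if "v \<in> V" "v \<notin> Z" for v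
    using that unfolding Z_def h_def by (simp add: le_nat_floor)
  have fZ: "finite Z" using V by (simp add: Z_def)
  have Zb: "real (card Z) \<le> 2 * C / \<eta>"
  proof -
    have "\<eta> * ?n * card Z \<le> 2 * (C * ?n)"
      using card_high_degree[OF V MV, of "\<eta> * ?n"] M unfolding Z_def by linarith
    then have "?n * (\<eta> * card Z) \<le> ?n * (2 * C)" by (simp add: algebra_simps)
    then have "\<eta> * card Z \<le> 2 * C" using n1 by (simp add: mult_le_cancel_left)
    then show ?thesis using \<eta> by (simp add: field_simps)
  qed
  define a where "a = Min ((\<lambda>j. card (?N \<inter> ?K j)) ` {..<p})"
  have "a \<in> (\<lambda>j. card (?N \<inter> ?K j)) ` {..<p}"
    unfolding a_def using p2 by (intro Min_in) (auto simp: lessThan_empty_iff)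
  then obtain j0 where j0: "j0 < p" "card (?N \<inter> ?K j0) = a" by auto
  have amin: "a \<le> card (?N \<inter> ?K j)" if "j < p" for j
    unfolding a_def using that by (intro Min_le) auto
  have a\<alpha>: "real a \<ge> \<alpha> * ?n" using nb[OF j0(1)] j0(2) by simp
  have fN: "finite ?N" by (rule finite_nbh[OF V E])
  have NV: "?N \<subseteq> V" using nbh_subset[OF E, of x] by auto
  have fK: "finite (?K j)" for j using V color_class_subset by (rule rev_finite_subset)
  \<comment> \<open>Each class offers at least \<open>a\<close> neighbours of \<open>x\<close>.
    Without \<open>Z\<close> and one vertex per earlier clique, more than \<open>p * h\<close> of
    them remain while fewer than \<open>s\<close> cliques have been chosen; hence the limit of one
    vertex per class in \<open>?P\<close>.\<close>
  define s where "s = a - (card Z + p * h)"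
  let ?P = "\<lambda>q. card q = p \<and> q \<subseteq> ?N \<and> nsets q 2 \<subseteq> E \<and> (\<forall>j<p. card (q \<inter> ?K j) \<le> 1)"
  have "\<exists>Q. finite Q \<and> card Q = s \<and> disjoint Q \<and> (\<forall>q\<in>Q. ?P q)"
  proof (rule greedy_disjoint_family)
    fix q assume "?P q"
    then show "q \<noteq> {}" using p2 by auto
  next
    fix Q assume Q: "finite Q" "card Q < s" "disjoint Q" "\<forall>q\<in>Q. ?P q"
    define A where "A j = (?N \<inter> ?K j) - (Z \<union> (\<Union>q\<in>Q. q \<inter> ?K j))" for j
    have Abig: "p * h < card (A j)" if j: "j < p" for j
    proof -
      have "card (\<Union>q\<in>Q. q \<inter> ?K j) \<le> (\<Sum>q\<in>Q. card (q \<inter> ?K j))" by (rule card_UN_le[OF Q(1)])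
      also have "\<dots> \<le> (\<Sum>q\<in>Q. 1)" using Q(4) j by (intro sum_mono) blast
      finally have u: "card (\<Union>q\<in>Q. q \<inter> ?K j) \<le> card Q" by simp
      have "card (Z \<union> (\<Union>q\<in>Q. q \<inter> ?K j)) \<le> card Z + card Q"
        using card_Un_le[of Z "\<Union>q\<in>Q. q \<inter> ?K j"] u by linarith
      moreover have "card (?N \<inter> ?K j) - card (Z \<union> (\<Union>q\<in>Q. q \<inter> ?K j)) \<le> card (A j)"
        unfolding A_def using fZ Q(1) fK by (intro diff_card_le_card_Diff) auto
      ultimately show ?thesis using amin[OF j] Q(2) unfolding s_def by linarith
    qed
    have "\<exists>g. (\<forall>i\<in>{..<p}. g i \<in> A i) \<and> (\<forall>i\<in>{..<p}. \<forall>i'\<in>{..<p}. i \<noteq> i' \<longrightarrow> \<not> {g i, g i'} \<in> ?M)"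
    proof (rule greedy_transversal)
      fix i i' v assume i: "i \<in> {..<p}" "i' \<in> {..<p}" "v \<in> A i'"
      then have v: "v \<in> V" "v \<notin> Z" using NV by (auto simp: A_def)
      have "card {u \<in> A i. {u, v} \<in> ?M} \<le> card (nbh ?M v)"
        by (rule card_mono[OF finite_nbh[OF V MV]]) (auto simp: nbh_def)
      also have "\<dots> \<le> h" using card_nbh[OF MV, of v] dh[OF v] by simp
      finally show "card {u \<in> A i. {u, v} \<in> ?M} \<le> h" .
    next
      fix i assume "i \<in> {..<p}"
      then have "p * h < card (A i)" using Abig by simp
      moreover have "(p - 1) * h \<le> p * h" by (intro mult_le_mono1) simp
      ultimately show "(card {..<p} - 1) * h < card (A i)"
        unfolding card_lessThan by (rule le_less_trans[rotated])
    next
      fix i show "finite (A i)" unfolding A_def using fN by auto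
    qed (auto simp: insert_commute)
    then obtain g where g: "\<And>i. i < p \<Longrightarrow> g i \<in> A i"
      "\<And>i i'. i < p \<Longrightarrow> i' < p \<Longrightarrow> i \<noteq> i' \<Longrightarrow> {g i, g i'} \<notin> ?M" by auto
    have gc: "c (g i) = i" "g i \<in> V" "g i \<in> ?N" "g i \<notin> \<Union>Q" if "i < p" for i
      using g(1)[OF that] NV by (auto simp: A_def color_class_def)
    have inj: "inj_on g {..<p}" using gc by (metis inj_onI lessThan_iff)
    define q where "q = g ` {..<p}"
    have "card q = p" using inj by (simp add: q_def card_image)
    moreover have "q \<subseteq> ?N" using gc by (auto simp: q_def)
    moreover have "q \<inter> \<Union>Q = {}" using gc(4) by (auto simp: q_def)
    moreover have "nsets q 2 \<subseteq> E"
    proof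
      fix e assume "e \<in> nsets q 2"
      then obtain i i' where i: "i < p" "i' < p" "g i \<noteq> g i'" "e = {g i, g i'}"
        by (auto simp: nsets_2_eq q_def)
      then have "{g i, g i'} \<in> cross_pairs V c" using gc by auto
      then show "e \<in> E" using g(2)[of i i'] i by auto
    qed
    moreover have "card (q \<inter> ?K j) \<le> 1" if "j < p" for j
    proof -
      have "q \<inter> ?K j \<subseteq> {g j}" using gc by (auto simp: q_def color_class_def)
      then show ?thesis using card_mono[of "{g j}"] by fastforce
    qed
    ultimately show "\<exists>q. ?P q \<and> q \<inter> \<Union>Q = {}" by blast
  qed
  then obtain Q where Q: "finite Q" "card Q = s" "disjoint Q" "\<forall>q\<in>Q. ?P q" by blast
  have Q': "\<And>q. q \<in> Q \<Longrightarrow> card q = p \<and> q \<subseteq> nbh E x \<and> nsets q 2 \<subseteq> E" using Q(4) by blast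
  obtain E' where E': "E' \<subseteq> nsets (V - {x}) 2" "phi E + (s div k) * (k * p - 1) \<le> phi E' + deg E x"
    using star_removal[OF V E x Q(1,3) Q'] Q(2) by blast
  have "2 * phi E + 3 * s \<le> 2 * phi E' + 2 * deg E x + 3 * k"
    using E'(2) fan_gain[of s] by linarith
  then have e1: "2 * real (phi E) + 3 * real s \<le> 2 * real (phi E') + 2 * real (deg E x) + 3 * real k"
    by linarith
  have s: "real s \<ge> real a - real (card Z) - p * real h"
  proof -
    have "real s \<ge> real a - real (card Z + p * h)" unfolding s_def by linarith
    then show ?thesis by simp
  qed
  have d: "real (deg E x) \<le> real a + ?n - card (?K j0)"
  proof -
    have "?N \<subseteq> (?N \<inter> ?K j0) \<union> (V - ?K j0)" using NV by auto
    then have "card ?N \<le> card ((?N \<inter> ?K j0) \<union> (V - ?K j0))" using V fN by (intro card_mono) auto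
    also have "\<dots> \<le> a + card (V - ?K j0)" using card_Un_le[of "?N \<inter> ?K j0"] j0(2) by metis
    also have "card (V - ?K j0) = ?n - card (?K j0)"
      using fK color_class_subset by (intro card_Diff_subset)
    finally have "card ?N + card (?K j0) \<le> a + ?n"
      using card_mono[OF V color_class_subset[of V c j0]] by linarith
    then show ?thesis using card_nbh[OF E, of x] by linarith
  qed
  have ph: "p * real h \<le> \<alpha> / 6 * ?n"
  proof -
    have "p * real h \<le> p * (\<eta> * ?n)" using h by (intro mult_left_mono) auto
    also have "\<dots> = \<alpha> / 6 * ?n" using p2 by (simp add: \<eta>_def)
    finally show ?thesis .
  qed
  have z: "real (card Z) \<le> 12 * p * C / \<alpha>" using Zb by (simp add: \<eta>_def field_simps)
  have t: "real (turan_step p ?n) \<ge> ?n - ?n / p - 1" using n1 p2 by (intro turan_step_bounds) auto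
  \<comment> \<open>The cliques gain \<open>a / 2\<close>, at least \<open>\<alpha> * n / 2\<close>.
    Against this stand \<open>\<alpha> * n / 4\<close> from \<open>3 / 2 * p * h\<close> and
    \<open>\<alpha> * n / 32\<close> each from the class size and from the constants in
    \<open>large\<close>; what remains exceeds \<open>\<alpha> * n / 8\<close>.\<close>
  have "12 * p * C / \<alpha> * (3 / 2) = 18 * p * C / \<alpha>" by simp
  then have "real (phi E) \<le> real (phi E') + turan_step p ?n - \<alpha> / 8 * ?n"
    using e1 s d ph z t size[OF j0(1)] large a\<alpha> by (simp add: field_simps)
  then show ?thesis using E'(1) by blast
qed

end

section \<open>Recolouring exceptional vertices\<close>

context fan_setting
begin

text \<open>The surplus \<open>phi E - turan p (card V)\<close> grows by at least
  \<open>\<gamma> * card V\<close> when passing to \<open>E'\<close> on one vertex fewer. A bounded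
  surplus rules this out for large graphs whose own surplus is not negative.\<close>

definition removable :: "real \<Rightarrow> nat set \<Rightarrow> nat set set \<Rightarrow> bool" where
  "removable \<gamma> V E \<longleftrightarrow> (\<exists>x\<in>V. \<exists>E'\<subseteq>nsets (V - {x}) 2.
     real (phi E) \<le> real (phi E') + real (turan_step p (card V)) - \<gamma> * real (card V))"

definition balanced :: "real \<Rightarrow> real \<Rightarrow> nat set \<Rightarrow> nat set set \<Rightarrow> (nat \<Rightarrow> nat) \<Rightarrow> bool" where
  "balanced \<alpha> D V E c \<longleftrightarrow> c ` V \<subseteq> {..<p} \<and>
     real (card (inner_edges c E)) \<le> D * real (card V) \<and>
     real (card (missing_edges V c E)) \<le> D * real (card V) \<and>
     (\<forall>j<p. real (card (color_class V c j)) \<ge> real (card V) / real p - \<alpha> * real (card V)) \<and>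
     (\<forall>v\<in>V. real (deg (inner_edges c E) v) \<le> 2 * \<alpha> * real (card V) \<and>
            real (deg (missing_edges V c E) v) \<le> 5 * \<alpha> * real (card V))"

text \<open>When no vertex is removable, every vertex has fewer than \<open>\<alpha> * n\<close>
  neighbours in some class. Vertices of large inner degree are bounded in number, as there are only
  \<open>C * n\<close> inner edges, and each is moved to such a class. A large missing degree would
  then mean a degree well below the Turan degree.\<close>

lemma removable_or_balanced:
  fixes C \<alpha> :: real
  assumes C: "C \<ge> 0" and \<alpha>: "\<alpha> > 0"
  shows "\<exists>N. \<forall>V E c. finite V \<and> E \<subseteq> nsets V 2 \<and> c ` V \<subseteq> {..<p} \<and> N \<le> card V \<and>
     real (card (inner_edges c E)) \<le> C * card V \<and> real (card (missing_edges V c E)) \<le> C * card V \<and>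
     turan p (card V) \<le> card E \<longrightarrow>
     removable (\<alpha> / 8) V E \<or> (\<exists>c'. balanced \<alpha> (C + 2 * C / \<alpha>) V E c')"
proof -
  \<comment> \<open>In this order the summands give class sizes within
    \<open>\<alpha> / 32 * n\<close> of \<open>n / p\<close>, the condition \<open>large\<close> of
    \<open>crossing_vertex_removal\<close>, at most \<open>\<alpha> / 2 * n\<close> recoloured
    vertices, and \<open>1 \<le> \<alpha> * n\<close> to absorb rounding.\<close>
  define N where "N = nat \<lceil>1024 * (1 + 2 * C) / \<alpha>\<^sup>2 + 32 * (1 + 18 * p * C / \<alpha> + 3 / 2 * k) / \<alpha> + 4 * C / \<alpha>\<^sup>2 + 1 / \<alpha>\<rceil> + 1"
  have "\<exists>c'. balanced \<alpha> (C + 2 * C / \<alpha>) V E c'"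
    if V: "finite V" and E: "E \<subseteq> nsets V 2" and c: "c ` V \<subseteq> {..<p}" and N: "N \<le> card V"
      and B: "real (card (inner_edges c E)) \<le> C * card V"
      and M: "real (card (missing_edges V c E)) \<le> C * card V"
      and T: "turan p (card V) \<le> card E"
      and notrem: "\<not> removable (\<alpha> / 8) V E" for V E c
  proof -
    let ?n = "card V" and ?K = "color_class V c"
    have pos: "1024 * (1 + 2 * C) / \<alpha>\<^sup>2 \<ge> 0" "32 * (1 + 18 * p * C / \<alpha> + 3 / 2 * k) / \<alpha> \<ge> 0"
      "4 * C / \<alpha>\<^sup>2 \<ge> 0" "1 / \<alpha> \<ge> 0"
      using C \<alpha> by auto
    have "1024 * (1 + 2 * C) / \<alpha>\<^sup>2 + 32 * (1 + 18 * p * C / \<alpha> + 3 / 2 * k) / \<alpha> + 4 * C / \<alpha>\<^sup>2 + 1 / \<alpha> \<le> real ?n"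
      using N unfolding N_def by linarith
    then have "1024 * (1 + 2 * C) / \<alpha>\<^sup>2 \<le> real ?n" "32 * (1 + 18 * p * C / \<alpha> + 3 / 2 * k) / \<alpha> \<le> real ?n"
      "4 * C / \<alpha>\<^sup>2 \<le> real ?n" "1 / \<alpha> \<le> real ?n"
      using pos by linarith+
    then have n: "1024 * (1 + 2 * C) \<le> \<alpha>\<^sup>2 * ?n" "32 * (1 + 18 * p * C / \<alpha> + 3 / 2 * k) \<le> \<alpha> * ?n"
      "4 * C \<le> \<alpha>\<^sup>2 * ?n" "1 \<le> \<alpha> * ?n"
      using \<alpha> by (simp_all add: pos_divide_le_eq mult.commute)
    have n1: "?n \<ge> 1" using N by (simp add: N_def)
    have fE: "finite E" by (rule finite_edges[OF V E])
    have "real (turan p ?n) \<le> card (cross_pairs V c) + C * ?n"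
      using card_balance[OF V E, of c] B T by linarith
    then have dev: "(real (card (?K j)) - ?n / p) ^ 2 \<le> ?n + 2 * (C * ?n)" if "j < p" for j
      using color_class_deviation[OF V c _ _ that] p2 by auto
    have size: "real (card (?K j)) \<ge> ?n / p - \<alpha> / 32 * ?n" if "j < p" for j
    proof -
      have "(real (card (?K j)) - ?n / p) ^ 2 \<le> (1 + 2 * C) * ?n" using dev[OF that] by (simp add: algebra_simps)
      also have "\<dots> \<le> (\<alpha>\<^sup>2 * ?n / 1024) * ?n" using n(1) by (intro mult_right_mono) auto
      also have "\<dots> = (\<alpha> / 32 * ?n) ^ 2" by (simp add: power2_eq_square)
      finally have "\<bar>real (card (?K j)) - ?n / p\<bar> \<le> \<alpha> / 32 * ?n"
        using \<alpha> by (subst (asm) power2_le_iff_abs_le) auto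
      then show ?thesis by linarith
    qed
    have ex: "\<exists>j<p. real (card (nbh E x \<inter> ?K j)) < \<alpha> * ?n" if x: "x \<in> V" for x
    proof (rule ccontr)
      assume "\<not> ?thesis"
      then have "\<And>j. j < p \<Longrightarrow> real (card (nbh E x \<inter> ?K j)) \<ge> \<alpha> * ?n" by (meson not_less)
      then have "removable (\<alpha> / 8) V E"
        using crossing_vertex_removal[OF V E c x M C \<alpha> size] n(2) x unfolding removable_def by auto
      then show False using notrem by simp
    qed
    then obtain f where f: "\<And>x. x \<in> V \<Longrightarrow> f x < p" "\<And>x. x \<in> V \<Longrightarrow> real (card (nbh E x \<inter> ?K (f x))) < \<alpha> * ?n"
      by metis
    have degl: "real (deg E x) > turan_step p ?n - \<alpha> / 8 * ?n" if x: "x \<in> V" for x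
    proof (rule ccontr)
      assume "\<not> ?thesis"
      moreover obtain E' where "E' \<subseteq> nsets (V - {x}) 2" "phi E \<le> phi E' + deg E x"
        using star_removal[OF V E x, of "{}"] by auto
      ultimately have "removable (\<alpha> / 8) V E"
        unfolding removable_def using x by (intro bexI[of _ x] exI[of _ E']) auto
      then show False using notrem by simp
    qed
    define X where "X = {v \<in> V. \<alpha> * ?n \<le> deg (inner_edges c E) v}"
    define c' where "c' v = (if v \<in> X then f v else c v)" for v
    have fX: "finite X" and XV: "X \<subseteq> V" using V by (auto simp: X_def)
    have cX: "real (card X) \<le> 2 * C / \<alpha>"
    proof -
      have "\<alpha> * ?n * card X \<le> 2 * (C * ?n)"
        using card_high_degree[OF V, of "inner_edges c E" "\<alpha> * ?n"] E B unfolding X_def by force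
      then have "?n * (\<alpha> * card X) \<le> ?n * (2 * C)" by (simp add: algebra_simps)
      then have "\<alpha> * card X \<le> 2 * C" using n1 by (simp add: mult_le_cancel_left)
      then show ?thesis using \<alpha> by (simp add: field_simps)
    qed
    have cX': "real (card X) \<le> \<alpha> / 2 * ?n"
    proof -
      have "2 * C / \<alpha> \<le> \<alpha> / 2 * ?n" using n(3) \<alpha> by (simp add: field_simps power2_eq_square)
      then show ?thesis using cX by linarith
    qed
    have colc': "c' ` V \<subseteq> {..<p}" using c f(1) XV by (auto simp: c'_def)
    have cls: "color_class V c' j \<subseteq> ?K j \<union> X" "?K j \<subseteq> color_class V c' j \<union> X" for j
      by (auto simp: color_class_def c'_def)
    have fcl: "finite (color_class V d j)" for d :: "nat \<Rightarrow> nat" and j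
      using V color_class_subset by (rule rev_finite_subset)
    have size': "real (card (color_class V c' j)) \<ge> ?n / p - \<alpha> * ?n" if "j < p" for j
    proof -
      have "card (?K j) \<le> card (color_class V c' j \<union> X)" using cls fX fcl by (intro card_mono) auto
      also have "\<dots> \<le> card (color_class V c' j) + card X" by (rule card_Un_le)
      finally have "real (card (?K j)) \<le> real (card (color_class V c' j)) + real (card X)" by linarith
      moreover have "0 \<le> \<alpha> * ?n" using \<alpha> by simp
      ultimately show ?thesis using size[OF that] cX' by linarith
    qed
    have inn: "real (deg (inner_edges c' E) v) \<le> 2 * \<alpha> * ?n" if v: "v \<in> V" for v
    proof -
      have low: "real (card (nbh E v \<inter> ?K (c' v))) \<le> \<alpha> * ?n"
      proof (cases "v \<in> X")
        case True
        then show ?thesis using f(2)[OF v] by (simp add: c'_def)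
      next
        case False
        then show ?thesis using v deg_inner_edges[OF E, of c v] by (simp add: c'_def X_def)
      qed
      have "card (nbh E v \<inter> color_class V c' (c' v)) \<le> card ((nbh E v \<inter> ?K (c' v)) \<union> X)"
        using cls finite_nbh[OF V E] fX by (intro card_mono) auto
      also have "\<dots> \<le> card (nbh E v \<inter> ?K (c' v)) + card X" by (rule card_Un_le)
      finally show ?thesis using low cX' deg_inner_edges[OF E, of c' v] \<alpha> by linarith
    qed
    have mis: "real (deg (missing_edges V c' E) v) \<le> 5 * \<alpha> * ?n" if v: "v \<in> V" for v
    proof -
      have "c' v < p" using colc' v by auto
      then have "real (card (color_class V c' (c' v))) \<ge> ?n / p - \<alpha> * ?n" by (rule size')
      moreover have "real (turan_step p ?n) \<ge> ?n - ?n / p - 1"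
        using n1 p2 by (intro turan_step_bounds) auto
      \<comment> \<open>The terms add up to
        \<open>(2 + 1 + 1 / 8) * \<alpha> * n + 1\<close>.\<close>
      ultimately show ?thesis
        using deg_balance[OF V E v, of c'] inn[OF v] degl[OF v] n(4) by linarith
    qed
    \<comment> \<open>Only edges meeting \<open>X\<close> can change their status; they account for
      the summand \<open>2 * C / \<alpha>\<close> of the new constant.\<close>
    have meet: "real (card {e \<in> nsets V 2. e \<inter> X \<noteq> {}}) \<le> 2 * C / \<alpha> * ?n"
    proof -
      have "real (card {e \<in> nsets V 2. e \<inter> X \<noteq> {}}) \<le> real (card X) * ?n"
        using card_edges_meeting[OF V XV] by (metis of_nat_le_iff of_nat_mult)
      also have "\<dots> \<le> 2 * C / \<alpha> * ?n" using cX by (rule mult_right_mono) auto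
      finally show ?thesis .
    qed
    have same: "mono_edge c' e = mono_edge c e" if "e \<inter> X = {}" for e
      using that by (auto simp: mono_edge_def c'_def)
    have fV2: "finite (nsets V 2)" by (rule finite_imp_finite_nsets[OF V])
    have "card (inner_edges c' E) \<le> card (inner_edges c E \<union> {e \<in> nsets V 2. e \<inter> X \<noteq> {}})"
      using fE fV2 E same by (intro card_mono) auto
    also have "\<dots> \<le> card (inner_edges c E) + card {e \<in> nsets V 2. e \<inter> X \<noteq> {}}" by (rule card_Un_le)
    finally have B': "real (card (inner_edges c' E)) \<le> (C + 2 * C / \<alpha>) * ?n"
      using B meet by (simp add: algebra_simps)
    have "card (missing_edges V c' E) \<le> card (missing_edges V c E \<union> {e \<in> nsets V 2. e \<inter> X \<noteq> {}})"
      using fV2 same finite_edges[OF V cross_pairs_subset] by (intro card_mono) (auto simp: cross_pairs_def)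
    also have "\<dots> \<le> card (missing_edges V c E) + card {e \<in> nsets V 2. e \<inter> X \<noteq> {}}" by (rule card_Un_le)
    finally have M': "real (card (missing_edges V c' E)) \<le> (C + 2 * C / \<alpha>) * ?n"
      using M meet by (simp add: algebra_simps)
    have "balanced \<alpha> (C + 2 * C / \<alpha>) V E c'"
      unfolding balanced_def using colc' B' M' size' inn mis by auto
    then show "\<exists>c'. balanced \<alpha> (C + 2 * C / \<alpha>) V E c'" by blast
  qed
  then show ?thesis by blast
qed

end

section \<open>Packing fans in balanced graphs\<close>

text \<open>Each vertex already present rules out itself and at most \<open>h\<close> vertices
  joined to it by a missing edge, whence \<open>Suc h\<close>. Adjacency between different colours
  is then automatic. \<open>H\<close> collects the vertices to be avoided, such as heavy ones or
  those of earlier fans.\<close>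

lemma partite_extension:
  fixes c :: "'a \<Rightarrow> nat"
  assumes V: "finite V" and E: "E \<subseteq> nsets V 2" and I: "finite I" and U: "finite U" "U \<subseteq> V" and H: "finite H"
    and M: "\<And>v. v \<in> V \<Longrightarrow> deg (missing_edges V c E) v \<le> h"
    and big: "\<And>i. i \<in> I \<Longrightarrow> card H + (card U + card I) * Suc h < card (color_class V c (col i))"
  shows "\<exists>g. inj_on g I \<and> (\<forall>i\<in>I. g i \<in> V - H - U \<and> c (g i) = col i) \<and>
    (\<forall>i\<in>I. \<forall>u\<in>U. c u \<noteq> col i \<longrightarrow> {u, g i} \<in> E) \<and>
    (\<forall>i\<in>I. \<forall>i'\<in>I. col i \<noteq> col i' \<longrightarrow> {g i, g i'} \<in> E)"
proof -
  let ?M = "missing_edges V c E"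
  have MV: "?M \<subseteq> nsets V 2" using cross_pairs_subset by blast
  have fK: "finite (color_class V c j)" for j using V color_class_subset by (rule rev_finite_subset)
  have nM: "card (nbh ?M v) \<le> h" if "v \<in> V" for v using M[OF that] card_nbh[OF MV, of v] by simp
  have fnM: "finite (nbh ?M v)" for v by (rule finite_nbh[OF V MV])
  define A where "A i = color_class V c (col i) - (H \<union> U \<union> (\<Union>u\<in>U. nbh ?M u))" for i
  have Abig: "card I * Suc h < card (A i)" if i: "i \<in> I" for i
  proof -
    have "card (\<Union>u\<in>U. nbh ?M u) \<le> (\<Sum>u\<in>U. card (nbh ?M u))" by (rule card_UN_le[OF U(1)])
    also have "\<dots> \<le> (\<Sum>u\<in>U. h)" using nM U by (intro sum_mono) auto
    finally have "card (\<Union>u\<in>U. nbh ?M u) \<le> card U * h" by simp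
    then have "card (H \<union> U \<union> (\<Union>u\<in>U. nbh ?M u)) \<le> card H + card U + card U * h"
      using card_Un_le[of "H \<union> U" "\<Union>u\<in>U. nbh ?M u"] card_Un_le[of H U] by linarith
    moreover have "card (color_class V c (col i)) - card (H \<union> U \<union> (\<Union>u\<in>U. nbh ?M u)) \<le> card (A i)"
      unfolding A_def using H U fnM by (intro diff_card_le_card_Diff) auto
    ultimately show ?thesis using big[OF i] by (simp add: algebra_simps)
  qed
  have "\<exists>g. (\<forall>i\<in>I. g i \<in> A i) \<and> (\<forall>i\<in>I. \<forall>i'\<in>I. i \<noteq> i' \<longrightarrow> \<not> (g i = g i' \<or> {g i, g i'} \<in> ?M))"
  proof (rule greedy_transversal[OF I])
    fix i i' v assume i: "i \<in> I" "i' \<in> I" "v \<in> A i'"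
    then have v: "v \<in> V" by (auto simp: A_def color_class_def)
    have "card {u \<in> A i. u = v \<or> {u, v} \<in> ?M} \<le> card (insert v (nbh ?M v))"
      using fnM by (intro card_mono) (auto simp: nbh_def)
    also have "\<dots> \<le> Suc h" using nM[OF v] card_insert_le_m1[of "Suc h" "nbh ?M v" v] by simp
    finally show "card {u \<in> A i. u = v \<or> {u, v} \<in> ?M} \<le> Suc h" .
  next
    fix i assume "i \<in> I"
    then have "card I * Suc h < card (A i)" by (rule Abig)
    moreover have "(card I - 1) * Suc h \<le> card I * Suc h" by (intro mult_le_mono1) simp
    ultimately show "(card I - 1) * Suc h < card (A i)" by (rule le_less_trans[rotated])
  next
    fix i show "finite (A i)" unfolding A_def using fK by auto
  qed (auto simp: insert_commute)
  then obtain g where g: "\<And>i. i \<in> I \<Longrightarrow> g i \<in> A i"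
    "\<And>i i'. i \<in> I \<Longrightarrow> i' \<in> I \<Longrightarrow> i \<noteq> i' \<Longrightarrow> g i \<noteq> g i' \<and> {g i, g i'} \<notin> ?M" by blast
  have gc: "g i \<in> V - H - U" "c (g i) = col i" if "i \<in> I" for i
    using g(1)[OF that] by (auto simp: A_def color_class_def)
  have "inj_on g I" using g(2) by (meson inj_onI)
  moreover have "{u, g i} \<in> E" if "i \<in> I" "u \<in> U" "c u \<noteq> col i" for i u
  proof -
    have "{g i, u} \<notin> ?M" using g(1)[OF that(1)] that(2) by (auto simp: A_def nbh_def)
    moreover have "{g i, u} \<in> cross_pairs V c" using gc[OF that(1)] that U by auto
    ultimately show ?thesis by (simp add: insert_commute)
  qed
  moreover have "{g i, g i'} \<in> E" if "i \<in> I" "i' \<in> I" "col i \<noteq> col i'" for i i'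
  proof -
    have "{g i, g i'} \<in> cross_pairs V c" using gc[OF that(1)] gc[OF that(2)] that by auto
    then show ?thesis using g(2)[of i i'] that by auto
  qed
  ultimately show ?thesis using gc by (intro exI[of _ g]) blast
qed

context fan_setting
begin

text \<open>\<open>J i\<close> holds the colours of the vertices that the partial petal \<open>s i\<close> still lacks.\<close>

lemma complete_petals:
  fixes c :: "'a \<Rightarrow> nat"
  assumes V: "finite V" and E: "E \<subseteq> nsets V 2" and H: "finite H"
    and M: "\<And>v. v \<in> V \<Longrightarrow> deg (missing_edges V c E) v \<le> h"
    and big: "\<And>j. j < p \<Longrightarrow> card H + (2 * k * p + 1) * Suc h < card (color_class V c j)"
    and x: "x \<in> V"
    and s: "\<And>i. i < k \<Longrightarrow> s i \<subseteq> V - {x}" "\<And>i i'. i < k \<Longrightarrow> i' < k \<Longrightarrow> i \<noteq> i' \<Longrightarrow> s i \<inter> s i' = {}"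
    and J: "\<And>i. i < k \<Longrightarrow> J i \<subseteq> {..<p}" "\<And>i. i < k \<Longrightarrow> J i \<inter> c ` insert x (s i) = {}"
    and sJ: "\<And>i. i < k \<Longrightarrow> card (s i) + card (J i) = p"
  shows "\<exists>Q T. petals k p x Q \<and> T \<subseteq> V - H - insert x (\<Union>i<k. s i) \<and>
    \<Union>Q = (\<Union>i<k. s i) \<union> T \<and> card T = (\<Sum>i<k. card (J i)) \<and>
    (\<forall>e\<in>fan_edges x Q. (\<exists>i<k. e \<in> nsets (insert x (s i)) 2) \<or> e \<inter> T \<noteq> {} \<and> e \<in> E \<and> e \<in> cross_pairs V c) \<and>
    (\<forall>i<k. nsets (insert x (s i)) 2 \<subseteq> fan_edges x Q)"
proof -
  define U where "U = insert x (\<Union>i<k. s i)"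
  define I where "I = Sigma {..<k} J"
  have fs: "finite (s i)" if "i < k" for i
    using s(1)[OF that] V by (auto intro: finite_subset)
  have fJ: "finite (J i)" if "i < k" for i using J(1)[OF that] by (auto intro: finite_subset)
  have fI: "finite I" unfolding I_def using fJ by auto
  have UV: "U \<subseteq> V" "finite U" using s(1) x fs by (auto simp: U_def)
  have "card (\<Union>i<k. s i) \<le> (\<Sum>i<k. card (s i))" by (rule card_UN_le) simp
  also have "\<dots> \<le> (\<Sum>i<k. p)" using sJ by (intro sum_mono) (metis le_add1 lessThan_iff)
  finally have "card U \<le> k * p + 1"
    unfolding U_def using card_insert_le_m1[of "k * p + 1" "\<Union>i<k. s i" x] by simp
  moreover have cI: "card I = (\<Sum>i<k. card (J i))" unfolding I_def using fJ by (subst card_SigmaI) auto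
  moreover have "(\<Sum>i<k. card (J i)) \<le> (\<Sum>i<k. p)" using sJ by (intro sum_mono) (metis le_add2 lessThan_iff)
  ultimately have "card U + card I \<le> 2 * k * p + 1" by simp
  \<comment> \<open>At most \<open>k * p + 1\<close> given and \<open>k * p\<close> new vertices:
    the origin of the factor \<open>2 * k * p + 1\<close> in \<open>big\<close>.\<close>
  then have "(card U + card I) * Suc h \<le> (2 * k * p + 1) * Suc h" by (rule mult_le_mono1)
  then have big': "card H + (card U + card I) * Suc h < card (color_class V c (snd i))" if "i \<in> I" for i
    using big[of "snd i"] that J(1) by (fastforce simp: I_def)
  obtain g where g: "inj_on g I" "\<And>i. i \<in> I \<Longrightarrow> g i \<in> V - H - U \<and> c (g i) = snd i"
    "\<And>i u. i \<in> I \<Longrightarrow> u \<in> U \<Longrightarrow> c u \<noteq> snd i \<Longrightarrow> {u, g i} \<in> E"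
    "\<And>i i'. i \<in> I \<Longrightarrow> i' \<in> I \<Longrightarrow> snd i \<noteq> snd i' \<Longrightarrow> {g i, g i'} \<in> E"
    using partite_extension[where col = snd, OF V E fI UV(2,1) H M big'] by blast
  define t where "t i = (\<lambda>j. g (i, j)) ` J i" for i
  define T where "T = (\<Union>i<k. t i)"
  define Q where "Q = (\<lambda>i. s i \<union> t i) ` {..<k}"
  have II: "(i, j) \<in> I" if "i < k" "j \<in> J i" for i j using that by (simp add: I_def)
  have tV: "t i \<subseteq> V - H - U" if "i < k" for i
    using g(2)[OF II[OF that]] by (auto simp: t_def)
  have ct: "card (t i) = card (J i)" if "i < k" for i
    unfolding t_def using g(1) II[OF that] by (intro card_image) (auto simp: inj_on_def)
  have tt: "t i \<inter> t i' = {}" if "i < k" "i' < k" "i \<noteq> i'" for i i'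
    using g(1) II that by (auto simp: t_def inj_on_def)
  have TI: "T = g ` I" by (force simp: T_def t_def I_def)
  have cT: "card T = (\<Sum>i<k. card (J i))" using TI g(1) cI by (simp add: card_image)
  have sU: "s i \<subseteq> U" "x \<in> U" if "i < k" for i using that by (auto simp: U_def)
  have st: "s i \<inter> t i' = {}" "x \<notin> t i'" if "i < k" "i' < k" for i i'
    using tV[OF that(2)] sU[OF that(1)] by auto
  have cq: "card (s i \<union> t i) = p" if "i < k" for i
    using st[OF that that] fs[OF that] fJ[OF that] ct[OF that] sJ[OF that]
    by (subst card_Un_disjoint) (auto simp: t_def)
  have disj: "(s i \<union> t i) \<inter> (s i' \<union> t i') = {}" if "i < k" "i' < k" "i \<noteq> i'" for i i'
    using s(2)[OF that] tt[OF that] st[OF that(1,2)] st[OF that(2,1)] by blast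
  have inj: "inj_on (\<lambda>i. s i \<union> t i) {..<k}"
  proof (rule inj_onI)
    fix i i' assume i: "i \<in> {..<k}" "i' \<in> {..<k}" "s i \<union> t i = s i' \<union> t i'"
    show "i = i'"
    proof (rule ccontr)
      assume "i \<noteq> i'"
      then have "s i \<union> t i = {}" using disj[of i i'] i by auto
      then show False using cq[of i] i p2 by auto
    qed
  qed
  have pet: "petals k p x Q"
    unfolding petals_def
  proof (intro conjI ballI)
    show "finite Q" "card Q = k" using inj by (auto simp: Q_def card_image)
    show "disjoint Q" unfolding disjoint_def Q_def using disj by blast
    fix q assume "q \<in> Q"
    then obtain i where i: "i < k" "q = s i \<union> t i" by (auto simp: Q_def)
    show "card q = p" using cq i by simp
    then show "finite q" using p2 by (intro card_ge_0_finite) simp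
    show "x \<notin> q" using st(2)[OF i(1) i(1)] s(1)[OF i(1)] i by auto
  qed
  have fe: "(\<exists>i<k. e \<in> nsets (insert x (s i)) 2) \<or> e \<inter> T \<noteq> {} \<and> e \<in> E \<and> e \<in> cross_pairs V c"
    if e: "e \<in> fan_edges x Q" for e
  proof -
    obtain i where i: "i < k" "e \<in> nsets (insert x (s i \<union> t i)) 2"
      using e by (auto simp: fan_edges_def Q_def)
    then obtain u v where uv: "e = {u, v}" "u \<noteq> v" "u \<in> insert x (s i) \<union> t i" "v \<in> insert x (s i) \<union> t i"
      by (auto simp: nsets_2_eq)
    \<comment> \<open>The other end of an edge at a new vertex has a different colour, since the
      colours in \<open>J i\<close> are distinct and avoid those of \<open>insert x (s i)\<close>.
      So the completion creates no inner edges.\<close>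
    have key: "e \<inter> T \<noteq> {} \<and> e \<in> E \<and> e \<in> cross_pairs V c" if w: "w \<in> t i" "e = {y, w}" "y \<noteq> w" "y \<in> insert x (s i) \<union> t i" for y w
    proof -
      obtain j where j: "j \<in> J i" "w = g (i, j)" using w by (auto simp: t_def)
      have w': "c w = j" "w \<in> V" using g(2)[OF II[OF i(1) j(1)]] j by auto
      have "{y, w} \<in> E \<and> c y \<noteq> c w"
      proof (cases "y \<in> t i")
        case True
        then obtain j' where j': "j' \<in> J i" "y = g (i, j')" by (auto simp: t_def)
        have "j' \<noteq> j" using j j' w by auto
        then show ?thesis using g(4)[OF II[OF i(1) j'(1)] II[OF i(1) j(1)]] g(2)[OF II[OF i(1) j'(1)]] j j' w' by auto
      next
        case False
        then have y: "y \<in> insert x (s i)" using w by auto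
        then have "c y \<noteq> j" using J(2)[OF i(1)] j(1) by auto
        then show ?thesis using g(3)[OF II[OF i(1) j(1)], of y] y sU[OF i(1)] j w' by auto
      qed
      moreover have "y \<in> V" using w(4) tV[OF i(1)] sU[OF i(1)] UV by auto
      ultimately show ?thesis using w w' i by (auto simp: T_def)
    qed
    consider "u \<in> insert x (s i)" "v \<in> insert x (s i)" | "u \<in> t i" | "v \<in> t i" using uv by auto
    then show ?thesis
    proof cases
      case 1
      then have "e \<in> nsets (insert x (s i)) 2" using uv by auto
      then show ?thesis using i by blast
    next
      case 2
      then show ?thesis using key[of u v] uv by (auto simp: insert_commute)
    next
      case 3
      then show ?thesis using key[of v u] uv by auto
    qed
  qed
  have "nsets (insert x (s i)) 2 \<subseteq> fan_edges x Q" if "i < k" for i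
    using that nsets_mono[of "insert x (s i)" "insert x (s i \<union> t i)" 2] by (force simp: fan_edges_def Q_def)
  moreover have "T \<subseteq> V - H - insert x (\<Union>i<k. s i)" using tV by (fastforce simp: T_def U_def)
  moreover have "\<Union>Q = (\<Union>i<k. s i) \<union> T" by (auto simp: Q_def T_def)
  ultimately show ?thesis using pet fe cT by (intro exI[of _ Q] exI[of _ T]) blast
qed

end

text \<open>The at most \<open>2 * s\<close> ends of a maximal matching with fewer than
  \<open>s\<close> edges meet every edge of \<open>B\<close>; with all degrees below
  \<open>k\<close> this allows at most \<open>2 * s * k\<close> edges.\<close>

lemma star_or_matching:
  assumes V: "finite V" and B: "B \<subseteq> nsets V 2" and big: "2 * s * k < card B"
  shows "(\<exists>x\<in>V. k \<le> deg B x) \<or> (\<exists>F\<subseteq>B. finite F \<and> card F = s \<and> disjoint F)"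
proof (rule disjCI)
  assume "\<not> (\<exists>F\<subseteq>B. finite F \<and> card F = s \<and> disjoint F)"
  then have nF: "\<not> (\<exists>F. finite F \<and> card F = s \<and> disjoint F \<and> (\<forall>e\<in>F. e \<in> B))" by blast
  show "\<exists>x\<in>V. k \<le> deg B x"
  proof (rule ccontr)
    assume con: "\<not> ?thesis"
    have fB: "finite B" by (rule finite_edges[OF V B])
    have "\<exists>F. finite F \<and> card F = s \<and> disjoint F \<and> (\<forall>e\<in>F. e \<in> B)"
    proof (rule greedy_disjoint_family)
      fix e assume "e \<in> B"
      then show "e \<noteq> {}" using B by (auto simp: nsets_def)
    next
      fix F assume F: "finite F" "card F < s" "disjoint F" "\<forall>e\<in>F. e \<in> B"
      show "\<exists>e. e \<in> B \<and> e \<inter> \<Union>F = {}"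
      proof (rule ccontr)
        assume "\<not> ?thesis"
        then have sub: "B \<subseteq> (\<Union>v\<in>\<Union>F. {e \<in> B. v \<in> e})" by blast
        have FV: "\<And>e. e \<in> F \<Longrightarrow> e \<subseteq> V \<and> card e = 2" using F(4) B by (auto simp: nsets_def)
        have fU: "finite (\<Union>F)" using FV V by (auto intro: finite_subset)
        have "card (\<Union>F) \<le> (\<Sum>e\<in>F. card e)" by (rule card_Union_le_sum_card)
        also have "\<dots> = 2 * card F" using FV by simp
        finally have U: "card (\<Union>F) \<le> 2 * s" using F(2) by simp
        have "card B \<le> card (\<Union>v\<in>\<Union>F. {e \<in> B. v \<in> e})"
          using fB by (intro card_mono[OF _ sub] finite_UN_I fU) auto
        also have "\<dots> \<le> (\<Sum>v\<in>\<Union>F. card {e \<in> B. v \<in> e})" by (rule card_UN_le[OF fU])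
        also have "\<dots> \<le> (\<Sum>v\<in>\<Union>F. k)"
        proof (rule sum_mono)
          fix v assume "v \<in> \<Union>F"
          then have "v \<in> V" using FV by auto
          then show "card {e \<in> B. v \<in> e} \<le> k" using con unfolding deg_def by (meson le_cases)
        qed
        also have "\<dots> \<le> 2 * s * k" using U by simp
        finally show False using big by simp
      qed
    qed
    then show False using nF by blast
  qed
qed

lemma color_pigeonhole:
  fixes col :: "'a \<Rightarrow> nat"
  assumes "finite F" "col ` F \<subseteq> {..<p}" "card F = p * k" "p \<ge> 1"
  shows "\<exists>j<p. k \<le> card {e \<in> F. col e = j}"
proof (rule ccontr)
  assume con: "\<not> ?thesis"
  then have k: "k \<ge> 1" using assms(4) by (cases k) auto
  have "card F = (\<Sum>j<p. card (color_class F col j))"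
    by (rule card_eq_sum_color_classes[OF assms(1,2)])
  also have "\<dots> \<le> (\<Sum>j<p. k - 1)"
    using con by (intro sum_mono) (fastforce simp: color_class_def)
  also have "\<dots> < p * k" using k assms(4) by simp
  finally show False using assms(3) by simp
qed

section \<open>Fans with the least possible number of inner edges\<close>

context fan_setting
begin

lemma deg_fan_edges_le:
  assumes "petals k p x Q"
  shows "deg (fan_edges x Q) v \<le> k * p"
proof -
  have sub: "fan_edges x Q \<subseteq> nsets (insert x (\<Union>Q)) 2"
    by (auto simp: fan_edges_def nsets_def)
  have f: "finite (insert x (\<Union>Q))" using assms by (auto simp: petals_def)
  show ?thesis
  proof (cases "v \<in> insert x (\<Union>Q)")
    case True
    have "card (\<Union>Q) = k * p"
      using assms by (subst card_Union_disjoint) (auto simp: petals_def pairwise_def disjnt_def disjoint_def)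
    then have "card (insert x (\<Union>Q)) \<le> k * p + 1" using card_insert_le_m1[of "k * p + 1" "\<Union>Q" x] by simp
    moreover have "card (nbh (fan_edges x Q) v) \<le> card (insert x (\<Union>Q) - {v})"
      using nbh_subset[OF sub, of v] f by (intro card_mono) auto
    ultimately show ?thesis using True f card_nbh[OF sub, of v] by simp
  next
    case False
    then have "{e \<in> fan_edges x Q. v \<in> e} = {}" using sub by (auto simp: nsets_def)
    then have "deg (fan_edges x Q) v = 0" unfolding deg_def by (simp only: card.empty)
    then show ?thesis by simp
  qed
qed

text \<open>More inner edges than this contain a star with \<open>k\<close> edges or a matching with \<open>p * k\<close> edges, of
  which \<open>k\<close> lie in one class.\<close>

definition excess :: nat where "excess = 2 * (p * k) * k"

text \<open>A star of \<open>k\<close> inner edges supplies the centre and one leaf per petal; a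
  matching of \<open>k\<close> inner edges in one class supplies one edge per petal, with the centre
  taken from another class. All further vertices bring new colours to their cliques, so no other
  inner edges arise. By the last conclusion a vertex of \<open>H\<close> in the fan always loses an
  inner edge when the fan is removed.\<close>

lemma exists_light_fan:
  assumes V: "finite V" and E: "E \<subseteq> nsets V 2" and H: "finite H" and c: "c ` V \<subseteq> {..<p}"
    and M: "\<And>v. v \<in> V \<Longrightarrow> deg (missing_edges V c E) v \<le> h"
    and big: "\<And>j. j < p \<Longrightarrow> card H + (2 * k * p + 1) * Suc h < card (color_class V c j)"
    and B: "excess < card (inner_edges c E)"
  shows "\<exists>x Q. petals k p x Q \<and> fan_edges x Q \<subseteq> E \<and> card (inner_edges c (fan_edges x Q)) = k \<and>
    insert x (\<Union>Q) \<inter> H \<subseteq> \<Union>(inner_edges c (fan_edges x Q))"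
proof -
  let ?B = "inner_edges c E"
  have BV: "?B \<subseteq> nsets V 2" using E by auto
  have fin: "inner_edges c (fan_edges x Q) = S \<and> fan_edges x Q \<subseteq> E \<and> insert x (\<Union>Q) \<inter> H \<subseteq> insert x (\<Union>i<k. s i)"
    if Q: "\<forall>e\<in>fan_edges x Q. (\<exists>i<k. e \<in> nsets (insert x (s i)) 2) \<or> e \<inter> T \<noteq> {} \<and> e \<in> E \<and> e \<in> cross_pairs V c"
      "\<forall>i<k. nsets (insert x (s i)) 2 \<subseteq> fan_edges x Q" "\<Union>Q = (\<Union>i<k. s i) \<union> T" "T \<inter> H = {}"
      "\<And>i. i < k \<Longrightarrow> nsets (insert x (s i)) 2 \<subseteq> E"
      "S = (\<Union>i<k. inner_edges c (nsets (insert x (s i)) 2))"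
    for x Q s T S
  proof (intro conjI)
    show "inner_edges c (fan_edges x Q) = S"
      using Q(1,2) unfolding Q(6) by (auto simp: cross_pairs_def)
    show "fan_edges x Q \<subseteq> E" using Q(1,5) by blast
    show "insert x (\<Union>Q) \<inter> H \<subseteq> insert x (\<Union>i<k. s i)" using Q(3,4) by blast
  qed
  have "2 * (p * k) * k < card ?B" using B by (simp add: excess_def)
  then consider (star) x where "x \<in> V" "k \<le> deg ?B x"
    | (matching) F where "F \<subseteq> ?B" "finite F" "card F = p * k" "disjoint F"
    using star_or_matching[OF V BV, of "p * k" k] by blast
  then show ?thesis
  proof cases
    case star
    then have "k \<le> card (nbh ?B x)" using card_nbh[OF BV, of x] by simp
    then obtain Y where Y: "Y \<subseteq> nbh ?B x" "card Y = k" "finite Y" by (rule obtain_subset_with_card_n)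
    then obtain y where y: "bij_betw y {..<k} Y"
      using ex_bij_betw_nat_finite[of Y] by (auto simp: atLeast0LessThan)
    have yY: "y i \<in> Y" if "i < k" for i using y that by (auto simp: bij_betw_def)
    have yB: "{y i, x} \<in> ?B" if "i < k" for i using yY[OF that] Y(1) by (auto simp: nbh_def)
    have yE: "{y i, x} \<in> E" "c (y i) = c x" "y i \<in> V" "y i \<noteq> x" if "i < k" for i
    proof -
      show "{y i, x} \<in> E" "c (y i) = c x" using yB[OF that] by auto
      then have "{y i, x} \<in> nsets V 2" using E by blast
      then show "y i \<in> V" "y i \<noteq> x" by simp_all
    qed
    have yinj: "y i \<noteq> y i'" if "i < k" "i' < k" "i \<noteq> i'" for i i'
      using y that by (auto simp: bij_betw_def inj_on_def)
    have cx: "c x < p" using c star by auto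
    define s where "s i = {y i}" for i
    have s1: "\<And>i. i < k \<Longrightarrow> s i \<subseteq> V - {x}" "\<And>i i'. i < k \<Longrightarrow> i' < k \<Longrightarrow> i \<noteq> i' \<Longrightarrow> s i \<inter> s i' = {}"
      using yE yinj by (auto simp: s_def)
    \<comment> \<open>The leaf shares the colour of the centre, so the petal lacks exactly the other
      \<open>p - 1\<close> colours.\<close>
    define J where "J i = {..<p} - {c x}" for i :: nat
    have J1: "\<And>i. i < k \<Longrightarrow> J i \<subseteq> {..<p}" "\<And>i. i < k \<Longrightarrow> J i \<inter> c ` insert x (s i) = {}"
      using yE by (auto simp: s_def J_def)
    have sJ: "\<And>i. i < k \<Longrightarrow> card (s i) + card (J i) = p"
      using cx p2 by (simp add: s_def J_def)
    obtain Q T where Q: "petals k p x Q" "T \<subseteq> V - H - insert x (\<Union>i<k. s i)"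
      "\<Union>Q = (\<Union>i<k. s i) \<union> T"
      "\<forall>e\<in>fan_edges x Q. (\<exists>i<k. e \<in> nsets (insert x (s i)) 2) \<or> e \<inter> T \<noteq> {} \<and> e \<in> E \<and> e \<in> cross_pairs V c"
      "\<forall>i<k. nsets (insert x (s i)) 2 \<subseteq> fan_edges x Q"
      using complete_petals[where s = s and J = J, OF V E H M big star(1) s1 J1 sJ] by blast
    have ns: "nsets (insert x (s i)) 2 = {{y i, x}}" if "i < k" for i
      using yE[OF that] by (auto simp: s_def insert_commute)
    define S where "S = (\<lambda>i. {y i, x}) ` {..<k}"
    have mem: "inner_edges c (nsets (insert x (s i)) 2) = {{y i, x}}" if "i < k" for i
      using ns[OF that] yE[OF that] by auto
    have SS: "S = (\<Union>i<k. inner_edges c (nsets (insert x (s i)) 2))"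
      using mem by (auto simp: S_def)
    have TH: "T \<inter> H = {}" using Q(2) by auto
    have nE: "\<And>i. i < k \<Longrightarrow> nsets (insert x (s i)) 2 \<subseteq> E" using ns yE by simp
    have f: "inner_edges c (fan_edges x Q) = S" "fan_edges x Q \<subseteq> E"
      "insert x (\<Union>Q) \<inter> H \<subseteq> insert x (\<Union>i<k. s i)"
      using fin[OF Q(4,5,3) TH nE SS] by simp_all
    have "inj_on (\<lambda>i. {y i, x}) {..<k}" using yinj by (auto simp: inj_on_def doubleton_eq_iff)
    then have "card S = k" by (simp add: S_def card_image)
    moreover have "insert x (\<Union>i<k. s i) \<subseteq> \<Union>S"
    proof -
      have "{y 0, x} \<in> S" unfolding S_def using k2 by (intro image_eqI[of _ _ 0]) auto
      then show ?thesis by (auto simp: S_def s_def)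
    qed
    ultimately have "insert x (\<Union>Q) \<inter> H \<subseteq> \<Union>(inner_edges c (fan_edges x Q))"
      "card (inner_edges c (fan_edges x Q)) = k"
      unfolding f(1) using order_trans[OF f(3)] by simp_all
    then show ?thesis using Q(1) f(2) by blast
  next
    case matching
    define col where "col e = c (SOME v. v \<in> e)" for e
    have FE: "\<exists>a b. e = {a, b} \<and> a \<noteq> b \<and> a \<in> V \<and> b \<in> V \<and> c a = col e \<and> c b = col e \<and> e \<in> E" if "e \<in> F" for e
    proof -
      have e: "e \<in> E" "mono_edge c e" using that matching(1) by blast+
      then have "e \<in> nsets V 2" using E by auto
      then obtain a b where ab: "e = {a, b}" "a \<noteq> b" "a \<in> V" "b \<in> V" by (auto simp: nsets_2_eq)
      have m: "a \<in> e" "b \<in> e" using ab by auto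
      define w where "w = (SOME v. v \<in> e)"
      have "w \<in> e" unfolding w_def using m(1) by (rule someI)
      then have "c a = c w" "c b = c w" using e(2) m unfolding mono_edge_def by blast+
      then have "c a = col e" "c b = col e" by (simp_all add: col_def w_def)
      then show ?thesis using ab e by blast
    qed
    have "col ` F \<subseteq> {..<p}"
    proof
      fix j assume "j \<in> col ` F"
      then obtain e where "e \<in> F" "j = col e" by blast
      then obtain a where "a \<in> V" "c a = j" using FE by metis
      then show "j \<in> {..<p}" using c by blast
    qed
    then obtain j0 where j0: "j0 < p" "k \<le> card {e \<in> F. col e = j0}"
      using color_pigeonhole[of F col p k] matching p2 by auto
    obtain G where G: "G \<subseteq> {e \<in> F. col e = j0}" "card G = k" "finite G"
      using j0(2) by (rule obtain_subset_with_card_n)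
    then obtain s where s: "bij_betw s {..<k} G"
      using ex_bij_betw_nat_finite[of G] by (auto simp: atLeast0LessThan)
    have sG: "s i \<in> F" "col (s i) = j0" if "i < k" for i using s that G by (auto simp: bij_betw_def)
    have sinj: "s i \<noteq> s i'" if "i < k" "i' < k" "i \<noteq> i'" for i i'
      using s that by (auto simp: bij_betw_def inj_on_def)
    have sV: "s i \<subseteq> V" "card (s i) = 2" "s i \<in> E" "\<And>v. v \<in> s i \<Longrightarrow> c v = j0" "nsets (s i) 2 = {s i}" if i: "i < k" for i
    proof -
      obtain a b where ab: "s i = {a, b}" "a \<noteq> b" "a \<in> V" "b \<in> V" "c a = col (s i)" "c b = col (s i)" "s i \<in> E"
        using FE[OF sG(1)[OF i]] by blast
      then show "s i \<subseteq> V" "card (s i) = 2" "s i \<in> E" by simp_all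
      show "c v = j0" if "v \<in> s i" for v
        using that ab(1,5,6) sG(2)[OF i] by (metis insertE singletonD)
      show "nsets (s i) 2 = {s i}" unfolding ab(1) using ab(2) by simp
    qed
    obtain j1 where j1: "j1 < p" "j1 \<noteq> j0"
    proof -
      have "\<exists>j1<p. j1 \<noteq> j0" by (rule exI[of _ "if j0 = 0 then 1 else 0"]) (use p2 in auto)
      then show ?thesis using that by blast
    qed
    define U where "U = (\<Union>i<k. s i)"
    have UV: "U \<subseteq> V" using sV by (auto simp: U_def)
    have fU: "finite U" using UV V by (rule finite_subset)
    have "card U \<le> (\<Sum>i<k. card (s i))" unfolding U_def by (rule card_UN_le) simp
    also have "\<dots> = k * 2" using sV by simp
    also have "\<dots> \<le> k * p" using p2 by (intro mult_le_mono2)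
    finally have cU: "card U \<le> k * p" .
    have big1: "\<And>i. i \<in> {()} \<Longrightarrow> card H + (card U + card {()}) * Suc h < card (color_class V c j1)"
    proof -
      have "k * p \<le> 2 * k * p" by simp
      then have "card U + card {()} \<le> 2 * k * p + 1" using cU by simp
      then have "(card U + card {()}) * Suc h \<le> (2 * k * p + 1) * Suc h" by (rule mult_le_mono1)
      then show "card H + (card U + card {()}) * Suc h < card (color_class V c j1)" using big[OF j1(1)] by linarith
    qed
    obtain g where g: "g () \<in> V - H - U" "c (g ()) = j1" "\<forall>u\<in>U. c u \<noteq> j1 \<longrightarrow> {u, g ()} \<in> E"
      using partite_extension[where col = "\<lambda>_. j1", OF V E _ fU UV H M big1] by auto
    define x where "x = g ()"
    have x: "x \<in> V" "x \<notin> H" "x \<notin> U" "c x = j1" using g by (auto simp: x_def)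
    have xs: "{v, x} \<in> E" if "i < k" "v \<in> s i" for i v
      using g(3) that sV(4)[OF that] j1 by (auto simp: x_def U_def)
    have s1: "\<And>i. i < k \<Longrightarrow> s i \<subseteq> V - {x}" using sV(1) x by (auto simp: U_def)
    have s2: "\<And>i i'. i < k \<Longrightarrow> i' < k \<Longrightarrow> i \<noteq> i' \<Longrightarrow> s i \<inter> s i' = {}"
      using matching(4) sG sinj by (auto simp: disjoint_def)
    \<comment> \<open>The edge \<open>s i\<close> uses colour \<open>j0\<close> twice and the centre
      has colour \<open>j1\<close>; the remaining \<open>p - 2\<close> colours complete the
      petal.\<close>
    define J where "J i = {..<p} - {j0, j1}" for i :: nat
    have J1: "\<And>i. i < k \<Longrightarrow> J i \<subseteq> {..<p}" "\<And>i. i < k \<Longrightarrow> J i \<inter> c ` insert x (s i) = {}"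
      using sV(4) x by (auto simp: J_def)
    have sJ: "\<And>i. i < k \<Longrightarrow> card (s i) + card (J i) = p"
      using j0 j1 p2 sV(2) by (simp add: card_Diff_subset J_def)
    obtain Q T where Q: "petals k p x Q" "T \<subseteq> V - H - insert x (\<Union>i<k. s i)"
      "\<Union>Q = (\<Union>i<k. s i) \<union> T"
      "\<forall>e\<in>fan_edges x Q. (\<exists>i<k. e \<in> nsets (insert x (s i)) 2) \<or> e \<inter> T \<noteq> {} \<and> e \<in> E \<and> e \<in> cross_pairs V c"
      "\<forall>i<k. nsets (insert x (s i)) 2 \<subseteq> fan_edges x Q"
      using complete_petals[where s = s and J = J, OF V E H M big x(1) s1 s2 J1 sJ] by blast
    have ns: "e = s i \<or> (\<exists>v\<in>s i. e = {v, x})" if i: "i < k" and e: "e \<in> nsets (insert x (s i)) 2" for i e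
    proof -
      obtain u v where uv: "e = {u, v}" "u \<noteq> v" "u \<in> insert x (s i)" "v \<in> insert x (s i)"
        using e by (auto simp: nsets_2_eq)
      consider "u = x" "v \<in> s i" | "v = x" "u \<in> s i" | "u \<in> s i" "v \<in> s i" using uv by auto
      then show ?thesis
      proof cases
        case 1 then show ?thesis using uv by (auto simp: insert_commute)
      next
        case 2 then show ?thesis using uv by auto
      next
        case 3 then have "e \<in> nsets (s i) 2" using uv by auto
        then show ?thesis using sV(5)[OF i] by simp
      qed
    qed
    have sm: "mono_edge c (s i)" "s i \<in> nsets (insert x (s i)) 2" if "i < k" for i
    proof -
      show "mono_edge c (s i)" using sV(4)[OF that] by (auto simp: mono_edge_def)
      show "s i \<in> nsets (insert x (s i)) 2"
        using sV(5)[OF that] nsets_mono[of "s i" "insert x (s i)" 2] by auto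
    qed
    have mem: "inner_edges c (nsets (insert x (s i)) 2) = {s i}" if "i < k" for i
      using ns[OF that] sm[OF that] sV(4)[OF that] x(4) j1(2) by fastforce
    have SS: "G = (\<Union>i<k. inner_edges c (nsets (insert x (s i)) 2))"
      using mem s by (auto simp: bij_betw_def)
    have TH: "T \<inter> H = {}" using Q(2) by auto
    have nE: "\<And>i. i < k \<Longrightarrow> nsets (insert x (s i)) 2 \<subseteq> E" using ns xs sV(3) by blast
    have f: "inner_edges c (fan_edges x Q) = G" "fan_edges x Q \<subseteq> E"
      "insert x (\<Union>Q) \<inter> H \<subseteq> insert x (\<Union>i<k. s i)"
      using fin[OF Q(4,5,3) TH nE SS] by simp_all
    have "\<Union>G = (\<Union>i<k. s i)" using s by (auto simp: bij_betw_def)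
    then have "insert x (\<Union>Q) \<inter> H \<subseteq> \<Union>(inner_edges c (fan_edges x Q))"
      "card (inner_edges c (fan_edges x Q)) = k"
      unfolding f(1) using f(3) x(2) G(2) by auto
    then show ?thesis using Q(1) f(2) by blast
  qed
qed

end

context fan_setting
begin

lemma fan_edges_degree_0:
  assumes "v \<notin> insert x (\<Union>Q)"
  shows "deg (fan_edges x Q) v = 0"
proof -
  have "{e \<in> fan_edges x Q. v \<in> e} = {}" using assms by (auto simp: fan_edges_def nsets_def)
  then show ?thesis unfolding deg_def by (simp only: card.empty)
qed

lemma kp_le_fan_size: "k * p \<le> fan_size"
proof -
  have "p \<le> (Suc p choose 2)" by (simp add: numeral_2_eq_2)
  then show ?thesis unfolding fan_size_def by (rule mult_le_mono2)
qed

text \<open>Greedy packing of fans. The weight \<open>deg M v + k p deg B v\<close> of a vertex does not increase when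
  an inner edge at \<open>v\<close> is used up, so it stays small provided that all other vertices of the fans
  are taken from those of low weight.\<close>

lemma phi_inner_bound:
  assumes V: "finite V" and c: "c ` V \<subseteq> {..<p}" and \<tau>: "k * p \<le> \<tau>" and z: "2 * S \<le> z * \<tau>"
    and size: "\<And>j. j < p \<Longrightarrow> z + (2 * k * p + 1) * Suc (2 * \<tau>) < card (color_class V c j)"
    and E: "E \<subseteq> nsets V 2"
    and w: "\<And>v. v \<in> V \<Longrightarrow> deg (missing_edges V c E) v + k * p * deg (inner_edges c E) v \<le> 2 * \<tau>"
    and S: "card (missing_edges V c E) + fan_size * card (inner_edges c E) \<le> S"
  shows "phi E + 2 * card (inner_edges c E) \<le> card E + 2 * excess"
  using E w S
proof (induction "card (inner_edges c E)" arbitrary: E rule: less_induct)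
  case less
  let ?B = "inner_edges c E" and ?M = "missing_edges V c E"
  have fE: "finite E" by (rule finite_edges[OF V less.prems(1)])
  show ?case
  proof (cases "card ?B \<le> excess")
    case True
    then show ?thesis using phi_le_card[of E] by simp
  next
    case False
    \<comment> \<open>The heavy vertices. By the handshake lemma and \<open>kp_le_fan_size\<close>
      all weights together are at most \<open>2 * S\<close>, so at most \<open>z\<close> vertices
      exceed \<open>\<tau>\<close>.\<close>
    define Z where "Z = {v \<in> V. \<tau> < deg ?M v + k * p * deg ?B v}"
    have fZ: "finite Z" using V by (simp add: Z_def)
    have MV: "?M \<subseteq> nsets V 2" and BV: "?B \<subseteq> nsets V 2" using cross_pairs_subset less.prems(1) by blast+
    have \<tau>0: "\<tau> > 0" using \<tau> k2 p2 by (cases \<tau>) auto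
    have "card Z * \<tau> \<le> z * \<tau>"
    proof -
      have "card Z * \<tau> = (\<Sum>v\<in>Z. \<tau>)" by simp
      also have "\<dots> \<le> (\<Sum>v\<in>Z. deg ?M v + k * p * deg ?B v)" by (intro sum_mono) (auto simp: Z_def)
      also have "\<dots> \<le> (\<Sum>v\<in>V. deg ?M v + k * p * deg ?B v)" using V by (intro sum_mono2) (auto simp: Z_def)
      also have "\<dots> = 2 * card ?M + k * p * (2 * card ?B)"
        using handshake[OF V MV] handshake[OF V BV] by (simp add: sum.distrib flip: sum_distrib_left)
      also have "\<dots> \<le> 2 * (card ?M + fan_size * card ?B)"
        using mult_le_mono1[OF kp_le_fan_size, of "card ?B"] by simp
      also have "\<dots> \<le> z * \<tau>" by (rule order_trans[OF mult_le_mono2[OF less.prems(3)] z])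
      finally show ?thesis .
    qed
    then have cZ: "card Z \<le> z" using \<tau>0 by simp
    have big: "card Z + (2 * k * p + 1) * Suc (2 * \<tau>) < card (color_class V c j)" if "j < p" for j
      using size[OF that] cZ by linarith
    have degM: "deg ?M v \<le> 2 * \<tau>" if "v \<in> V" for v using less.prems(2)[OF that] by linarith
    obtain x Q where Q: "petals k p x Q" "fan_edges x Q \<subseteq> E" "card (inner_edges c (fan_edges x Q)) = k"
      "insert x (\<Union>Q) \<inter> Z \<subseteq> \<Union>(inner_edges c (fan_edges x Q))"
      using exists_light_fan[OF V less.prems(1) fZ c degM big] False by (auto simp: not_le)
    define A where "A = fan_edges x Q"
    have fanA: "is_fan A" using Q by (auto simp: is_fan_def A_def)
    have AE: "A \<subseteq> E" using Q by (simp add: A_def)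
    have fA: "finite A" "card A = fan_size" using is_fanD[OF fanA] by auto
    let ?E1 = "E - A"
    let ?B1 = "inner_edges c ?E1" and ?M1 = "missing_edges V c ?E1" and ?BA = "inner_edges c A"
    have E1: "?E1 \<subseteq> nsets V 2" using less.prems(1) by auto
    have B1: "?B = ?B1 \<union> ?BA" "?B1 \<inter> ?BA = {}" using AE by auto
    have M1: "?M1 = ?M \<union> (A \<inter> cross_pairs V c)" "?M \<inter> (A \<inter> cross_pairs V c) = {}" using AE by auto
    have fM: "finite ?M" using finite_edges[OF V MV] .
    have fB1: "finite ?B1" "finite ?BA" using fE fA by auto
    have cB: "card ?B = card ?B1 + k"
      using B1 fB1 Q(3) card_Un_disjoint[OF fB1 B1(2)] by (simp add: A_def)
    have cE: "card E = card ?E1 + fan_size"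
      using AE fA fE card_mono[OF fE AE] by (simp add: card_Diff_subset)
    have lt: "card ?B1 < card ?B" using cB k2 by simp
    have dA: "deg (A \<inter> cross_pairs V c) v \<le> deg A v" for v
      unfolding deg_def using fA by (intro card_mono) auto
    have w1: "deg ?M1 v + k * p * deg ?B1 v \<le> 2 * \<tau>" if v: "v \<in> V" for v
    proof -
      have dM: "deg ?M1 v = deg ?M v + deg (A \<inter> cross_pairs V c) v"
        unfolding M1(1) using fM fA M1(2) by (intro deg_Un_disjoint) auto
      have dB: "deg ?B v = deg ?B1 v + deg ?BA v"
        unfolding B1(1) using fB1 B1(2) by (intro deg_Un_disjoint)
      have dAk: "deg A v \<le> k * p" unfolding A_def by (rule deg_fan_edges_le[OF Q(1)])
      \<comment> \<open>A vertex on a used inner edge gains at most \<open>k * p\<close> missing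
        edges and loses at least \<open>k * p\<close> of weight on the inner side. Any other vertex
        of the fan is light, and its weight grows to at most \<open>\<tau> + k * p\<close>, which is
        at most \<open>2 * \<tau>\<close>.\<close>
      consider (inner) "v \<in> \<Union>?BA" | (ext) "v \<in> insert x (\<Union>Q)" "v \<notin> \<Union>?BA" | (out) "v \<notin> insert x (\<Union>Q)" by blast
      then show ?thesis
      proof cases
        case inner
        then have "{e \<in> ?BA. v \<in> e} \<noteq> {}" by blast
        moreover have "finite {e \<in> ?BA. v \<in> e}" using fB1(2) by (rule rev_finite_subset) auto
        ultimately have "deg ?BA v > 0" unfolding deg_def card_gt_0_iff by blast
        then have "deg ?BA v \<ge> 1" by simp
        then have "k * p * 1 \<le> k * p * deg ?BA v" by (rule mult_le_mono2)
        moreover have "k * p * deg ?B v = k * p * deg ?B1 v + k * p * deg ?BA v"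
          unfolding dB by (rule add_mult_distrib2)
        ultimately show ?thesis using less.prems(2)[OF v] dM dA[of v] dAk by linarith
      next
        case ext
        then have "v \<notin> Z" using Q(4) by (auto simp: A_def)
        then have "deg ?M v + k * p * deg ?B v \<le> \<tau>" using v by (simp add: Z_def)
        moreover have "k * p * deg ?B1 v \<le> k * p * deg ?B v" using dB by (intro mult_le_mono2) simp
        ultimately show ?thesis using dM dA[of v] dAk \<tau> by linarith
      next
        case out
        then have "deg A v = 0" unfolding A_def by (rule fan_edges_degree_0)
        moreover have "k * p * deg ?B1 v \<le> k * p * deg ?B v" using dB by (intro mult_le_mono2) simp
        ultimately show ?thesis using dM dA[of v] less.prems(2)[OF v] by linarith
      qed
    qed
    \<comment> \<open>A fan creates at most \<open>fan_size\<close> missing edges and removes at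
      least one inner edge, so this sum does not grow.\<close>
    have S1: "card ?M1 + fan_size * card ?B1 \<le> S"
    proof -
      have "card ?M1 \<le> card ?M + card (A \<inter> cross_pairs V c)" unfolding M1(1) by (rule card_Un_le)
      also have "card (A \<inter> cross_pairs V c) \<le> fan_size" using card_mono[OF fA(1), of "A \<inter> cross_pairs V c"] fA(2) by simp
      finally have "card ?M1 \<le> card ?M + fan_size" by simp
      moreover have "fan_size * (card ?B1 + 1) \<le> fan_size * card ?B" using lt by (intro mult_le_mono2) simp
      ultimately show ?thesis using less.prems(3) by simp
    qed
    have IH: "phi ?E1 + 2 * card ?B1 \<le> card ?E1 + 2 * excess"
      by (rule less.hyps[OF lt E1 w1 S1])
    have "phi E \<le> phi ?E1 + 1" by (rule phi_remove_fan[OF fanA AE])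
    \<comment> \<open>The fan saves \<open>fan_size - 1 \<ge> 2 * k\<close> parts and uses up
      \<open>k\<close> inner edges, each counted twice in the claim.\<close>
    then show ?thesis using IH cB cE fan_size_ge(3) by linarith
  qed
qed

text \<open>\<open>\<alpha>\<close> has to be fixed before \<open>D\<close>, as recolouring yields a
  \<open>D\<close> that depends on \<open>\<alpha>\<close>. The bound \<open>1 / (4 * p)\<close>
  keeps every class at three quarters of \<open>n / p\<close> or more.\<close>

lemma balanced_phi_bound:
  "\<exists>\<alpha>>0. \<alpha> \<le> 1 / (4 * p) \<and> (\<forall>D\<ge>0. \<exists>N. \<forall>V E c. finite V \<and> E \<subseteq> nsets V 2 \<and> N \<le> card V \<and>
     balanced \<alpha> D V E c \<longrightarrow>
     phi E + card (inner_edges c E) + card (missing_edges V c E) \<le> turan p (card V) + 2 * excess)"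
proof -
  define L where "L = real (k * p)"
  have L: "L \<ge> 0" by (simp add: L_def)
  have p0: "real p > 0" using p2 by simp
  \<comment> \<open>A vertex of a balanced graph has weight at most
    \<open>(5 + 2 * L) * \<alpha> * n\<close>, with 5 and 2 from \<open>balanced\<close>. The choice
    of \<open>\<alpha>\<close> below lets the vertices spoiled during the choice of one fan, about
    \<open>(2 * L + 1) * a * \<alpha> * n\<close>, fill a quarter of \<open>n / p\<close>.\<close>
  define a where "a = 5 + 2 * L"
  define \<alpha> where "\<alpha> = 1 / (4 * p * (2 * L + 1) * a)"
  have a: "a > 0" "a \<ge> 1" using L by (auto simp: a_def)
  have \<alpha>: "\<alpha> > 0" using L p0 a by (simp add: \<alpha>_def)
  have \<alpha>1: "(2 * L + 1) * (a * \<alpha>) = 1 / (4 * p)" using L p0 a by (simp add: \<alpha>_def)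
  have \<alpha>2: "\<alpha> \<le> 1 / (4 * p)"
  proof -
    have "1 * (1 * \<alpha>) \<le> (2 * L + 1) * (a * \<alpha>)" using L a \<alpha> by (intro mult_mono) auto
    then show ?thesis using \<alpha>1 by simp
  qed
  have "\<exists>N. \<forall>V E c. finite V \<and> E \<subseteq> nsets V 2 \<and> N \<le> card V \<and> balanced \<alpha> D V E c \<longrightarrow>
     phi E + card (inner_edges c E) + card (missing_edges V c E) \<le> turan p (card V) + 2 * excess"
    if D: "D \<ge> 0" for D
  proof -
    define m where "m = real fan_size"
    \<comment> \<open>An upper bound for \<open>2 * S / \<tau>\<close>, where \<open>S\<close> is at
      most \<open>(1 + m) * D * n\<close> and \<open>\<tau>\<close> at least
      \<open>a * \<alpha> * n / 2\<close>.\<close>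
    define z where "z = nat \<lceil>4 * (1 + m) * D / (a * \<alpha>)\<rceil>"
    define N where "N = nat \<lceil>2 * L / (a * \<alpha>) + 2 * p * (z + 3 * (2 * L + 1))\<rceil> + 1"
    have "phi E + card (inner_edges c E) + card (missing_edges V c E) \<le> turan p (card V) + 2 * excess"
      if V: "finite V" and E: "E \<subseteq> nsets V 2" and N: "N \<le> card V" and bal: "balanced \<alpha> D V E c" for V E c
    proof -
      let ?n = "real (card V)"
      have c: "c ` V \<subseteq> {..<p}" using bal by (simp add: balanced_def)
      have pos: "2 * L / (a * \<alpha>) \<ge> 0" "2 * p * (z + 3 * (2 * L + 1)) \<ge> 0" using L a \<alpha> by auto
      have "2 * L / (a * \<alpha>) + 2 * p * (z + 3 * (2 * L + 1)) < ?n" using N unfolding N_def by linarith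
      then have n1: "2 * L / (a * \<alpha>) < ?n" and n2: "2 * p * (z + 3 * (2 * L + 1)) < ?n"
        using pos by linarith+
      have n1': "2 * L < a * \<alpha> * ?n" using n1 a \<alpha> by (simp add: pos_divide_less_eq mult.commute)
      have n2': "z + 3 * (2 * L + 1) < ?n / (2 * p)" using n2 p0 by (simp add: pos_less_divide_eq mult.commute)
      define \<tau> where "\<tau> = nat \<lceil>a * \<alpha> * ?n / 2\<rceil>"
      define S where "S = nat \<lfloor>(1 + m) * D * ?n\<rfloor>"
      have an: "a * \<alpha> * ?n \<ge> 0" using a \<alpha> by simp
      have \<tau>l: "real \<tau> \<ge> a * \<alpha> * ?n / 2" unfolding \<tau>_def by linarith
      have \<tau>u: "real \<tau> \<le> a * \<alpha> * ?n / 2 + 1" unfolding \<tau>_def using an by linarith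
      have "real (k * p) \<le> real \<tau>" using n1' \<tau>l unfolding L_def by linarith
      then have \<tau>: "k * p \<le> \<tau>" by (simp only: of_nat_le_iff)
      have m0: "m \<ge> 0" by (simp add: m_def)
      have z: "2 * S \<le> z * \<tau>"
      proof -
        have "real S \<le> (1 + m) * D * ?n" unfolding S_def using D m0 by simp
        moreover have "real z * (a * \<alpha> * ?n / 2) \<ge> 2 * ((1 + m) * D * ?n)"
        proof -
          have a\<alpha>: "a * \<alpha> > 0" using a \<alpha> by simp
          have "4 * (1 + m) * D / (a * \<alpha>) \<le> real z" unfolding z_def by linarith
          then have "4 * (1 + m) * D \<le> real z * (a * \<alpha>)" using a\<alpha> by (simp only: pos_divide_le_eq)
          then have "4 * (1 + m) * D * (?n / 2) \<le> real z * (a * \<alpha>) * (?n / 2)"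
            by (rule mult_right_mono) simp
          moreover have "4 * (1 + m) * D * (?n / 2) = 2 * ((1 + m) * D * ?n)"
            by algebra
          moreover have "real z * (a * \<alpha>) * (?n / 2) = real z * (a * \<alpha> * ?n / 2)"
            by algebra
          ultimately show ?thesis by (simp only:)
        qed
        moreover have "real z * real \<tau> \<ge> real z * (a * \<alpha> * ?n / 2)" using \<tau>l by (intro mult_left_mono) auto
        ultimately have "2 * real S \<le> real z * real \<tau>" by linarith
        then have "real (2 * S) \<le> real (z * \<tau>)" by simp
        then show ?thesis by (simp only: of_nat_le_iff)
      qed
      have size: "z + (2 * k * p + 1) * Suc (2 * \<tau>) < card (color_class V c j)" if "j < p" for j
      proof -
        have "(2 * L + 1) * (2 * real \<tau> + 1) \<le> (2 * L + 1) * (a * \<alpha> * ?n + 3)"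
          using \<tau>u L by (intro mult_left_mono) auto
        also have "\<dots> = ((2 * L + 1) * (a * \<alpha>)) * ?n + 3 * (2 * L + 1)" by (simp add: algebra_simps)
        also have "\<dots> = ?n / (4 * p) + 3 * (2 * L + 1)" unfolding \<alpha>1 by simp
        finally have 1: "(2 * L + 1) * (2 * real \<tau> + 1) \<le> ?n / (4 * p) + 3 * (2 * L + 1)" .
        define y where "y = ?n / (4 * p)"
        define q where "q = (2 * L + 1) * (2 * real \<tau> + 1)"
        have "\<alpha> * ?n \<le> 1 / (4 * p) * ?n" using \<alpha>2 by (rule mult_right_mono) simp
        then have "\<alpha> * ?n \<le> y" by (simp add: y_def)
        moreover have "real (card (color_class V c j)) \<ge> ?n / p - \<alpha> * ?n"
          using bal that by (auto simp: balanced_def)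
        moreover have "?n / p = 4 * y" "?n / (2 * p) = 2 * y" by (simp_all add: y_def)
        moreover have "real z + 3 * (2 * L + 1) < 2 * y" using n2' calculation(4) by simp
        moreover have "q \<le> y + 3 * (2 * L + 1)" using 1 by (simp only: q_def y_def)
        ultimately have "real z + q < real (card (color_class V c j))" by linarith
        then have "real z + (2 * L + 1) * (2 * real \<tau> + 1) < real (card (color_class V c j))"
          by (simp only: q_def)
        then have "real (z + (2 * k * p + 1) * Suc (2 * \<tau>)) < real (card (color_class V c j))"
          by (simp add: L_def algebra_simps)
        then show ?thesis by (simp only: of_nat_less_iff)
      qed
      have w: "deg (missing_edges V c E) v + k * p * deg (inner_edges c E) v \<le> 2 * \<tau>" if "v \<in> V" for v
      proof -
        have 1: "real (deg (inner_edges c E) v) \<le> 2 * \<alpha> * ?n" and 2: "real (deg (missing_edges V c E) v) \<le> 5 * \<alpha> * ?n"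
          using bal that by (auto simp: balanced_def)
        have "L * real (deg (inner_edges c E) v) \<le> L * (2 * \<alpha> * ?n)" using 1 L by (rule mult_left_mono)
        then have "real (deg (missing_edges V c E) v) + L * real (deg (inner_edges c E) v) \<le> a * \<alpha> * ?n"
          using 2 by (simp add: a_def algebra_simps)
        also have "\<dots> \<le> 2 * real \<tau>" using \<tau>l by linarith
        finally have "real (deg (missing_edges V c E) v + k * p * deg (inner_edges c E) v) \<le> real (2 * \<tau>)"
          by (simp add: L_def)
        then show ?thesis by (simp only: of_nat_le_iff)
      qed
      have S: "card (missing_edges V c E) + fan_size * card (inner_edges c E) \<le> S"
      proof -
        have 1: "real (card (inner_edges c E)) \<le> D * ?n" and 2: "real (card (missing_edges V c E)) \<le> D * ?n"
          using bal by (auto simp: balanced_def)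
        have "m * real (card (inner_edges c E)) \<le> m * (D * ?n)" using 1 m0 by (rule mult_left_mono)
        then have "real (card (missing_edges V c E)) + m * real (card (inner_edges c E)) \<le> (1 + m) * D * ?n"
          using 2 by (simp add: algebra_simps)
        then have "real (card (missing_edges V c E) + fan_size * card (inner_edges c E)) \<le> (1 + m) * D * ?n"
          by (simp add: m_def)
        then show ?thesis unfolding S_def by (rule le_nat_floor)
      qed
      \<comment> \<open>One of the two copies of the inner edges is spent in replacing
        \<open>card E\<close> by the Turan number; \<open>card_balance\<close> also brings in the
        missing edges.\<close>
      have "phi E + 2 * card (inner_edges c E) \<le> card E + 2 * excess"
        by (rule phi_inner_bound[OF V c \<tau> z size E w S])
      moreover have "card (cross_pairs V c) \<le> turan p (card V)"
        using p2 by (intro card_cross_pairs_le_turan[OF V c]) simp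
      ultimately show ?thesis using card_balance[OF V E, of c] by linarith
    qed
    then show ?thesis by blast
  qed
  then show ?thesis using \<alpha> \<alpha>2 by blast
qed

end

section \<open>From a linear error to a bounded one\<close>

context fan_setting
begin

text \<open>The excess of the decomposition number over the Turan number is bounded because it can only
  grow along vertex deletions when the graph is balanced. Once it is bounded, a removable vertex is
  impossible in a large graph reaching the Turan number.\<close>

lemma near_extremal_structure:
  "\<exists>N. \<forall>V E. finite V \<and> E \<subseteq> nsets V 2 \<and> N \<le> card V \<and> turan p (card V) \<le> phi E \<longrightarrow>
     (\<exists>c. c ` V \<subseteq> {..<p} \<and> card (inner_edges c E) + card (missing_edges V c E) \<le> 2 * excess \<and>
        (\<forall>j<p. card V \<le> 2 * p * card (color_class V c j)))"
proof -
  obtain C where C: "\<forall>V E. finite V \<and> E \<subseteq> nsets V 2 \<and> turan p (card V) \<le> phi E \<longrightarrow>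
     (\<exists>c. c ` V \<subseteq> {..<p} \<and> card (inner_edges c E) \<le> C * card V \<and>
        card (missing_edges V c E) \<le> C * card V)"
    by (rule exE[OF almost_partite])
  obtain \<alpha> where \<alpha>: "\<alpha> > 0" "\<alpha> \<le> 1 / (4 * p)" and \<alpha>': "\<forall>D\<ge>0. \<exists>N. \<forall>V E c. finite V \<and> E \<subseteq> nsets V 2 \<and> N \<le> card V \<and>
     balanced \<alpha> D V E c \<longrightarrow>
     phi E + card (inner_edges c E) + card (missing_edges V c E) \<le> turan p (card V) + 2 * excess"
    using balanced_phi_bound by blast
  define D where "D = real C + 2 * real C / \<alpha>"
  have D: "D \<ge> 0" using \<alpha> by (simp add: D_def)
  obtain N1 where N1': "\<forall>V E c. finite V \<and> E \<subseteq> nsets V 2 \<and> N1 \<le> card V \<and> balanced \<alpha> D V E c \<longrightarrow>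
     phi E + card (inner_edges c E) + card (missing_edges V c E) \<le> turan p (card V) + 2 * excess"
    using \<alpha>'[rule_format, OF D] by (rule exE)
  have N1: "phi E + card (inner_edges c E) + card (missing_edges V c E) \<le> turan p (card V) + 2 * excess"
    if "finite V" "E \<subseteq> nsets V 2" "N1 \<le> card V" "balanced \<alpha> D V E c" for V E c
    using N1' that by blast
  obtain N2 where N2': "\<forall>V E c. finite V \<and> E \<subseteq> nsets V 2 \<and> c ` V \<subseteq> {..<p} \<and> N2 \<le> card V \<and>
     real (card (inner_edges c E)) \<le> real C * card V \<and> real (card (missing_edges V c E)) \<le> real C * card V \<and>
     turan p (card V) \<le> card E \<longrightarrow> removable (\<alpha> / 8) V E \<or> (\<exists>c'. balanced \<alpha> D V E c')"
    using removable_or_balanced[OF of_nat_0_le_iff \<alpha>(1), of C] unfolding D_def by (rule exE)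
  have N2: "removable (\<alpha> / 8) V E \<or> (\<exists>c'. balanced \<alpha> D V E c')"
    if "finite V" "E \<subseteq> nsets V 2" "c ` V \<subseteq> {..<p}" "N2 \<le> card V"
      "real (card (inner_edges c E)) \<le> real C * card V" "real (card (missing_edges V c E)) \<le> real C * card V"
      "turan p (card V) \<le> card E" for V E c
    using N2' that by blast
  define N where "N = max N1 N2 + 1"
  have dich: "removable (\<alpha> / 8) V E \<or> (\<exists>c'. balanced \<alpha> D V E c')"
    if V: "finite V" and E: "E \<subseteq> nsets V 2" and N: "N \<le> card V" and T: "turan p (card V) \<le> phi E" for V E
  proof -
    obtain c where c: "c ` V \<subseteq> {..<p}" "card (inner_edges c E) \<le> C * card V"
        "card (missing_edges V c E) \<le> C * card V"
      using C V E T by blast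
    have "real (card (inner_edges c E)) \<le> real C * card V" "real (card (missing_edges V c E)) \<le> real C * card V"
      using c(2,3) by (metis of_nat_le_iff of_nat_mult)+
    moreover have "turan p (card V) \<le> card E" using T phi_le_card[of E] by linarith
    ultimately show ?thesis using N2[OF V E c(1)] N by (simp add: N_def)
  qed
  \<comment> \<open>\<open>N * N\<close> covers graphs on fewer than \<open>N\<close> vertices,
    where the number of edges bounds \<open>phi\<close>; \<open>2 * excess\<close> is the bound in
    the balanced case.\<close>
  define K where "K = N * N + 2 * excess"
  have bounded: "phi E \<le> turan p (card V) + K" if "finite V" "E \<subseteq> nsets V 2" for V E
    using that
  proof (induction "card V" arbitrary: V E rule: less_induct)
    case less
    have fE: "finite E" by (rule finite_edges[OF less.prems])
    show ?case
    proof (cases "card V < N")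
      case True
      have "card E \<le> card (nsets V 2)" by (rule card_mono[OF finite_imp_finite_nsets[OF less.prems(1)] less.prems(2)])
      also have "\<dots> = card V choose 2" by simp
      also have "\<dots> \<le> card V * card V" unfolding choose_two by (meson div_le_dividend le_trans mult_le_mono2 diff_le_self)
      also have "\<dots> \<le> N * N" using True by (intro mult_le_mono) auto
      finally show ?thesis using phi_le_card[of E] by (simp add: K_def)
    next
      case False
      then have n: "N \<le> card V" by simp
      show ?thesis
      proof (cases "phi E < turan p (card V)")
        case False
        then have "turan p (card V) \<le> phi E" by simp
        then consider "removable (\<alpha> / 8) V E" | c' where "balanced \<alpha> D V E c'"
          using dich[OF less.prems n] by blast
        then show ?thesis
        proof cases
          case 1
          then obtain x E' where x: "x \<in> V" "E' \<subseteq> nsets (V - {x}) 2"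
            "real (phi E) \<le> real (phi E') + real (turan_step p (card V)) - \<alpha> / 8 * real (card V)"
            by (auto simp: removable_def)
          have cV: "card (V - {x}) = card V - 1" "card V \<ge> 1" using x n by (auto simp: N_def)
          have "\<alpha> / 8 * real (card V) \<ge> 0" using \<alpha> by simp
          then have "real (phi E) \<le> real (phi E' + turan_step p (card V))" using x(3) by simp
          then have "phi E \<le> phi E' + turan_step p (card V)" by (simp only: of_nat_le_iff)
          moreover have "phi E' \<le> turan p (card (V - {x})) + K"
            using less.hyps[of "V - {x}" E'] cV less.prems(1) x(2) by auto
          ultimately show ?thesis using turan_eq_step[OF cV(2), of p] cV(1) by simp
        next
          case 2
          have "N1 \<le> card V" using n by (simp add: N_def)
          from N1[OF less.prems this 2] show ?thesis unfolding K_def by linarith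
        qed
      qed simp
    qed
  qed
  \<comment> \<open>Large enough for a single removal, which raises the surplus by
    \<open>\<alpha> / 8 * n\<close>, to exceed the bound \<open>K\<close>.\<close>
  define N' where "N' = N + nat \<lceil>8 * K / \<alpha>\<rceil> + 1"
  have "\<exists>c. c ` V \<subseteq> {..<p} \<and> card (inner_edges c E) + card (missing_edges V c E) \<le> 2 * excess \<and>
        (\<forall>j<p. card V \<le> 2 * p * card (color_class V c j))"
    if V: "finite V" and E: "E \<subseteq> nsets V 2" and N': "N' \<le> card V" and T: "turan p (card V) \<le> phi E" for V E
  proof -
    have n: "N \<le> card V" "card V \<ge> 1" using N' by (auto simp: N'_def)
    have "\<not> removable (\<alpha> / 8) V E"
    proof
      assume "removable (\<alpha> / 8) V E"
      then obtain x E' where x: "x \<in> V" "E' \<subseteq> nsets (V - {x}) 2"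
        "real (phi E) \<le> real (phi E') + real (turan_step p (card V)) - \<alpha> / 8 * real (card V)"
        by (auto simp: removable_def)
      have cV: "card (V - {x}) = card V - 1" using x by auto
      have "8 * K / \<alpha> < real (card V)" using N' unfolding N'_def by linarith
      then have "real K < \<alpha> / 8 * real (card V)" using \<alpha> by (simp add: field_simps)
      moreover have "phi E' \<le> turan p (card V - 1) + K"
        using bounded[of "V - {x}" E'] cV V x(2) by auto
      ultimately have "real (phi E) < real (turan p (card V - 1) + turan_step p (card V))"
        using x(3) by simp
      then show False using T turan_eq_step[OF n(2), of p] by simp
    qed
    then obtain c where c: "balanced \<alpha> D V E c" using dich[OF V E n(1) T] by blast
    have "phi E + card (inner_edges c E) + card (missing_edges V c E) \<le> turan p (card V) + 2 * excess"
      using N1[OF V E _ c] n by (simp add: N_def)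
    then have "card (inner_edges c E) + card (missing_edges V c E) \<le> 2 * excess" using T by linarith
    moreover have "card V \<le> 2 * p * card (color_class V c j)" if "j < p" for j
    proof -
      have p0: "real p > 0" using p2 by simp
      have "real (card (color_class V c j)) \<ge> real (card V) / p - \<alpha> * real (card V)"
        using c that by (auto simp: balanced_def)
      moreover have "\<alpha> * real (card V) \<le> 1 / (4 * p) * real (card V)" using \<alpha>(2) by (intro mult_right_mono) auto
      moreover have "real (card V) / p = 4 * (1 / (4 * p) * real (card V))" by simp
      moreover have "0 \<le> 1 / (4 * p) * real (card V)" by simp
      ultimately have "2 * (1 / (4 * p) * real (card V)) \<le> real (card (color_class V c j))" by linarith
      then have "real (card V) \<le> 2 * p * real (card (color_class V c j))"
        using p0 by (simp add: field_simps)
      then have "real (card V) \<le> real (2 * p * card (color_class V c j))" by simp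
      then show ?thesis by (simp only: of_nat_le_iff)
    qed
    ultimately show ?thesis using c by (auto simp: balanced_def)
  qed
  then show ?thesis by blast
qed

end

section \<open>Comparison with fan-free graphs\<close>

context fan_setting
begin

lemma edges_fan_nonempty: "edges (fan k (Suc p)) \<noteq> {}"
proof -
  have "{None, Some (0, 0)} \<in> edges (fan k (Suc p))"
    unfolding edges_fan using k2 p2 by (intro UN_I[of 0]) auto
  then show ?thesis by blast
qed

lemma petals_subset:
  assumes "petals k p x Q" "fan_edges x Q \<subseteq> nsets V 2"
  shows "insert x (\<Union>Q) \<subseteq> V"
proof -
  have "\<Union>(fan_edges x Q) = insert x (\<Union>Q)" using k2 p2 by (intro Union_fan_edges[OF assms(1)]) auto
  moreover have "\<Union>(fan_edges x Q) \<subseteq> V" using assms(2) by (auto simp: nsets_def)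
  ultimately show ?thesis by simp
qed

text \<open>A petal together with the centre has \<open>p + 1\<close> vertices, but there are only
  \<open>p\<close> colours.\<close>

lemma fan_inner_edge:
  assumes Q: "petals k p x Q" and V: "fan_edges x Q \<subseteq> nsets V 2" and c: "c ` V \<subseteq> {..<p}"
  shows "\<exists>e\<in>fan_edges x Q. mono_edge c e"
proof -
  have "Q \<noteq> {}" using Q k2 by (auto simp: petals_def)
  then obtain q where q: "q \<in> Q" by blast
  then have cq: "finite q" "card q = p" "x \<notin> q" using Q by (auto simp: petals_def)
  have "insert x q \<subseteq> V" using petals_subset[OF Q V] q by auto
  then have "card (c ` insert x q) \<le> card {..<p}" using c by (intro card_mono) auto
  also have "\<dots> < card (insert x q)" using cq by simp
  finally have "\<not> inj_on c (insert x q)" by (rule pigeonhole)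
  then obtain u v where uv: "u \<in> insert x q" "v \<in> insert x q" "u \<noteq> v" "c u = c v"
    unfolding inj_on_def by blast
  then have "{u, v} \<in> nsets (insert x q) 2" by simp
  then have "{u, v} \<in> fan_edges x Q" using q unfolding fan_edges_def by blast
  then show ?thesis using uv(4) by (intro bexI[of _ "{u, v}"]) simp_all
qed

text \<open>This provides the two edges outside \<open>S\<close> for a fan that has a vertex outside
  \<open>S\<close>: every vertex lies in a clique on \<open>p + 1 \<ge> 3\<close> vertices.\<close>

lemma fan_degree_ge_2:
  assumes Q: "petals k p x Q" and w: "w \<in> insert x (\<Union>Q)"
  shows "2 \<le> deg (fan_edges x Q) w"
proof -
  have "Q \<noteq> {}" using Q k2 by (auto simp: petals_def)
  then obtain q where q: "q \<in> Q" "w \<in> insert x q" using w by blast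
  then have cq: "finite q" "card q = p" "x \<notin> q" using Q by (auto simp: petals_def)
  have "nbh (nsets (insert x q) 2) w = insert x q - {w}" using q(2) by (auto simp: nbh_def)
  then have "deg (nsets (insert x q) 2) w = card (insert x q - {w})"
    using card_nbh[of "nsets (insert x q) 2" "insert x q" w] by simp
  also have "\<dots> = p" using q(2) cq by (subst card_Diff_singleton) auto
  finally have "deg (nsets (insert x q) 2) w = p" .
  moreover have "deg (nsets (insert x q) 2) w \<le> deg (fan_edges x Q) w"
  proof -
    have "finite {e \<in> fan_edges x Q. w \<in> e}" using finite_fan_edges[OF Q] by simp
    then show ?thesis unfolding deg_def by (rule card_mono) (use q(1) in \<open>auto simp: fan_edges_def\<close>)
  qed
  ultimately show ?thesis using p2 by linarith
qed

text \<open>Vertices outside \<open>S\<close> are adjacent to exactly the vertices of other colours, hence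
  interchangeable within a colour class. A fan contained in \<open>S\<close> has either a petal with a repeated
  colour, one of whose vertices can be exchanged, or an exchangeable centre.\<close>

lemma relocate_fan:
  fixes c :: "'a \<Rightarrow> nat"
  assumes V: "finite V" and E: "E \<subseteq> nsets V 2" and c: "c ` V \<subseteq> {..<p}" and S: "S \<subseteq> V"
    and Y: "finite Y" "Y \<inter> S = {}"
    and gen: "\<And>u v. u \<in> V \<Longrightarrow> v \<in> V - S \<Longrightarrow> {u, v} \<in> E \<longleftrightarrow> c u \<noteq> c v"
    and M: "\<And>v. v \<in> V \<Longrightarrow> deg (missing_edges V c E) v \<le> h"
    and big: "\<And>j. j < p \<Longrightarrow> card (S \<union> Y) + (2 * k * p + 1) * Suc h < card (color_class V c j)"
    and Q: "petals k p x Q" "fan_edges x Q \<subseteq> E"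
  shows "\<exists>x' Q'. petals k p x' Q' \<and> fan_edges x' Q' \<subseteq> E \<and> insert x' (\<Union>Q') \<inter> Y = {} \<and>
    (\<forall>e\<in>fan_edges x' Q'. e \<subseteq> S \<longrightarrow> e \<in> fan_edges x Q) \<and> \<not> insert x' (\<Union>Q') \<subseteq> S"
proof -
  have fS: "finite S" using V S by (rule rev_finite_subset)
  have fH: "finite (S \<union> Y)" using fS Y by simp
  have "fan_edges x Q \<subseteq> nsets V 2" using Q E by blast
  then have FV: "insert x (\<Union>Q) \<subseteq> V" by (rule petals_subset[OF Q(1)])
  have Qf: "finite Q" "card Q = k" "disjoint Q" using Q(1) by (auto simp: petals_def)
  obtain q where q: "bij_betw q {..<k} Q"
    using ex_bij_betw_nat_finite[OF Qf(1)] Qf(2) by (auto simp: atLeast0LessThan)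
  have qQ: "q i \<in> Q" if "i < k" for i using q that by (auto simp: bij_betw_def)
  have qp: "finite (q i)" "card (q i) = p" "x \<notin> q i" "q i \<subseteq> V" if "i < k" for i
    using qQ[OF that] Q(1) FV by (auto simp: petals_def)
  have xV: "x \<in> V" using FV by simp
  have qd: "q i \<inter> q i' = {}" if "i < k" "i' < k" "i \<noteq> i'" for i i'
  proof -
    have "q i \<noteq> q i'" using q that by (auto simp: bij_betw_def inj_on_def)
    then show ?thesis using Qf(3) qQ[OF that(1)] qQ[OF that(2)] by (auto simp: disjoint_def)
  qed
  have cl: "nsets (insert x (q i)) 2 \<subseteq> fan_edges x Q" if "i < k" for i
    using qQ[OF that] by (auto simp: fan_edges_def)
  have adj: "{u, v} \<in> E" if "i < k" "u \<in> insert x (q i)" "v \<in> insert x (q i)" "u \<noteq> v" for i u v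
  proof -
    have "{u, v} \<in> nsets (insert x (q i)) 2" using that by simp
    then show ?thesis using cl[OF that(1)] Q(2) by blast
  qed
  have gcol: "c u \<noteq> c v" if "i < k" "u \<in> insert x (q i)" "v \<in> insert x (q i)" "u \<noteq> v" "v \<notin> S" for i u v
    using gen[of u v] adj[OF that(1-4)] that qp(4)[OF that(1)] xV by auto
  \<comment> \<open>A part \<open>s i\<close> of each petal inside \<open>S\<close> is kept, and the
    colours \<open>J i\<close> are filled with fresh vertices outside \<open>S\<close> and
    \<open>Y\<close>. Edges at fresh vertices are not inside \<open>S\<close>, so only the kept
    edges have to be compared with the old fan.\<close>
  have finish: ?thesis
    if x': "x' \<in> V" "x' \<notin> Y" and s: "\<And>i. i < k \<Longrightarrow> s i \<subseteq> q i \<inter> S" "\<And>i. i < k \<Longrightarrow> x' \<notin> s i"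
      and J: "\<And>i. i < k \<Longrightarrow> J i \<subseteq> {..<p}" "\<And>i. i < k \<Longrightarrow> J i \<inter> c ` insert x' (s i) = {}"
      and sJ: "\<And>i. i < k \<Longrightarrow> card (s i) + card (J i) = p"
      and nE: "\<And>i. i < k \<Longrightarrow> nsets (insert x' (s i)) 2 \<subseteq> E"
      and nF: "\<And>i e. i < k \<Longrightarrow> e \<in> nsets (insert x' (s i)) 2 \<Longrightarrow> e \<subseteq> S \<Longrightarrow> e \<in> fan_edges x Q"
      and out: "x' \<notin> S \<or> (\<exists>i<k. J i \<noteq> {})"
    for x' s J
  proof -
    have s1: "\<And>i. i < k \<Longrightarrow> s i \<subseteq> V - {x'}" using s S by blast
    have s2: "\<And>i i'. i < k \<Longrightarrow> i' < k \<Longrightarrow> i \<noteq> i' \<Longrightarrow> s i \<inter> s i' = {}"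
      using s(1) qd by blast
    obtain Q' T where Q': "petals k p x' Q'" "T \<subseteq> V - (S \<union> Y) - insert x' (\<Union>i<k. s i)"
      "\<Union>Q' = (\<Union>i<k. s i) \<union> T" "card T = (\<Sum>i<k. card (J i))"
      "\<forall>e\<in>fan_edges x' Q'. (\<exists>i<k. e \<in> nsets (insert x' (s i)) 2) \<or> e \<inter> T \<noteq> {} \<and> e \<in> E \<and> e \<in> cross_pairs V c"
      using complete_petals[where s = s and J = J, OF V E fH M big x'(1) s1 s2 J sJ] by blast
    have "fan_edges x' Q' \<subseteq> E" using Q'(5) nE by blast
    moreover have "insert x' (\<Union>Q') \<inter> Y = {}" using x'(2) Q'(2,3) s(1) Y(2) by blast
    moreover have "\<forall>e\<in>fan_edges x' Q'. e \<subseteq> S \<longrightarrow> e \<in> fan_edges x Q"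
      using Q'(2,5) nF by blast
    moreover have "\<not> insert x' (\<Union>Q') \<subseteq> S"
    proof (cases "x' \<in> S")
      case True
      then obtain i where i: "i < k" "J i \<noteq> {}" using out by blast
      have "finite (J i)" using J(1)[OF i(1)] by (rule finite_subset) simp
      then have "card (J i) > 0" using i(2) by (simp add: card_gt_0_iff)
      moreover have "card (J i) \<le> (\<Sum>i<k. card (J i))" using i(1) by (intro member_le_sum) auto
      ultimately have "T \<noteq> {}" using Q'(4) by auto
      then show ?thesis using Q'(2,3) by blast
    qed simp
    ultimately show ?thesis using Q'(1) by blast
  qed
  define s where "s i = q i \<inter> S" for i
  define J where "J i = c ` (q i - S)" for i
  have sJ: "card (s i) + card (J i) = p" if i: "i < k" for i
  proof -
    \<comment> \<open>Petal vertices outside \<open>S\<close> have pairwise distinct colours, so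
      their colours determine as many fresh vertices.\<close>
    have "inj_on c (q i - S)" using gcol[OF i] by (auto simp: inj_on_def)
    then have "card (J i) = card (q i - S)" by (simp add: J_def card_image)
    moreover have "card (q i) = card (q i \<inter> S) + card (q i - S)"
      using qp(1)[OF i] by (rule card_Int_Diff)
    ultimately show ?thesis using qp(2)[OF i] by (simp add: s_def)
  qed
  have Jp: "J i \<subseteq> {..<p}" if "i < k" for i using c qp(4)[OF that] by (auto simp: J_def)
  have Js: "J i \<inter> c ` insert x (s i) = {}" if i: "i < k" for i
  proof -
    have "c u \<noteq> c v" if "u \<in> insert x (s i)" "v \<in> q i - S" for u v
      using that qp(3)[OF i] by (intro gcol[OF i]) (auto simp: s_def)
    then show ?thesis by (fastforce simp: J_def)
  qed
  show ?thesis
  proof (cases "\<forall>i<k. \<forall>u\<in>q i \<inter> S. c u \<noteq> c x")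
    case True
    \<comment> \<open>No petal vertex in \<open>S\<close> has the colour of the centre, so a fresh
      vertex of that colour can become the centre.\<close>
    define U where "U = (\<Union>i<k. s i)"
    have UV: "U \<subseteq> V" using S by (auto simp: U_def s_def)
    have fU: "finite U" using V UV by (rule rev_finite_subset)
    have "card U \<le> (\<Sum>i<k. card (s i))" unfolding U_def by (rule card_UN_le) simp
    also have "\<dots> \<le> (\<Sum>i<k. p)" using sJ by (intro sum_mono) (metis le_add1 lessThan_iff)
    finally have cU: "card U \<le> k * p" by simp
    have cx: "c x < p" using c xV by auto
    have big1: "card (S \<union> Y) + (card U + card {()}) * Suc h < card (color_class V c (c x))"
      if "i \<in> {()}" for i
    proof -
      have "k * p \<le> 2 * k * p" by simp
      then have "card U + card {()} \<le> 2 * k * p + 1" using cU by simp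
      then have "(card U + card {()}) * Suc h \<le> (2 * k * p + 1) * Suc h" by (rule mult_le_mono1)
      then show ?thesis using big[OF cx] by linarith
    qed
    obtain g where g: "g () \<in> V - (S \<union> Y) - U" "c (g ()) = c x" "\<forall>u\<in>U. c u \<noteq> c x \<longrightarrow> {u, g ()} \<in> E"
      using partite_extension[where col = "\<lambda>_. c x", OF V E _ fU UV fH M big1] by auto
    define y where "y = g ()"
    have y: "y \<in> V" "y \<notin> Y" "y \<notin> S" "y \<notin> U" "c y = c x" using g by (auto simp: y_def)
    have yE: "{u, y} \<in> E" if "i < k" "u \<in> s i" for i u
      using g(3) that True by (auto simp: y_def U_def s_def)
    show ?thesis
    proof (rule finish[where x' = y and s = s and J = J])
      show "y \<in> V" "y \<notin> Y" "y \<notin> S \<or> (\<exists>i<k. J i \<noteq> {})" using y by auto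
      fix i assume i: "i < k"
      show "s i \<subseteq> q i \<inter> S" by (simp add: s_def)
      show "y \<notin> s i" using y i by (auto simp: U_def)
      show "J i \<subseteq> {..<p}" by (rule Jp[OF i])
      show "J i \<inter> c ` insert y (s i) = {}" using Js[OF i] y(5) by simp
      show "card (s i) + card (J i) = p" by (rule sJ[OF i])
      show "nsets (insert y (s i)) 2 \<subseteq> E"
      proof
        fix e assume "e \<in> nsets (insert y (s i)) 2"
        then obtain u v where uv: "e = {u, v}" "u \<noteq> v" "u \<in> insert y (s i)" "v \<in> insert y (s i)"
          by (auto simp: nsets_2_eq)
        consider "u = y" "v \<in> s i" | "v = y" "u \<in> s i" | "u \<in> s i" "v \<in> s i" using uv by auto
        then show "e \<in> E"
        proof cases
          case 1
          then show ?thesis using yE[OF i] uv by (simp add: insert_commute)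
        next
          case 2
          then show ?thesis using yE[OF i] uv by simp
        next
          case 3
          then show ?thesis using adj[OF i, of u v] uv by (simp add: s_def)
        qed
      qed
    next
      fix i e assume i: "i < k" and e: "e \<in> nsets (insert y (s i)) 2" "e \<subseteq> S"
      then have "e \<in> nsets (insert x (q i)) 2" using y(3) by (auto simp: nsets_def s_def)
      then show "e \<in> fan_edges x Q" using cl[OF i] by blast
    qed
  next
    case False
    then obtain i1 u1 where u1: "i1 < k" "u1 \<in> q i1" "u1 \<in> S" "c u1 = c x" by blast
    have u1x: "u1 \<noteq> x" using u1 qp(3) by auto
    have xS: "x \<in> S"
    proof (rule ccontr)
      assume "x \<notin> S"
      then have "c u1 \<noteq> c x" using u1 u1x by (intro gcol[OF u1(1)]) auto
      then show False using u1 by simp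
    qed
    have xY: "x \<notin> Y" using xS Y by blast
    show ?thesis
    proof (cases "\<exists>i<k. \<not> q i \<subseteq> S")
      case True
      show ?thesis
      proof (rule finish[where x' = x and s = s and J = J])
        show "x \<notin> S \<or> (\<exists>i<k. J i \<noteq> {})" using True by (auto simp: J_def)
        fix i assume i: "i < k"
        show "x \<notin> s i" using qp(3)[OF i] by (simp add: s_def)
        have "nsets (insert x (s i)) 2 \<subseteq> nsets (insert x (q i)) 2" by (rule nsets_mono) (auto simp: s_def)
        then have n: "nsets (insert x (s i)) 2 \<subseteq> fan_edges x Q" using cl[OF i] by blast
        then show "nsets (insert x (s i)) 2 \<subseteq> E" using Q(2) by blast
        show "e \<in> fan_edges x Q" if "e \<in> nsets (insert x (s i)) 2" for e using n that by blast
      qed (use xV xY Jp Js sJ in \<open>auto simp: s_def\<close>)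
    next
      case False
      then have qS: "q i \<subseteq> S" if "i < k" for i using that by blast
      have "\<not> q i1 \<subseteq> {u1}"
        using card_mono[of "{u1}" "q i1"] qp(2)[OF u1(1)] p2 by auto
      then obtain v where v: "v \<in> q i1" "v \<noteq> u1" by blast
      \<comment> \<open>All petals lie in \<open>S\<close>. As \<open>x\<close> and
        \<open>u1\<close> share a colour, the \<open>p\<close> vertices of \<open>A\<close> show
        fewer than \<open>p\<close> colours, so the dropped vertex \<open>v\<close> can be replaced
        by a fresh one of a colour \<open>j\<close> missing on \<open>A\<close>.\<close>
      define A where "A = insert x (q i1 - {v})"
      have fA: "finite A" using qp(1)[OF u1(1)] by (simp add: A_def)
      have cA: "card A = p"
        using qp(1-3)[OF u1(1)] v p2 by (simp add: A_def card_Diff_singleton)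
      have "\<not> inj_on c A" using u1 v u1x by (auto simp: A_def inj_on_def)
      then have "card (c ` A) < p" using card_image_le[OF fA, of c] cA eq_card_imp_inj_on[OF fA, of c] by linarith
      then have "\<not> {..<p} \<subseteq> c ` A" using card_mono[of "c ` A" "{..<p}"] fA by auto
      then obtain j where j: "j < p" "j \<notin> c ` A" by auto
      define s' where "s' i = (if i = i1 then q i1 - {v} else q i)" for i
      define J' where "J' i = (if i = i1 then {j} else {})" for i
      show ?thesis
      proof (rule finish[where x' = x and s = s' and J = J'])
        show "x \<notin> S \<or> (\<exists>i<k. J' i \<noteq> {})" using u1(1) by (auto simp: J'_def)
        fix i assume i: "i < k"
        have sq: "s' i \<subseteq> q i" by (auto simp: s'_def)
        show "s' i \<subseteq> q i \<inter> S" using sq qS[OF i] by blast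
        show "x \<notin> s' i" using sq qp(3)[OF i] by blast
        show "J' i \<subseteq> {..<p}" using j by (simp add: J'_def)
        show "J' i \<inter> c ` insert x (s' i) = {}" using j(2) by (simp add: J'_def s'_def A_def)
        show "card (s' i) + card (J' i) = p"
          using qp(1,2)[OF i] v p2 by (auto simp: s'_def J'_def card_Diff_singleton)
        have "nsets (insert x (s' i)) 2 \<subseteq> nsets (insert x (q i)) 2" by (rule nsets_mono) (use sq in auto)
        then have n: "nsets (insert x (s' i)) 2 \<subseteq> fan_edges x Q" using cl[OF i] by blast
        then show "nsets (insert x (s' i)) 2 \<subseteq> E" using Q(2) by blast
        show "e \<in> fan_edges x Q" if "e \<in> nsets (insert x (s' i)) 2" for e using n that by blast
      qed (use xV xY in auto)
    qed
  qed
qed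

text \<open>Fans are packed so that each uses at most \<open>fan_size - 2\<close> edges inside \<open>S\<close>. Deleting the edges
  used inside \<open>S\<close> leaves a fan-free graph once no further fan can be packed, which loses fewer edges
  than the packing saves parts.\<close>

lemma phi_less_fan_free:
  assumes V: "finite V" and E: "E \<subseteq> nsets V 2" and c: "c ` V \<subseteq> {..<p}"
    and b: "card (inner_edges c E) + card (missing_edges V c E) \<le> b"
    and big: "\<And>j. j < p \<Longrightarrow> 2 * b + 4 * b * b * (k * p + 1) + (2 * k * p + 1) * Suc b < card (color_class V c j)"
    and nf: "\<not> fan_free E"
  shows "\<exists>D\<subseteq>E. fan_free (E - D) \<and> phi E < card (E - D)"
proof -
  let ?B = "inner_edges c E" and ?M = "missing_edges V c E"
  define S where "S = \<Union>(?B \<union> ?M)"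
  have BMV: "?B \<union> ?M \<subseteq> nsets V 2" using E cross_pairs_subset by blast
  have fE: "finite E" by (rule finite_edges[OF V E])
  have fBM: "finite (?B \<union> ?M)" by (rule finite_edges[OF V BMV])
  have SV: "S \<subseteq> V" using BMV by (auto simp: S_def nsets_def)
  have fS: "finite S" using V SV by (rule rev_finite_subset)
  have cS: "card S \<le> 2 * b"
  proof -
    have "card S \<le> (\<Sum>e\<in>?B \<union> ?M. card e)" unfolding S_def by (rule card_Union_le_sum_card)
    also have "\<dots> = (\<Sum>e\<in>?B \<union> ?M. 2)" using BMV by (intro sum.cong) (auto simp: nsets_def)
    also have "\<dots> = 2 * card (?B \<union> ?M)" by simp
    also have "\<dots> \<le> 2 * b" using card_Un_le[of ?B ?M] b by linarith
    finally show ?thesis .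
  qed
  define ES where "ES = {e \<in> E. e \<subseteq> S}"
  have fES: "finite ES" using fE by (simp add: ES_def)
  have cES: "card ES \<le> 4 * b * b"
  proof -
    have "ES \<subseteq> nsets S 2" using E by (auto simp: ES_def nsets_def)
    then have "card ES \<le> card S choose 2" using card_mono[OF finite_imp_finite_nsets[OF fS]] by fastforce
    also have "\<dots> \<le> card S * card S" unfolding choose_two by (meson div_le_dividend le_trans mult_le_mono2 diff_le_self)
    also have "\<dots> \<le> (2 * b) * (2 * b)" using cS by (intro mult_le_mono)
    finally show ?thesis by simp
  qed
  have gen: "{u, v} \<in> E \<longleftrightarrow> c u \<noteq> c v" if "u \<in> V" "v \<in> V - S" for u v
  proof
    assume e: "{u, v} \<in> E"
    show "c u \<noteq> c v"
    proof
      assume "c u = c v"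
      then have "{u, v} \<in> ?B" using e by simp
      then have "v \<in> S" unfolding S_def by blast
      then show False using that by simp
    qed
  next
    assume "c u \<noteq> c v"
    then have "{u, v} \<in> cross_pairs V c" using that by simp
    moreover have "{u, v} \<notin> ?M"
    proof
      assume "{u, v} \<in> ?M"
      then have "v \<in> S" unfolding S_def by blast
      then show False using that by simp
    qed
    ultimately show "{u, v} \<in> E" by blast
  qed
  have M: "deg ?M v \<le> b" for v
  proof -
    have "deg ?M v \<le> card ?M" unfolding deg_def using fBM by (intro card_mono) auto
    then show ?thesis using b by linarith
  qed
  \<comment> \<open>\<open>D\<close> holds the edges inside \<open>S\<close> used so far,
    \<open>Y\<close> the vertices outside \<open>S\<close> of the fans packed so far, and
    \<open>E0\<close> the edges still available. A round adds at least one edge to \<open>D\<close>,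
    since every inner edge lies in \<open>S\<close>, and at most \<open>k * p + 1\<close> vertices
    to \<open>Y\<close>, so \<open>Y\<close> stays bounded. The conditional term records that the
    gain is strict once a fan is packed: \<open>fan_size - 1\<close> parts are saved for at most
    \<open>fan_size - 2\<close> edges.\<close>
  have claim: "\<exists>D'. D \<subseteq> D' \<and> D' \<subseteq> ES \<and> fan_free (E - D') \<and>
      phi E0 + card (D' - D) + (if D' = D then 0 else 1) \<le> card E0"
    if "D \<subseteq> ES" "finite Y" "Y \<inter> S = {}" "card Y + card (ES - D) * (k * p + 1) \<le> 4 * b * b * (k * p + 1)"
      "E0 \<subseteq> E" "\<And>e. e \<in> E - D \<Longrightarrow> e \<inter> Y = {} \<Longrightarrow> e \<in> E0"
    for D Y E0
    using that
  proof (induction "card (ES - D)" arbitrary: D Y E0 rule: less_induct)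
    case less
    note D = less.prems(1) and Y = less.prems(2,3) and cY = less.prems(4) and E0 = less.prems(5,6)
    show ?case
    proof (cases "fan_free (E - D)")
      case True
      then show ?thesis using D phi_le_card[of E0] by (intro exI[of _ D]) simp
    next
      case False
      then obtain x Q where Q: "petals k p x Q" "fan_edges x Q \<subseteq> E - D"
        by (auto simp: fan_free_def is_fan_def)
      have "card (S \<union> Y) \<le> 2 * b + 4 * b * b * (k * p + 1)"
        using card_Un_le[of S Y] cS cY by linarith
      then have big': "card (S \<union> Y) + (2 * k * p + 1) * Suc b < card (color_class V c j)" if "j < p" for j
        using big[OF that] by linarith
      have QE: "fan_edges x Q \<subseteq> E" using Q(2) by blast
      have "\<exists>x' Q'. petals k p x' Q' \<and> fan_edges x' Q' \<subseteq> E \<and> insert x' (\<Union>Q') \<inter> Y = {} \<and>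
        (\<forall>e\<in>fan_edges x' Q'. e \<subseteq> S \<longrightarrow> e \<in> fan_edges x Q) \<and> \<not> insert x' (\<Union>Q') \<subseteq> S"
        by (rule relocate_fan[OF V E c SV Y gen M big' Q(1) QE])
      then obtain x' Q' where Q': "petals k p x' Q'" "fan_edges x' Q' \<subseteq> E" "insert x' (\<Union>Q') \<inter> Y = {}"
        "\<forall>e\<in>fan_edges x' Q'. e \<subseteq> S \<longrightarrow> e \<in> fan_edges x Q" "\<not> insert x' (\<Union>Q') \<subseteq> S"
        by (elim exE conjE)
      define A where "A = fan_edges x' Q'"
      define A1 where "A1 = {e \<in> A. e \<subseteq> S}"
      define D1 where "D1 = D \<union> A1"
      define Y1 where "Y1 = Y \<union> (insert x' (\<Union>Q') - S)"
      have fan: "is_fan A" using Q'(1) by (auto simp: is_fan_def A_def)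
      have fA: "finite A" "card A = fan_size" using is_fanD[OF fan] by auto
      have AE: "A \<subseteq> E" using Q' by (simp add: A_def)
      have AV: "\<Union>A = insert x' (\<Union>Q')" unfolding A_def using k2 p2 by (intro Union_fan_edges[OF Q'(1)]) auto
      have A1D: "A1 \<inter> D = {}" using Q'(4) Q(2) unfolding A1_def A_def by blast
      have A1ES: "A1 \<subseteq> ES" using AE by (auto simp: A1_def ES_def)
      have AD: "A \<inter> D = {}" using A1D D unfolding A1_def ES_def by blast
      \<comment> \<open>Avoiding \<open>Y\<close> and \<open>D\<close> is enough, since every edge
        consumed earlier is in \<open>D\<close> or meets \<open>Y\<close>.\<close>
      have AE0: "A \<subseteq> E0"
      proof
        fix e assume e: "e \<in> A"
        then have "e \<inter> Y = {}" using Q'(3) AV by blast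
        then show "e \<in> E0" using E0(2) e AE AD by blast
      qed
      have "\<exists>e\<in>A. mono_edge c e"
        unfolding A_def using Q'(2) E by (intro fan_inner_edge[OF Q'(1) _ c]) blast
      then obtain e0 where e0: "e0 \<in> A" "mono_edge c e0" by blast
      then have "e0 \<in> ?B" using AE by blast
      then have "e0 \<subseteq> S" unfolding S_def by blast
      then have A1ne: "e0 \<in> A1" using e0 by (simp add: A1_def)
      have cA1: "card A1 + 2 \<le> fan_size"
      proof -
        obtain w where w: "w \<in> insert x' (\<Union>Q')" "w \<notin> S" using Q'(5) by blast
        have "card A1 + deg A w = card (A1 \<union> {e \<in> A. w \<in> e})"
          unfolding deg_def using fA(1) w(2) by (intro card_Un_disjoint[symmetric]) (auto simp: A1_def)
        also have "\<dots> \<le> card A" using fA(1) by (intro card_mono) (auto simp: A1_def)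
        finally show ?thesis using fan_degree_ge_2[OF Q'(1) w(1)] fA(2) by (simp add: A_def)
      qed
      have fA1: "finite A1" using fA by (simp add: A1_def)
      have D1: "D1 \<subseteq> ES" using D A1ES by (simp add: D1_def)
      have cD1: "card (ES - D1) < card (ES - D)"
        using fES A1ne A1ES A1D by (intro psubset_card_mono) (auto simp: D1_def)
      have fY1: "finite Y1" using Y(1) Q'(1) by (auto simp: Y1_def petals_def)
      have cY1: "card Y1 \<le> card Y + (k * p + 1)"
      proof -
        have "card (\<Union>Q') = k * p"
          using Q'(1) by (subst card_Union_disjoint) (auto simp: petals_def pairwise_def disjnt_def disjoint_def)
        then have "card (insert x' (\<Union>Q')) \<le> k * p + 1" using card_insert_le_m1[of "k * p + 1" "\<Union>Q'" x'] by simp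
        moreover have "card (insert x' (\<Union>Q') - S) \<le> card (insert x' (\<Union>Q'))"
          using Q'(1) by (intro card_mono) (auto simp: petals_def)
        ultimately show ?thesis unfolding Y1_def
          using card_Un_le[of Y "insert x' (\<Union>Q') - S"] by linarith
      qed
      have "card Y1 + card (ES - D1) * (k * p + 1) \<le> card Y + (card (ES - D1) + 1) * (k * p + 1)"
        using cY1 by simp
      also have "\<dots> \<le> card Y + card (ES - D) * (k * p + 1)"
        using cD1 by (intro add_left_mono mult_le_mono1) simp
      finally have cY1': "card Y1 + card (ES - D1) * (k * p + 1) \<le> 4 * b * b * (k * p + 1)" using cY by linarith
      have E1: "e \<in> E0 - A" if "e \<in> E - D1" "e \<inter> Y1 = {}" for e
      proof
        show "e \<in> E0" using that by (intro E0(2)) (auto simp: D1_def Y1_def)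
        show "e \<notin> A"
        proof
          assume e: "e \<in> A"
          then have "\<not> e \<subseteq> S" using that(1) by (auto simp: D1_def A1_def)
          then obtain w where "w \<in> e" "w \<notin> S" by blast
          then have "w \<in> Y1" using e AV by (auto simp: Y1_def)
          then show False using that(2) \<open>w \<in> e\<close> by blast
        qed
      qed
      have YS1: "Y1 \<inter> S = {}" using Y(2) by (auto simp: Y1_def)
      have E01: "E0 - A \<subseteq> E" using E0(1) by blast
      obtain D' where D': "D1 \<subseteq> D'" "D' \<subseteq> ES" "fan_free (E - D')"
        "phi (E0 - A) + card (D' - D1) + (if D' = D1 then 0 else 1) \<le> card (E0 - A)"
        using less.hyps[OF cD1 D1 fY1 YS1 cY1' E01 E1] by blast
      have fE0: "finite E0" using fE E0(1) by (rule rev_finite_subset)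
      have "card E0 = card (E0 - A) + fan_size"
        using AE0 fA card_mono[OF fE0 AE0] by (simp add: card_Diff_subset)
      moreover have "phi E0 \<le> phi (E0 - A) + 1" by (rule phi_remove_fan[OF fan AE0])
      moreover have "card (D' - D) \<le> card (D' - D1) + card A1"
      proof -
        have "card (D' - D) \<le> card ((D' - D1) \<union> A1)"
          using D'(2) fES fA1 by (intro card_mono) (auto simp: D1_def intro: finite_subset)
        then show ?thesis using card_Un_le[of "D' - D1" A1] by linarith
      qed
      ultimately have "phi E0 + card (D' - D) + 1 \<le> card E0" using D'(4) cA1 by linarith
      moreover have "D \<subseteq> D'" using D'(1) by (simp add: D1_def)
      ultimately show ?thesis using D'(2,3) by (intro exI[of _ D']) simp
    qed
  qed
  have "card {} + card (ES - {}) * (k * p + 1) \<le> 4 * b * b * (k * p + 1)"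
    using mult_le_mono1[OF cES, of "k * p + 1"] by simp
  then obtain D' where D': "D' \<subseteq> ES" "fan_free (E - D')"
    "phi E + card (D' - {}) + (if D' = {} then 0 else 1) \<le> card E"
    using claim[of "{}" "{}" E] by auto
  have "D' \<noteq> {}" using nf D'(2) by auto
  then have "phi E + card D' + 1 \<le> card E" using D'(3) by simp
  moreover have "D' \<subseteq> E" using D'(1) by (auto simp: ES_def)
  moreover have "card (E - D') = card E - card D'"
    using D'(1) fES \<open>D' \<subseteq> E\<close> by (intro card_Diff_subset) (auto intro: finite_subset)
  ultimately show ?thesis using D'(2) by (intro exI[of _ D']) auto
qed

section \<open>The strict inequality and the theorem\<close>

lemma phi_less_ex:
  "\<exists>N. \<forall>V E. finite V \<and> E \<subseteq> nsets V 2 \<and> N \<le> card V \<and> \<not> fan_free E \<longrightarrow>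
     phi E < turan p (card V) \<or> (\<exists>D\<subseteq>E. fan_free (E - D) \<and> phi E < card (E - D))"
proof -
  obtain N where N: "\<forall>V E. finite V \<and> E \<subseteq> nsets V 2 \<and> N \<le> card V \<and> turan p (card V) \<le> phi E \<longrightarrow>
     (\<exists>c. c ` V \<subseteq> {..<p} \<and> card (inner_edges c E) + card (missing_edges V c E) \<le> 2 * excess \<and>
        (\<forall>j<p. card V \<le> 2 * p * card (color_class V c j)))"
    by (rule exE[OF near_extremal_structure])
  define b where "b = 2 * excess"
  define R where "R = 2 * b + 4 * b * b * (k * p + 1) + (2 * k * p + 1) * Suc b"
  have "\<exists>D\<subseteq>E. fan_free (E - D) \<and> phi E < card (E - D)"
    if V: "finite V" and E: "E \<subseteq> nsets V 2" and n: "N + 2 * p * R + 1 \<le> card V" and nf: "\<not> fan_free E"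
      and T: "\<not> phi E < turan p (card V)" for V E
  proof -
    have "N \<le> card V" "turan p (card V) \<le> phi E" using n T by linarith+
    then have "finite V \<and> E \<subseteq> nsets V 2 \<and> N \<le> card V \<and> turan p (card V) \<le> phi E"
      using V E by simp
    from mp[OF spec[OF spec[OF N, of V], of E] this] obtain c where c: "c ` V \<subseteq> {..<p}" "card (inner_edges c E) + card (missing_edges V c E) \<le> 2 * excess"
      "\<forall>j<p. card V \<le> 2 * p * card (color_class V c j)"
      by (elim exE conjE)
    have "R < card (color_class V c j)" if "j < p" for j
    proof -
      have "card V \<le> 2 * p * card (color_class V c j)" using c(3) that by blast
      then have "2 * p * R < 2 * p * card (color_class V c j)" using n by linarith
      then show ?thesis by simp
    qed
    then have big: "2 * b + 4 * b * b * (k * p + 1) + (2 * k * p + 1) * Suc b < card (color_class V c j)"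
      if "j < p" for j
      using that unfolding R_def by blast
    have cb: "card (inner_edges c E) + card (missing_edges V c E) \<le> b" unfolding b_def by (rule c(2))
    show ?thesis by (rule phi_less_fan_free[OF V E c(1) cb big nf])
  qed
  then show ?thesis by blast
qed

text \<open>The colouring by residues attains \<open>turan\<close>, and its complete
  \<open>p\<close>-partite graph is fan-free because a fan always contains an inner edge.\<close>

lemma turan_le_ex: "turan p n \<le> ex_num n (fan k (Suc p))"
proof -
  define c where "c i = i mod p" for i :: nat
  have c: "c ` {..<n} \<subseteq> {..<p}" for n using p2 by (auto simp: c_def)
  have card: "card (cross_pairs {..<n} c) = turan p n" for n
  proof (induction n)
    case 0
    then show ?case by (simp add: cross_pairs_def nsets_empty_iff)
  next
    case (Suc n)
    let ?X = "cross_pairs {..<Suc n} c"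
    have fX: "finite ?X" by (rule finite_edges[OF _ cross_pairs_subset]) simp
    have "{e \<in> ?X. n \<notin> e} = cross_pairs {..<n} c"
      by (auto simp: cross_pairs_def nsets_def lessThan_Suc)
    then have "card ?X = turan p n + deg ?X n"
      using card_eq_without_vertex[OF fX, of n] Suc by simp
    moreover have "deg ?X n + card (color_class {..<Suc n} c (c n)) = Suc n"
      using deg_cross_pairs[of "{..<Suc n}" n c] by simp
    moreover have "card (color_class {..<Suc n} c (c n)) = Suc (n div p)"
    proof -
      have "color_class {..<Suc n} c (c n) = (\<lambda>i. n mod p + i * p) ` {..n div p}"
      proof (intro equalityI subsetI)
        fix i assume "i \<in> color_class {..<Suc n} c (c n)"
        then have i: "i \<le> n" "i mod p = n mod p" by (auto simp: color_class_def c_def)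
        have "i = n mod p + (i div p) * p" using i(2) by (metis add.commute div_mult_mod_eq)
        moreover have "i div p \<le> n div p" using i(1) by (rule div_le_mono)
        ultimately show "i \<in> (\<lambda>i. n mod p + i * p) ` {..n div p}" by blast
      next
        fix i assume "i \<in> (\<lambda>i. n mod p + i * p) ` {..n div p}"
        then obtain d where d: "d \<le> n div p" "i = n mod p + d * p" by auto
        have "d * p \<le> (n div p) * p" using d(1) by (rule mult_le_mono1)
        then have "i \<le> n" using d(2) by (metis add_le_cancel_left mod_div_mult_eq)
        then show "i \<in> color_class {..<Suc n} c (c n)" using d(2) by (simp add: color_class_def c_def)
      qed
      moreover have "inj_on (\<lambda>i. n mod p + i * p) {..n div p}" using p2 by (auto simp: inj_on_def)
      ultimately show ?thesis by (simp add: card_image)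
    qed
    ultimately show ?case by (simp add: turan_Suc)
  qed
  let ?G = "({..<n}, cross_pairs {..<n} c)"
  have "?G \<in> graphs_on n" by (simp add: graphs_on_def simple_graph_def cross_pairs_subset)
  moreover have "\<not> contains_graph ?G (fan k (Suc p))"
  proof
    assume "contains_graph ?G (fan k (Suc p))"
    then have "\<not> fan_free (cross_pairs {..<n} c)" by (rule contains_fanD)
    then obtain x Q where Q: "petals k p x Q" "fan_edges x Q \<subseteq> cross_pairs {..<n} c"
      by (auto simp: fan_free_def is_fan_def)
    then have "\<exists>e\<in>fan_edges x Q. mono_edge c e"
      using cross_pairs_subset by (intro fan_inner_edge[OF Q(1) _ c]) blast
    then show False using Q(2) by (auto simp: cross_pairs_def)
  qed
  moreover note edges_fan_nonempty
  moreover have "turan p n = card (edges ?G)" using card by simp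
  ultimately show ?thesis
    unfolding ex_num_def by (intro Max_ge ex_num_set(1)) blast+
qed

end

theorem theorem3:
  fixes k r :: nat
  assumes "k \<ge> 2" and "r \<ge> 3"
  shows "\<exists>n1. \<forall>n\<ge>n1.
           phi_num n (fan k r) = ex_num n (fan k r) \<and>
           (\<forall>G\<in>graphs_on n.
              phi_graph G (fan k r) = ex_num n (fan k r) \<longleftrightarrow> extremal_graph n (fan k r) G)"
proof -
  define p where "p = r - 1"
  have r: "r = Suc p" using assms by (simp add: p_def)
  interpret fan_setting k p by unfold_locales (use assms r in auto)
  let ?F = "fan k (Suc p)"
  obtain N where N: "\<forall>V E. finite V \<and> E \<subseteq> nsets V 2 \<and> N \<le> card V \<and> \<not> fan_free E \<longrightarrow>
     phi E < turan p (card V) \<or> (\<exists>D\<subseteq>E. fan_free (E - D) \<and> phi E < card (E - D))"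
    by (rule exE[OF phi_less_ex])
  note ne = edges_fan_nonempty
  have ex_ge: "card (edges G) \<le> ex_num n ?F" if "G \<in> graphs_on n" "\<not> contains_graph G ?F" for n G
  proof -
    have "card (edges G) \<in> {card (edges G) | G. G \<in> graphs_on n \<and> \<not> contains_graph G ?F}"
      using that by blast
    then show ?thesis unfolding ex_num_def by (rule Max_ge[OF ex_num_set(1)[OF ne]])
  qed
  have ph_eq: "phi_graph G ?F = card (edges G)" if "G \<in> graphs_on n" "\<not> contains_graph G ?F" for n G
    using phi_eq_card[of "verts G" "edges G"] that by (simp add: phi_graph_eq graphs_on_def)
  \<comment> \<open>Strictness for every graph containing a fan settles both claims, since for all
    other graphs \<open>phi_graph\<close> is the number of edges.\<close>
  have lt: "phi_graph G ?F < ex_num n ?F" if n: "N \<le> n" and G: "G \<in> graphs_on n" "contains_graph G ?F" for n G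
  proof -
    have V: "finite (verts G)" and E: "edges G \<subseteq> nsets (verts G) 2" and cV: "card (verts G) = n"
      using G by (auto simp: graphs_on_def simple_graph_def)
    have "\<not> fan_free (edges G)" using contains_fanD[of "verts G" "edges G"] G by simp
    then have "finite (verts G) \<and> edges G \<subseteq> nsets (verts G) 2 \<and> N \<le> card (verts G) \<and> \<not> fan_free (edges G)"
      using V E cV n by simp
    from mp[OF spec[OF spec[OF N, of "verts G"], of "edges G"] this]
    consider "phi (edges G) < turan p n"
      | D where "D \<subseteq> edges G" "fan_free (edges G - D)" "phi (edges G) < card (edges G - D)"
      unfolding cV by blast
    then show ?thesis
    proof cases
      case 1
      then show ?thesis using turan_le_ex[of n] by (simp add: phi_graph_eq)
    next
      case 2
      let ?G' = "(verts G, edges G - D)"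
      have "?G' \<in> graphs_on n" using V E cV by (auto simp: graphs_on_def simple_graph_def)
      moreover have "\<not> contains_graph ?G' ?F" using 2(2) contains_fanD by blast
      ultimately have "card (edges G - D) \<le> ex_num n ?F" using ex_ge[of ?G'] by simp
      then show ?thesis using 2(3) by (simp add: phi_graph_eq)
    qed
  qed
  have "phi_num n ?F = ex_num n ?F \<and>
      (\<forall>G\<in>graphs_on n. phi_graph G ?F = ex_num n ?F \<longleftrightarrow> extremal_graph n ?F G)" if n: "N \<le> n" for n
  proof
    have "ex_num n ?F \<in> {card (edges G) | G. G \<in> graphs_on n \<and> \<not> contains_graph G ?F}"
      unfolding ex_num_def using ex_num_set[OF ne] by (rule Max_in)
    then obtain G0 where G0: "G0 \<in> graphs_on n" "\<not> contains_graph G0 ?F" "ex_num n ?F = card (edges G0)"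
      by auto
    have "phi_graph G0 ?F = ex_num n ?F" using ph_eq G0 by simp
    then have mem: "ex_num n ?F \<in> {phi_graph G ?F | G. G \<in> graphs_on n}" using G0(1) by (intro CollectI exI[of _ G0]) simp
    have le: "phi_graph G ?F \<le> ex_num n ?F" if "G \<in> graphs_on n" for G
      using lt[OF n that] ph_eq[OF that] ex_ge[OF that] by (cases "contains_graph G ?F") auto
    show "phi_num n ?F = ex_num n ?F"
      unfolding phi_num_def
    proof (rule Max_eqI[OF phi_num_set(1)])
      show "ex_num n ?F \<in> {phi_graph G ?F | G. G \<in> graphs_on n}" by (rule mem)
    qed (use le in blast)
    show "\<forall>G\<in>graphs_on n. phi_graph G ?F = ex_num n ?F \<longleftrightarrow> extremal_graph n ?F G"
    proof
      fix G assume G: "G \<in> graphs_on n"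
      show "phi_graph G ?F = ex_num n ?F \<longleftrightarrow> extremal_graph n ?F G"
        using lt[OF n G] ph_eq[OF G] G unfolding extremal_graph_def
        by (cases "contains_graph G ?F") auto
    qed
  qed
  then show ?thesis unfolding r by blast
qed

end
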